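(* If $G$ is a cograph, then $\gamma_{gR}(G)$ can be computed in linear time; that is, there is an algorithm which, given a cograph $G$, computes $\gamma_{gR}(G)$ in time linear in the size of $G$.
   Context: All graphs are finite, simple and undirected. A Roman dominating function of a graph $G=(V,E)$ is a labeling $f:V\to\{0,1,2\}$ such that every vertex $u$ with $f(u)=0$ has a neighbour $v$ with $f(v)=2$. A global Roman dominating function of $G$ is a function that is a Roman dominating function of both $G$ and its complement $\overline{G}$. The weight of $f$ is $\sum_{u\in V}f(u)$, and $\gamma_{gR}(G)$ is the minimum weight of a global Roman dominating function of $G$. A cograph is a graph that contains no induced path on four vertices. *)

theory Defs
  imports Main
begin

section \<open>Graphs, cographs and global Roman domination\<close>

definition simple_graph :: "'a set \<Rightarrow> 'a set set \<Rightarrow> bool" where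
  "simple_graph V E \<longleftrightarrow>
     finite V \<and> (\<forall>e\<in>E. \<exists>u\<in>V. \<exists>v\<in>V. u \<noteq> v \<and> e = {u, v})"

definition complement_edges :: "'a set \<Rightarrow> 'a set set \<Rightarrow> 'a set set" where
  "complement_edges V E = {{u, v} | u v. u \<in> V \<and> v \<in> V \<and> u \<noteq> v \<and> {u, v} \<notin> E}"

definition induced_path :: "'a set \<Rightarrow> 'a set set \<Rightarrow> nat \<Rightarrow> (nat \<Rightarrow> 'a) \<Rightarrow> bool" where
  "induced_path V E k p \<longleftrightarrow>
     p ` {..<k} \<subseteq> V \<and> inj_on p {..<k} \<and>
     (\<forall>i<k. \<forall>j<k. {p i, p j} \<in> E \<longleftrightarrow> j = Suc i \<or> i = Suc j)"

definition cograph :: "'a set \<Rightarrow> 'a set set \<Rightarrow> bool" where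
  "cograph V E \<longleftrightarrow> simple_graph V E \<and> \<not> (\<exists>p. induced_path V E 4 p)"

definition roman_dominating :: "'a set \<Rightarrow> 'a set set \<Rightarrow> ('a \<Rightarrow> nat) \<Rightarrow> bool" where
  "roman_dominating V E f \<longleftrightarrow>
     (\<forall>u\<in>V. f u \<in> {0, 1, 2}) \<and>
     (\<forall>u\<in>V. f u = 0 \<longrightarrow> (\<exists>v\<in>V. {u, v} \<in> E \<and> f v = 2))"

definition global_roman_dominating :: "'a set \<Rightarrow> 'a set set \<Rightarrow> ('a \<Rightarrow> nat) \<Rightarrow> bool" where
  "global_roman_dominating V E f \<longleftrightarrow>
     roman_dominating V E f \<and> roman_dominating V (complement_edges V E) f"

text \<open>The constant labelling 1 is always global Roman dominating, so the minimum exists.\<close>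

definition global_roman_number :: "'a set \<Rightarrow> 'a set set \<Rightarrow> nat" where
  "global_roman_number V E =
     (LEAST k. \<exists>f. global_roman_dominating V E f \<and> (\<Sum>u\<in>V. f u) = k)"


section \<open>A word RAM\<close>

text \<open>
  A program is a finite list of instructions acting on registers and on a random access memory.
  Every instruction costs one time unit. Arithmetic is modulo \<open>2 ^ w\<close>, where \<open>w\<close> is the
  word length, since unit cost on unbounded numbers would not be realistic.
\<close>

datatype instr =
    Const nat nat      \<comment> \<open>\<open>R[i] := c\<close>\<close>
  | Move nat nat       \<comment> \<open>\<open>R[i] := R[j]\<close>\<close>
  | Add nat nat nat    \<comment> \<open>\<open>R[i] := R[j] + R[k]\<close>\<close>
  | Sub nat nat nat    \<comment> \<open>\<open>R[i] := R[j] - R[k]\<close>\<close>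
  | Load nat nat       \<comment> \<open>\<open>R[i] := M[R[j]]\<close>\<close>
  | Store nat nat      \<comment> \<open>\<open>M[R[i]] := R[j]\<close>\<close>
  | Jump nat
  | JumpLess nat nat nat  \<comment> \<open>if \<open>R[i] < R[j]\<close> then go to instruction \<open>l\<close>\<close>

text \<open>Program counter, registers, memory.\<close>

type_synonym config = "nat \<times> (nat \<Rightarrow> nat) \<times> (nat \<Rightarrow> nat)"

fun exec :: "nat \<Rightarrow> instr \<Rightarrow> config \<Rightarrow> config" where
  "exec w (Const i c) (pc, R, M) = (Suc pc, R(i := c mod 2 ^ w), M)"
| "exec w (Move i j) (pc, R, M) = (Suc pc, R(i := R j), M)"
| "exec w (Add i j k) (pc, R, M) = (Suc pc, R(i := (R j + R k) mod 2 ^ w), M)"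
| "exec w (Sub i j k) (pc, R, M) =
     (Suc pc, R(i := nat ((int (R j) - int (R k)) mod 2 ^ w)), M)"
| "exec w (Load i j) (pc, R, M) = (Suc pc, R(i := M (R j)), M)"
| "exec w (Store i j) (pc, R, M) = (Suc pc, R, M(R i := R j))"
| "exec w (Jump l) (pc, R, M) = (l, R, M)"
| "exec w (JumpLess i j l) (pc, R, M) = (if R i < R j then l else Suc pc, R, M)"

text \<open>A program halts when the program counter leaves the program.\<close>

definition halted :: "instr list \<Rightarrow> config \<Rightarrow> bool" where
  "halted P s \<longleftrightarrow> length P \<le> fst s"

definition step :: "nat \<Rightarrow> instr list \<Rightarrow> config \<Rightarrow> config" where
  "step w P s = (if halted P s then s else exec w (P ! fst s) s)"

definition initial_config :: "nat list \<Rightarrow> config" where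
  "initial_config xs = (0, \<lambda>_. 0, \<lambda>a. if a < length xs then xs ! a else 0)"

text \<open>The output is the final content of register 0.\<close>

definition outputs_within :: "nat \<Rightarrow> instr list \<Rightarrow> nat list \<Rightarrow> nat \<Rightarrow> nat \<Rightarrow> bool" where
  "outputs_within w P xs T y \<longleftrightarrow>
     (\<exists>t\<le>T. let s = (step w P ^^ t) (initial_config xs)
            in halted P s \<and> fst (snd s) 0 = y)"


section \<open>Graph parameters computable in linear time\<close>

text \<open>
  As the input of an algorithm, a graph has vertex set \<open>{..<n}\<close> and is given by adjacency lists,
  each in an arbitrary order.
\<close>

definition adjacency_lists :: "nat \<Rightarrow> nat set set \<Rightarrow> nat list list \<Rightarrow> bool" where
  "adjacency_lists n E adj \<longleftrightarrow>
     length adj = n \<and>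
     (\<forall>u<n. distinct (adj ! u) \<and> set (adj ! u) = {v. v < n \<and> {u, v} \<in> E})"

text \<open>
  The memory image: cell 0 holds \<open>n\<close>, and the neighbours of \<open>u\<close> occupy the cells from the address
  stored in cell \<open>u + 1\<close> up to, but excluding, the address stored in cell \<open>u + 2\<close>.
\<close>

definition encode :: "nat list list \<Rightarrow> nat list" where
  "encode adj =
     length adj
     # map (\<lambda>u. length adj + 2 + length (concat (take u adj))) [0..<Suc (length adj)]
     @ concat adj"

text \<open>
  A single program must work for all inputs from the class, on every machine whose words
  have at least \<open>log\<^sub>2 (\<bar>V\<bar> + \<bar>E\<bar> + 1) + O(1)\<close> bits, in time \<open>O(\<bar>V\<bar> + \<bar>E\<bar> + 1)\<close>; the
  summand 1 only matters for the graph without vertices. Nothing is required on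
  inputs outside the class.
\<close>

definition linear_time_computable ::
    "(nat set \<Rightarrow> nat set set \<Rightarrow> bool) \<Rightarrow> (nat set \<Rightarrow> nat set set \<Rightarrow> nat) \<Rightarrow> bool" where
  "linear_time_computable \<C> \<pi> \<longleftrightarrow>
     (\<exists>P c d. \<forall>n E adj w.
        \<C> {..<n} E \<longrightarrow> adjacency_lists n E adj \<longrightarrow> d * (n + card E + 1) \<le> 2 ^ w \<longrightarrow>
        outputs_within w P (encode adj) (c * (n + card E + 1)) (\<pi> {..<n} E))"

end

theory Submission
  imports Defs
begin

text \<open>
  Write \<open>F\<close> for a graph with connected components \<open>C\<close>, at least two of which have an edge. A cheapest
  Roman dominating function of \<open>F\<close> can be chosen separately on the components, with a label 2 in every
  component that has an edge. A vertex labelled 0 then has a neighbour labelled 2 in its own component and a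
  non-neighbour labelled 2 in another one, so the labelling is global, and the minimum weight is the sum of
  the Roman domination numbers of the components. For cographs these are easy: a connected cograph with an
  edge is a join, so two labels 2, one on each side, dominate it, and for a weight below 4 it is best to put a
  single label 2 on a vertex of maximum degree and 1 on its non-neighbours. This gives
  \<open>min 4 (\<bar>C\<bar> - \<Delta>(C) + 1)\<close>, while an isolated vertex costs 1. If \<open>F\<close> has no edges, all labels are 1.

  If only one component \<open>C\<close> has an edge, all the other vertices are isolated and get label 1 in a labelling
  that attains the sum. Such a labelling is global only if \<open>C\<close> itself supplies the non-neighbours labelled 2,
  and this happens exactly when \<open>C\<close> has two vertices or has cost 4 and contains two vertices such that every
  other vertex of \<open>C\<close> is adjacent to exactly one of them. Otherwise raising an isolated vertex to 2 costs one
  more, which is optimal. The theorem \<open>Least_weight\<close> collects these cases. Since global Roman domination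
  does not change under complementation and a cograph with at least two vertices or its complement
  is disconnected, \<open>F\<close> may be taken to be the graph or its complement.

  Linear time needs no cotree. Without an induced path on four vertices, any two vertices of a component
  are at distance at most 2, so replacing the label of every vertex by the minimum over its closed
  neighbourhood, twice, starting from the identity, labels every vertex with the least vertex of its component.
  For the complement the minimum runs over the non-neighbours. It is found by walking through the sorted list
  of the values that occur: a value is useless only if it is used up by neighbours, so \<open>deg v + 1\<close> probes suffice
  (\<open>Min_among_first_values\<close>). Component sizes and maximum degrees then give the sum. In a pair as above, one of
  the two vertices may be replaced by any vertex of minimum degree (\<open>splitting_pair_min_degree\<close>), so only one
  vertex has to be tested against all others, and the test is an equation between degrees and the number
  of common neighbours (\<open>splitting_pair_iff_card\<close>).

  The program is written in a small language with arrays and counted loops. Its weakest preconditions contain a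
  clock, so a loop invariant bounds the running time together with the result, and \<open>compile_correct\<close>
  transfers both to the word RAM.
\<close>

section \<open>Cographs\<close>

definition compl_rel :: "'a set \<Rightarrow> ('a \<Rightarrow> 'a \<Rightarrow> bool) \<Rightarrow> 'a \<Rightarrow> 'a \<Rightarrow> bool" where
  "compl_rel V r u v \<longleftrightarrow> u \<in> V \<and> v \<in> V \<and> u \<noteq> v \<and> \<not> r u v"

text \<open>Global Roman domination for an adjacency relation, in which a graph and its complement play the same role.\<close>

definition global_rd :: "'a set \<Rightarrow> ('a \<Rightarrow> 'a \<Rightarrow> bool) \<Rightarrow> ('a \<Rightarrow> nat) \<Rightarrow> bool" where
  "global_rd V r f \<longleftrightarrow> (\<forall>u\<in>V. f u \<le> 2) \<and>
     (\<forall>u\<in>V. f u = 0 \<longrightarrow> (\<exists>v\<in>V. r u v \<and> f v = 2) \<and> (\<exists>v\<in>V. compl_rel V r u v \<and> f v = 2))"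

text \<open>Distance at most 2, which in a cograph amounts to lying in the same component.\<close>

definition near :: "('a \<Rightarrow> 'a \<Rightarrow> bool) \<Rightarrow> 'a \<Rightarrow> 'a \<Rightarrow> bool" where
  "near r u v \<longleftrightarrow> u = v \<or> r u v \<or> (\<exists>w. r u w \<and> r w v)"

text \<open>With adjacency for \<open>P\<close> this says that the graph on \<open>X\<close> is a join, with non-adjacency that it is
  disconnected. Connectedness is expressed by the absence of such a partition, which avoids paths.\<close>

definition splits :: "('a \<Rightarrow> 'a \<Rightarrow> bool) \<Rightarrow> 'a set \<Rightarrow> bool" where
  "splits P X \<longleftrightarrow> (\<exists>A B. A \<noteq> {} \<and> B \<noteq> {} \<and> A \<inter> B = {} \<and> A \<union> B = X \<and> (\<forall>a\<in>A. \<forall>b\<in>B. P a b))"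

lemma splits_cong:
  assumes "\<And>a b. a \<in> X \<Longrightarrow> b \<in> X \<Longrightarrow> a \<noteq> b \<Longrightarrow> P a b \<longleftrightarrow> Q a b"
  shows "splits P X \<longleftrightarrow> splits Q X"
proof -
  have "(\<forall>a\<in>A. \<forall>b\<in>B. P a b) \<longleftrightarrow> (\<forall>a\<in>A. \<forall>b\<in>B. Q a b)" if "A \<inter> B = {}" "A \<union> B = X" for A B
    using assms that by (metis UnCI disjoint_iff)
  then show ?thesis unfolding splits_def by (intro ex_cong1 conj_cong refl)
qed

lemma splitsI:
  "A \<noteq> {} \<Longrightarrow> B \<noteq> {} \<Longrightarrow> A \<inter> B = {} \<Longrightarrow> A \<union> B = X \<Longrightarrow> (\<And>a b. a \<in> A \<Longrightarrow> b \<in> B \<Longrightarrow> P a b) \<Longrightarrow> splits P X"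
  unfolding splits_def by (intro exI[of _ A] exI[of _ B] conjI ballI)

text \<open>If some of the four vertices in \<open>p4_free\<close> coincide, then its conclusion holds in every simple graph, so the
  axiom excludes exactly the induced paths on four vertices.\<close>

locale cograph_rel =
  fixes V :: "'a set" and r :: "'a \<Rightarrow> 'a \<Rightarrow> bool"
  assumes fin: "finite V"
    and in_V: "r u v \<Longrightarrow> u \<in> V"
    and r_sym: "r u v \<Longrightarrow> r v u"
    and irrefl: "\<not> r u u"
    and p4_free: "r a b \<Longrightarrow> r b c \<Longrightarrow> r c d \<Longrightarrow> r a c \<or> r b d \<or> r a d"
begin

lemma in_V': "r u v \<Longrightarrow> v \<in> V"
  using in_V r_sym by blast

text \<open>The complement of an induced path on four vertices is again such a path.\<close>

lemma cograph_rel_complement: "cograph_rel V (compl_rel V r)"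
proof
  fix a b c d
  assume h: "compl_rel V r a b" "compl_rel V r b c" "compl_rel V r c d"
  show "compl_rel V r a c \<or> compl_rel V r b d \<or> compl_rel V r a d"
  proof (rule ccontr)
    assume n: "\<not> ?thesis"
    have "r a c" "r b d" "r a d" using h n r_sym unfolding compl_rel_def by metis+
    then show False using h p4_free[of c a d b] r_sym unfolding compl_rel_def by blast
  qed
qed (auto simp: compl_rel_def fin dest: r_sym)

lemma near_sym: "near r u v \<Longrightarrow> near r v u"
  unfolding near_def using r_sym by blast

text \<open>A shortest path with three edges would be an induced path on four vertices.\<close>

lemma near_step: assumes "near r u v" "r v w" shows "near r u w"
proof -
  consider "u = v" | "r u v" | x where "r u x" "r x v" using assms(1) unfolding near_def by blast
  then show ?thesis
  proof cases
    case 3 then show ?thesis using p4_free[OF 3 assms(2)] assms(2) unfolding near_def by blast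
  qed (use assms(2) in \<open>auto simp: near_def\<close>)
qed

lemma near_trans: assumes "near r u v" "near r v w" shows "near r u w"
proof -
  consider "v = w" | "r v w" | x where "r v x" "r x w" using assms(2) unfolding near_def by blast
  then show ?thesis using assms(1) by cases (auto intro: near_step)
qed

text \<open>The vertex \<open>v\<close> is joined to both sides of a disconnected graph but misses a vertex of \<open>A\<close>. The
  non-neighbours of \<open>v\<close> in \<open>A\<close> then form a union of components: an edge from such a vertex \<open>y\<close> to a neighbour
  \<open>z\<close> of \<open>v\<close> in \<open>A\<close> would give the induced path \<open>y, z, v, u\<close>.\<close>

lemma splits_insert_aux:
  assumes X: "insert v (A \<union> B) \<subseteq> V" "v \<notin> A \<union> B" "A \<inter> B = {}" "B \<noteq> {}"
    and sep: "\<And>a b. a \<in> A \<Longrightarrow> b \<in> B \<Longrightarrow> \<not> r a b"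
    and x: "x \<in> A" "\<not> r v x"
    and u: "u \<in> B" "r v u"
  shows "splits (\<lambda>a b. \<not> r a b) (insert v (A \<union> B))"
proof (rule splitsI[of "{y\<in>A. \<not> r v y}" "insert v ({y\<in>A. r v y} \<union> B)"])
  fix y z assume y: "y \<in> {y\<in>A. \<not> r v y}" and z: "z \<in> insert v ({y\<in>A. r v y} \<union> B)"
  show "\<not> r y z"
  proof
    assume yz: "r y z"
    then have zA: "z \<in> A" "r v z" using y z sep r_sym by auto
    have "r y v \<or> r z u \<or> r y u" using p4_free[OF yz r_sym[OF zA(2)] u(2)] .
    then show False using y zA u sep r_sym by blast
  qed
qed (use X x in auto)

lemma splits_insert:
  assumes X: "insert v X \<subseteq> V" "v \<notin> X" and s: "splits (\<lambda>a b. \<not> r a b) X"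
  shows "splits (\<lambda>a b. \<not> r a b) (insert v X) \<or> splits r (insert v X)"
proof -
  obtain A B where AB: "A \<noteq> {}" "B \<noteq> {}" "A \<inter> B = {}" "A \<union> B = X"
    and sep: "\<And>a b. a \<in> A \<Longrightarrow> b \<in> B \<Longrightarrow> \<not> r a b" using s unfolding splits_def by blast
  have sep': "\<And>a b. a \<in> B \<Longrightarrow> b \<in> A \<Longrightarrow> \<not> r a b" using sep r_sym by blast
  consider "\<And>a. a \<in> A \<Longrightarrow> \<not> r v a" | "\<And>b. b \<in> B \<Longrightarrow> \<not> r v b" | "\<And>x. x \<in> X \<Longrightarrow> r v x"
    | a b x where "a \<in> A" "r v a" "b \<in> B" "r v b" "x \<in> X" "\<not> r v x" by blast
  then show ?thesis
  proof cases
    case 1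
    have "splits (\<lambda>a b. \<not> r a b) (insert v X)"
    proof (rule splitsI[of A "insert v B"])
      show "\<And>a b. a \<in> A \<Longrightarrow> b \<in> insert v B \<Longrightarrow> \<not> r a b" using sep r_sym 1 by blast
    qed (use AB X in auto)
    then show ?thesis ..
  next
    case 2
    have "splits (\<lambda>a b. \<not> r a b) (insert v X)"
    proof (rule splitsI[of "insert v A" B])
      show "\<And>a b. a \<in> insert v A \<Longrightarrow> b \<in> B \<Longrightarrow> \<not> r a b" using sep 2 by blast
    qed (use AB X in auto)
    then show ?thesis ..
  next
    case 3
    have "splits r (insert v X)"
      by (rule splitsI[of "{v}" X]) (use AB X 3 in auto)
    then show ?thesis ..
  next
    case 4
    have "splits (\<lambda>a b. \<not> r a b) (insert v X)"
    proof (cases "x \<in> A")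
      case True
      show ?thesis using splits_insert_aux[of v A B x b] AB X sep 4 True by auto
    next
      case False
      then show ?thesis using splits_insert_aux[of v B A x a] AB X sep' 4 by (auto simp: Un_commute)
    qed
    then show ?thesis ..
  qed
qed

lemma splits_compl_iff:
  assumes "X \<subseteq> V"
  shows "splits (compl_rel V r) X \<longleftrightarrow> splits (\<lambda>a b. \<not> r a b) X"
    and "splits (\<lambda>a b. \<not> compl_rel V r a b) X \<longleftrightarrow> splits r X"
  using assms by (auto simp: compl_rel_def intro!: splits_cong)

end

text \<open>
  A cograph with at least two vertices or its complement is disconnected. A new vertex preserves this if the
  old graph is disconnected, by \<open>splits_insert\<close>; the case of a join is the same statement about the complement.
\<close>

lemma (in cograph_rel) cograph_splits:
  assumes "X \<subseteq> V" "2 \<le> card X"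
  shows "splits (\<lambda>a b. \<not> r a b) X \<or> splits r X"
proof -
  have "finite X" using assms(1) fin by (rule finite_subset)
  then show ?thesis using assms
  proof (induction X)
    case empty then show ?case by simp
  next
    case (insert v X)
    interpret c: cograph_rel V "compl_rel V r" by (rule cograph_rel_complement)
    show ?case
    proof (cases "2 \<le> card X")
      case True
      then have "splits (\<lambda>a b. \<not> r a b) X \<or> splits r X" using insert by auto
      then show ?thesis
      proof
        assume "splits (\<lambda>a b. \<not> r a b) X"
        then show ?thesis using splits_insert insert by blast
      next
        assume "splits r X"
        then have "splits (\<lambda>a b. \<not> compl_rel V r a b) X" using splits_compl_iff insert by blast
        then show ?thesis using c.splits_insert[of v X] splits_compl_iff[of "insert v X"] insert by blast
      qed
    next
      case False
      then have "card X = 1" using insert by auto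
      then obtain x where "X = {x}" by (auto simp: card_1_singleton_iff)
      then show ?thesis
        using splitsI[of "{v}" "{x}" "insert v X" r] splitsI[of "{v}" "{x}" "insert v X" "\<lambda>a b. \<not> r a b"] insert
        by auto
    qed
  qed
qed

section \<open>The weight of a cheapest labelling\<close>

text \<open>The Roman domination number of a connected cograph with \<open>s\<close> vertices and maximum degree \<open>m\<close>.\<close>

definition cost :: "nat \<Rightarrow> nat \<Rightarrow> nat" where
  "cost s m = (if s < 2 then 1 else min 4 (Suc (s - m)))"

text \<open>The components are the fibres of \<open>ld\<close>. A component is indexed by its label and not by its set of vertices
  because labels are what a program computes.\<close>

locale cograph_components = cograph_rel V r for V :: "'a set" and r +
  fixes ld :: "'a \<Rightarrow> 'b"
  assumes ld_eq_iff: "u \<in> V \<Longrightarrow> v \<in> V \<Longrightarrow> ld u = ld v \<longleftrightarrow> near r u v"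
begin

definition block :: "'b \<Rightarrow> 'a set" where
  "block t = {v \<in> V. ld v = t}"

definition degree :: "'a \<Rightarrow> nat" where
  "degree v = card {u. r v u}"

definition block_cost :: "'b \<Rightarrow> nat" where
  "block_cost t = cost (card (block t)) (Max (degree ` block t))"

definition big :: "'b set" where
  "big = {t \<in> ld ` V. 2 \<le> card (block t)}"

definition total_cost :: nat where
  "total_cost = (\<Sum>t\<in>ld ` V. block_cost t)"

lemma finite_block [simp]: "finite (block t)"
  using fin unfolding block_def by simp

lemma block_nonempty: "t \<in> ld ` V \<Longrightarrow> block t \<noteq> {}"
  unfolding block_def by auto

lemma block_subset: "block t \<subseteq> V" unfolding block_def by auto

lemma adj_same_block: "r u v \<Longrightarrow> u \<in> block t \<longleftrightarrow> v \<in> block t"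
  using ld_eq_iff[of u v] in_V in_V' unfolding block_def near_def by auto

lemma nbrs_subset: "v \<in> block t \<Longrightarrow> {u. r v u} \<subseteq> block t - {v}"
  using adj_same_block irrefl by blast

lemma degree_less: "v \<in> block t \<Longrightarrow> degree v < card (block t)"
  unfolding degree_def using nbrs_subset[of v t]
  by (intro psubset_card_mono) auto

lemma finite_nbrs [simp]: "finite {u. r v u}"
  by (rule finite_subset[OF _ fin]) (auto intro: in_V')

text \<open>A common neighbour of two vertices lies in their component, so it cannot lie outside both parts.\<close>

lemma block_connected: "\<not> splits (\<lambda>a b. \<not> r a b) (block t)"
proof
  assume "splits (\<lambda>a b. \<not> r a b) (block t)"
  then obtain A B a b where AB: "A \<union> B = block t" "\<And>a b. a \<in> A \<Longrightarrow> b \<in> B \<Longrightarrow> \<not> r a b"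
    "a \<in> A" "b \<in> B" "A \<inter> B = {}" unfolding splits_def by blast
  have V: "a \<in> V" "b \<in> V" and "near r a b"
    using AB ld_eq_iff[of a b] unfolding block_def by auto
  then consider "r a b" | w where "r a w" "r w b" using AB unfolding near_def by blast
  then show False
  proof cases
    case 2
    then have "w \<in> A \<union> B" using adj_same_block AB by blast
    then show False using 2 AB by blast
  qed (use AB in blast)
qed

lemma block_join:
  assumes "2 \<le> card (block t)"
  obtains A B where "A \<noteq> {}" "B \<noteq> {}" "A \<inter> B = {}" "A \<union> B = block t"
    "\<forall>a\<in>A. \<forall>b\<in>B. r a b \<and> r b a"
proof -
  have "splits r (block t)" using cograph_splits[OF block_subset assms] block_connected by blast
  then show ?thesis using that r_sym unfolding splits_def by meson
qed

lemma degree_le_Max: "v \<in> block t \<Longrightarrow> degree v \<le> Max (degree ` block t)"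
  by simp

lemma Max_degree_attained:
  assumes "t \<in> ld ` V" obtains x where "x \<in> block t" "degree x = Max (degree ` block t)"
proof -
  have "Max (degree ` block t) \<in> degree ` block t" using block_nonempty[OF assms] by (intro Max_in) auto
  then show ?thesis using that by (metis imageE)
qed

lemma card_le_degree: "(\<And>u. u \<in> A \<Longrightarrow> r v u) \<Longrightarrow> card A \<le> degree v"
  unfolding degree_def by (intro card_mono) auto

text \<open>In a join, every vertex of one side is adjacent to the whole other side.\<close>

lemma card_block_le_Max_degree:
  assumes "2 \<le> card (block t)" shows "card (block t) \<le> 2 * Max (degree ` block t)"
proof -
  obtain A B where AB: "A \<noteq> {}" "B \<noteq> {}" "A \<inter> B = {}" "A \<union> B = block t"
    "\<forall>a\<in>A. \<forall>b\<in>B. r a b \<and> r b a" using block_join[OF assms] by metis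
  obtain a b where ab: "a \<in> A" "b \<in> B" using AB by blast
  then have "a \<in> block t" "b \<in> block t" using AB by auto
  then have "degree a \<le> Max (degree ` block t)" "degree b \<le> Max (degree ` block t)"
    by (auto intro: degree_le_Max)
  moreover have "card B \<le> degree a" "card A \<le> degree b" using AB ab by (auto intro!: card_le_degree)
  moreover have "finite A" "finite B" using AB finite_block[of t] by (metis finite_Un)+
  then have "card (block t) = card A + card B" using AB card_Un_disjoint by metis
  ultimately show ?thesis by linarith
qed

lemma block_cost_le_card:
  assumes "t \<in> ld ` V" shows "block_cost t \<le> card (block t)"
proof (cases "card (block t) < 2")
  case True then show ?thesis using block_nonempty[OF assms]
    by (simp add: block_cost_def cost_def Suc_le_eq card_gt_0_iff)
next
  case False
  then show ?thesis using card_block_le_Max_degree[of t] unfolding block_cost_def cost_def by auto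
qed

text \<open>If there is no label 0, the weight is at least the number of vertices. Otherwise some \<open>x\<close> has label 2. If
  the other vertices have total weight \<open>e < 2\<close>, then \<open>x\<close> is the only vertex labelled 2, so it is adjacent to all vertices
  labelled 0, and at most \<open>e\<close> other vertices are not labelled 0. Hence \<open>x\<close> has degree at
  least \<open>card (block t) - 1 - e\<close>.\<close>

lemma block_cost_le_weight:
  assumes t: "t \<in> ld ` V"
    and dom: "\<And>u. u \<in> block t \<Longrightarrow> f u = (0::nat) \<Longrightarrow> \<exists>v. r u v \<and> f v = 2"
  shows "block_cost t \<le> (\<Sum>u\<in>block t. f u)"
proof (cases "\<exists>z\<in>block t. f z = 0")
  case False
  then have "card (block t) \<le> (\<Sum>u\<in>block t. f u)"
    using sum_mono[of "block t" "\<lambda>_. 1" f] by (auto simp: Suc_le_eq)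
  then show ?thesis using block_cost_le_card[OF t] by simp
next
  case True
  then obtain z x where z: "z \<in> block t" "f z = 0" "r z x" "f x = 2" using dom by blast
  then have x: "x \<in> block t" "x \<noteq> z" using adj_same_block[of z x t] irrefl[of x] by auto
  define e where "e = (\<Sum>u\<in>block t - {x}. f u)"
  have w: "(\<Sum>u\<in>block t. f u) = 2 + e" using sum.remove[of "block t" x f] x z by (simp add: e_def)
  have two: "2 \<le> card (block t)" using card_mono[of "block t" "{x,z}"] x z by simp
  show ?thesis
  proof (cases "e \<ge> 2")
    case True then show ?thesis using w two by (simp add: block_cost_def cost_def)
  next
    case False
    have only: "v = x" if "v \<in> block t" "f v = 2" for v
    proof (rule ccontr)
      assume "v \<noteq> x"
      then have "f v \<le> e" unfolding e_def using that by (intro member_le_sum) auto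
      then show False using False that by simp
    qed
    have zeros: "r x u" if u: "u \<in> block t" "f u = 0" for u
    proof -
      obtain v where v: "r u v" "f v = 2" using dom[OF u] by blast
      then have "v = x" using only adj_same_block[OF v(1)] u by blast
      then show ?thesis using v r_sym by blast
    qed
    let ?Z = "{u \<in> block t - {x}. f u = 0}" and ?P = "{u \<in> block t - {x}. f u \<noteq> 0}"
    have "card ?P \<le> (\<Sum>u\<in>?P. f u)" using sum_mono[of ?P "\<lambda>_. 1" f] by (auto simp: Suc_le_eq)
    also have "\<dots> \<le> e" unfolding e_def by (intro sum_mono2) auto
    finally have P: "card ?P \<le> e" .
    have "card ?Z + card ?P = card (?Z \<union> ?P)" by (rule card_Un_disjoint[symmetric]) auto
    also have "?Z \<union> ?P = block t - {x}" by auto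
    also have "card \<dots> = card (block t) - 1" using x by simp
    finally have "card (block t) \<le> card ?Z + e + 1" using P two by linarith
    moreover have "card ?Z \<le> degree x" using zeros by (intro card_le_degree) auto
    ultimately have "card (block t) - Max (degree ` block t) \<le> e + 1"
      using degree_le_Max[OF x(1)] by linarith
    then show ?thesis using w two by (simp add: block_cost_def cost_def)
  qed
qed

text \<open>Either one label 2 on a vertex \<open>x\<close> of maximum degree and labels 1 on the set \<open>Z\<close> of its non-neighbours, or, if
  \<open>Z\<close> is large, one label 2 on each side of a join.\<close>

lemma block_cost_attained:
  assumes t: "t \<in> ld ` V"
  shows "\<exists>g. (\<forall>u\<in>block t. g u \<le> 2) \<and> (\<forall>u\<in>block t. g u = 0 \<longrightarrow> (\<exists>v\<in>block t. r u v \<and> g v = 2)) \<and>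
     (\<Sum>u\<in>block t. g u) = block_cost t \<and> (2 \<le> card (block t) \<longrightarrow> (\<exists>x\<in>block t. g x = (2::nat)))"
proof (cases "2 \<le> card (block t)")
  case False
  then have "card (block t) = 1" using block_nonempty[OF t] by (simp add: not_le less_2_cases_iff)
  then show ?thesis by (intro exI[of _ "\<lambda>_. 1"]) (auto simp: block_cost_def cost_def)
next
  case True
  obtain x where x: "x \<in> block t" "degree x = Max (degree ` block t)" using Max_degree_attained[OF t] .
  define Z where "Z = block t - {x} - {u. r x u}"
  have Zc: "card Z = card (block t) - 1 - degree x"
    unfolding Z_def degree_def using x(1) nbrs_subset[OF x(1)] by (simp add: card_Diff_subset)
  show ?thesis
  proof (cases "card Z \<le> 2")
    case le: True
    define g where "g u = (if u = x then 2 else if u \<in> Z then 1 else (0::nat))" for u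
    have "(\<Sum>u\<in>block t. g u) = g x + (\<Sum>u\<in>block t - {x}. g u)" using x by (intro sum.remove) auto
    also have "(\<Sum>u\<in>block t - {x}. g u) = (\<Sum>u\<in>block t - {x}. if u \<in> Z then 1 else 0)"
      by (intro sum.cong) (auto simp: g_def)
    also have "\<dots> = card ((block t - {x}) \<inter> Z)" by (simp add: sum.If_cases)
    also have "(block t - {x}) \<inter> Z = Z" unfolding Z_def by auto
    finally have "(\<Sum>u\<in>block t. g u) = 2 + card Z" by (simp add: g_def)
    moreover have "block_cost t = 2 + card Z"
      unfolding block_cost_def cost_def using True le Zc x degree_less[OF x(1)] by simp
    moreover have "\<forall>u\<in>block t. g u = 0 \<longrightarrow> (\<exists>v\<in>block t. r u v \<and> g v = 2)"
      using x r_sym by (auto simp: g_def Z_def split: if_splits)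
    ultimately show ?thesis using x by (intro exI[of _ g]) (auto simp: g_def)
  next
    case gt: False
    obtain A B where AB: "A \<noteq> {}" "B \<noteq> {}" "A \<inter> B = {}" "A \<union> B = block t"
      "\<forall>a\<in>A. \<forall>b\<in>B. r a b \<and> r b a"
      using block_join[OF True] by blast
    obtain a b where ab: "a \<in> A" "b \<in> B" using AB by blast
    define g where "g u = (if u \<in> {a,b} then 2 else (0::nat))" for u
    have ab': "a \<noteq> b" "a \<in> block t" "b \<in> block t" using ab AB by auto
    have "(\<Sum>u\<in>block t. g u) = (\<Sum>u\<in>block t \<inter> {a,b}. 2)"
      unfolding g_def by (rule sum.inter_restrict[symmetric]) simp
    also have "block t \<inter> {a,b} = {a,b}" using ab' by blast
    also have "(\<Sum>u\<in>{a,b}. 2::nat) = 4" using ab' by simp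
    finally have "(\<Sum>u\<in>block t. g u) = 4" .
    moreover have "block_cost t = 4"
      unfolding block_cost_def cost_def using True gt Zc x by simp
    moreover have "\<exists>v\<in>block t. r u v \<and> g v = 2" if "u \<in> block t" for u
    proof -
      have "g a = 2" "g b = 2" by (auto simp: g_def)
      moreover have "u \<in> A \<or> u \<in> B" using that AB by blast
      ultimately show ?thesis using ab ab' AB by blast
    qed
    ultimately show ?thesis using ab' by (intro exI[of _ g]) (auto simp: g_def)
  qed
qed

lemma sum_blocks: "(\<Sum>u\<in>V. f u) = (\<Sum>t\<in>ld ` V. \<Sum>u\<in>block t. (f u :: nat))"
  using sum.image_gen[OF fin, of f ld] unfolding block_def by simp

lemma block_cost_le_global_rd_weight:
  assumes "global_rd V r f" "t \<in> ld ` V" shows "block_cost t \<le> (\<Sum>u\<in>block t. f u)"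
proof (rule block_cost_le_weight[OF assms(2)])
  fix u assume "u \<in> block t" "f u = 0"
  then show "\<exists>v. r u v \<and> f v = 2" using assms(1) block_subset unfolding global_rd_def by blast
qed

lemma total_le_weight: "global_rd V r f \<Longrightarrow> total_cost \<le> (\<Sum>u\<in>V. f u)"
  unfolding total_cost_def sum_blocks by (intro sum_mono block_cost_le_global_rd_weight)

lemma near_optimal_labelling:
  obtains F :: "'a \<Rightarrow> nat" where "\<And>u. u \<in> V \<Longrightarrow> F u \<le> 2"
    "\<And>u. u \<in> V \<Longrightarrow> F u = 0 \<Longrightarrow> \<exists>v\<in>V. r u v \<and> F v = 2"
    "\<And>t. t \<in> ld ` V \<Longrightarrow> (\<Sum>u\<in>block t. F u) = block_cost t"
    "\<And>t. t \<in> big \<Longrightarrow> \<exists>x\<in>block t. F x = 2"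
proof -
  define ok where "ok t g \<longleftrightarrow> (\<forall>u\<in>block t. g u \<le> 2) \<and> (\<forall>u\<in>block t. g u = 0 \<longrightarrow> (\<exists>v\<in>block t. r u v \<and> g v = 2)) \<and>
     (\<Sum>u\<in>block t. g u) = block_cost t \<and> (2 \<le> card (block t) \<longrightarrow> (\<exists>x\<in>block t. g x = (2::nat)))" for t g
  have "\<forall>t\<in>ld ` V. \<exists>g. ok t g" using block_cost_attained unfolding ok_def by blast
  then obtain G where G: "\<And>t. t \<in> ld ` V \<Longrightarrow> ok t (G t)" by metis
  define F where "F u = G (ld u) u" for u
  have F: "F u = G t u" if "u \<in> block t" for u t using that unfolding F_def block_def by simp
  have okF: "ok t F" if "t \<in> ld ` V" for t
  proof -
    have "ok t F = ok t (G t)" unfolding ok_def using F by (auto cong: sum.cong)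
    then show ?thesis using G that by simp
  qed
  show ?thesis
  proof (rule that[of F])
    fix u assume u: "u \<in> V"
    then have "u \<in> block (ld u)" "ok (ld u) F" using okF by (auto simp: block_def)
    then show "F u \<le> 2" "F u = 0 \<Longrightarrow> \<exists>v\<in>V. r u v \<and> F v = 2"
      using block_subset unfolding ok_def by blast+
  qed (use okF in \<open>auto simp: ok_def big_def\<close>)
qed

lemma compl_relI_blocks: "u \<in> block t \<Longrightarrow> v \<in> block t' \<Longrightarrow> t \<noteq> t' \<Longrightarrow> compl_rel V r u v"
  unfolding compl_rel_def using adj_same_block[of u v] block_subset by (auto simp: block_def)

lemma adj_in_big: assumes "r u v" shows "ld u \<in> big"
proof -
  have "u \<in> block (ld u)" "v \<in> block (ld u)"
    using assms adj_same_block in_V by (auto simp: block_def)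
  then have "card {u,v} \<le> card (block (ld u))" by (intro card_mono) auto
  moreover have "card {u,v} = 2" using assms irrefl by (auto simp: card_insert_if)
  ultimately show ?thesis using in_V[OF assms] by (auto simp: big_def)
qed

text \<open>Two components with a label 2 supply each other's vertices with non-neighbours labelled 2.\<close>

lemma total_attained:
  assumes "card big \<noteq> 1" shows "\<exists>f. global_rd V r f \<and> (\<Sum>u\<in>V. f u) = total_cost"
proof -
  obtain F :: "'a \<Rightarrow> nat" where F: "\<And>u. u \<in> V \<Longrightarrow> F u \<le> 2"
    "\<And>u. u \<in> V \<Longrightarrow> F u = 0 \<Longrightarrow> \<exists>v\<in>V. r u v \<and> F v = 2"
    "\<And>t. t \<in> ld ` V \<Longrightarrow> (\<Sum>u\<in>block t. F u) = block_cost t"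
    "\<And>t. t \<in> big \<Longrightarrow> \<exists>x\<in>block t. F x = 2" using near_optimal_labelling by blast
  have "\<exists>v\<in>V. compl_rel V r u v \<and> F v = 2" if u: "u \<in> V" "F u = 0" for u
  proof -
    have b: "ld u \<in> big" using F(2)[OF u] adj_in_big by blast
    have "big \<noteq> {ld u}" using assms by auto
    then obtain t where t: "t \<in> big" "t \<noteq> ld u" using b by blast
    obtain x where "x \<in> block t" "F x = 2" using F(4)[OF t(1)] by blast
    then show ?thesis using compl_relI_blocks[of u "ld u" x t] u t block_subset by (auto simp: block_def)
  qed
  then have "global_rd V r F" using F unfolding global_rd_def by blast
  moreover have "(\<Sum>u\<in>V. F u) = total_cost" unfolding sum_blocks total_cost_def using F(3) by simp
  ultimately show ?thesis by blast
qed

lemma small_block: assumes "t \<in> ld ` V" "t \<notin> big" obtains y where "block t = {y}" "block_cost t = 1"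
proof -
  have "card (block t) < 2" using assms by (auto simp: big_def)
  then have "card (block t) = 1" using block_nonempty[OF assms(1)] by (simp add: less_2_cases_iff)
  then show ?thesis using that by (auto simp: card_1_singleton_iff block_cost_def cost_def)
qed

text \<open>An isolated vertex whose label is raised from 1 to 2 is a non-neighbour of all vertices labelled 0.\<close>

lemma Suc_total_attained:
  assumes b: "big = {t}" and k: "ld ` V \<noteq> {t}"
  shows "\<exists>f. global_rd V r f \<and> (\<Sum>u\<in>V. f u) = Suc total_cost"
proof -
  obtain F :: "'a \<Rightarrow> nat" where F: "\<And>u. u \<in> V \<Longrightarrow> F u \<le> 2"
    "\<And>u. u \<in> V \<Longrightarrow> F u = 0 \<Longrightarrow> \<exists>v\<in>V. r u v \<and> F v = 2"
    "\<And>t. t \<in> ld ` V \<Longrightarrow> (\<Sum>u\<in>block t. F u) = block_cost t"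
    "\<And>t. t \<in> big \<Longrightarrow> \<exists>x\<in>block t. F x = 2" using near_optimal_labelling by blast
  obtain t' where t': "t' \<in> ld ` V" "t' \<notin> big" using b k by (auto simp: big_def)
  then obtain y where y: "block t' = {y}" "block_cost t' = 1" by (rule small_block)
  then have yV: "y \<in> V" "ld y = t'" and Fy: "F y = 1" using F(3)[OF t'(1)] by (auto simp: block_def)
  define f where "f = F(y := 2)"
  have two: "f v = 2" if "F v = 2" for v using that by (simp add: f_def)
  have "global_rd V r f" unfolding global_rd_def
  proof (intro conjI ballI impI)
    fix u assume u: "u \<in> V"
    show "f u \<le> 2" using F(1)[OF u] by (simp add: f_def)
    assume f0: "f u = 0"
    then have u0: "F u = 0" "u \<noteq> y" by (auto simp: f_def split: if_splits)
    then obtain v where v: "v \<in> V" "r u v" "F v = 2" using F(2) u by blast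
    then show "\<exists>v\<in>V. r u v \<and> f v = 2" using two by blast
    have "ld u \<in> big" using adj_in_big v by blast
    then have "ld u \<noteq> t'" using t' by metis
    then have "compl_rel V r u y" using compl_relI_blocks[of u "ld u" y t'] u y by (auto simp: block_def)
    then show "\<exists>v\<in>V. compl_rel V r u v \<and> f v = 2" using yV by (auto simp: f_def)
  qed
  moreover have "(\<Sum>u\<in>V. f u) = Suc total_cost"
  proof -
    have "(\<Sum>u\<in>V. f u) = f y + (\<Sum>u\<in>V - {y}. f u)" using yV fin by (intro sum.remove)
    also have "(\<Sum>u\<in>V - {y}. f u) = (\<Sum>u\<in>V - {y}. F u)" by (intro sum.cong) (auto simp: f_def)
    finally have "(\<Sum>u\<in>V. f u) = Suc (F y + (\<Sum>u\<in>V - {y}. F u))" using Fy by (simp add: f_def)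
    also have "F y + (\<Sum>u\<in>V - {y}. F u) = (\<Sum>u\<in>V. F u)" using yV fin by (intro sum.remove[symmetric])
    also have "\<dots> = total_cost" unfolding sum_blocks total_cost_def using F(3) by simp
    finally show ?thesis .
  qed
  ultimately show ?thesis by blast
qed

text \<open>Two labels 2 that on their own form a global labelling of a component whose other labels are 0.\<close>

definition splitting_pair :: "'b \<Rightarrow> 'a \<Rightarrow> 'a \<Rightarrow> bool" where
  "splitting_pair t x y \<longleftrightarrow> x \<in> block t \<and> y \<in> block t \<and> x \<noteq> y \<and> (\<forall>u\<in>block t - {x, y}. r x u \<longleftrightarrow> \<not> r y u)"

text \<open>A labelling that attains the sum attains the cost on every component. Isolated vertices have cost 1, so all labels
  2 lie in the only big component. If it has no label 0, its cost is its number of vertices, which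
  forces two vertices. If it has a vertex \<open>z\<close> labelled 0, then a neighbour and a non-neighbour of \<open>z\<close> are labelled 2 and
  use up the largest possible cost 4.\<close>

lemma total_attained_only_if:
  assumes b: "big = {t}" and f: "global_rd V r f" "(\<Sum>u\<in>V. f u) = total_cost"
  shows "card (block t) = 2 \<or> (block_cost t = 4 \<and> (\<exists>x y. splitting_pair t x y))"
proof -
  have t: "t \<in> ld ` V" "2 \<le> card (block t)" using b by (auto simp: big_def)
  have le: "block_cost s \<le> (\<Sum>u\<in>block s. f u)" if "s \<in> ld ` V" for s
    using block_cost_le_global_rd_weight[OF f(1) that] .
  have eq: "(\<Sum>u\<in>block s. f u) = block_cost s" if "s \<in> ld ` V" for s
  proof (rule ccontr)
    assume "(\<Sum>u\<in>block s. f u) \<noteq> block_cost s"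
    then have "block_cost s < (\<Sum>u\<in>block s. f u)" using le[OF that] by simp
    then have "total_cost < (\<Sum>s\<in>ld ` V. \<Sum>u\<in>block s. f u)"
      unfolding total_cost_def using le that fin by (intro sum_strict_mono_ex1) auto
    then show False using f(2) by (simp add: sum_blocks)
  qed
  have out: "v \<in> block t" if "v \<in> V" "f v = 2" for v
  proof (rule ccontr)
    assume "v \<notin> block t"
    then have "ld v \<in> ld ` V" "ld v \<notin> big" using that b by (auto simp: block_def)
    moreover then obtain y where "block (ld v) = {y}" "block_cost (ld v) = 1" by (rule small_block)
    moreover then have "y = v" using that by (auto simp: block_def)
    ultimately show False using eq[of "ld v"] that by simp
  qed
  have c4: "block_cost t \<le> 4" using t by (simp add: block_cost_def cost_def)
  show ?thesis
  proof (cases "\<exists>z\<in>block t. f z = 0")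
    case False
    then have "card (block t) \<le> (\<Sum>u\<in>block t. f u)"
      using sum_mono[of "block t" "\<lambda>_. 1" f] by (auto simp: Suc_le_eq)
    then have c: "card (block t) \<le> block_cost t" using eq t by simp
    show ?thesis using c card_block_le_Max_degree[OF t(2)] t unfolding block_cost_def cost_def by auto
  next
    case True
    then obtain z where z: "z \<in> block t" "f z = 0" by blast
    then have zV: "z \<in> V" using block_subset by blast
    then obtain x y where x: "x \<in> V" "r z x" "f x = 2" and y: "y \<in> V" "compl_rel V r z y" "f y = 2"
      using f z unfolding global_rd_def by blast
    have xy: "x \<in> block t" "y \<in> block t" "x \<noteq> y" using out x y by (auto simp: compl_rel_def)
    have "(\<Sum>u\<in>block t. f u) = f x + (\<Sum>u\<in>block t - {x}. f u)" using xy by (intro sum.remove) auto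
    also have "(\<Sum>u\<in>block t - {x}. f u) = f y + (\<Sum>u\<in>block t - {x} - {y}. f u)" using xy by (intro sum.remove) auto
    finally have s: "block_cost t = 4 + (\<Sum>u\<in>block t - {x} - {y}. f u)" using eq t x y by simp
    have c: "block_cost t = 4" and s0: "(\<Sum>u\<in>block t - {x} - {y}. f u) = 0" using s c4 by auto
    have zero: "f u = 0" if "u \<in> block t - {x,y}" for u
      using s0 that by (subst (asm) sum_eq_0_iff) auto
    have two: "v \<in> {x,y}" if "v \<in> V" "f v = 2" for v using out[OF that] zero[of v] that by auto
    have "r x u \<longleftrightarrow> \<not> r y u" if u: "u \<in> block t - {x,y}" for u
    proof -
      have uV: "u \<in> V" using u block_subset by blast
      then obtain v1 v2 where "v1 \<in> V" "r u v1" "f v1 = 2" "v2 \<in> V" "compl_rel V r u v2" "f v2 = 2"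
        using f zero[OF u] unfolding global_rd_def by blast
      then show ?thesis using two[of v1] two[of v2] r_sym unfolding compl_rel_def by blast
    qed
    then have "splitting_pair t x y" using xy unfolding splitting_pair_def by blast
    then show ?thesis using c by blast
  qed
qed

text \<open>With two vertices in the big component, all labels can be 1.\<close>

lemma total_attained_if:
  assumes b: "big = {t}" and s: "card (block t) = 2 \<or> (block_cost t = 4 \<and> splitting_pair t x y)"
  shows "\<exists>f. global_rd V r f \<and> (\<Sum>u\<in>V. f u) = total_cost"
proof -
  have t: "t \<in> ld ` V" "2 \<le> card (block t)" using b by (auto simp: big_def)
  have one: "(\<Sum>u\<in>block s. 1) = block_cost s" if s': "s \<in> ld ` V" "s \<noteq> t" for s
  proof -
    have "s \<notin> big" using b s'(2) by blast
    then obtain y where "block s = {y}" "block_cost s = 1" using small_block[OF s'(1)] by metis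
    then show ?thesis by simp
  qed
  from s show ?thesis
  proof
    assume c: "card (block t) = 2"
    obtain x where "x \<in> block t" "degree x = Max (degree ` block t)" using Max_degree_attained[OF t(1)] .
    then have "block_cost t = 2"
      using degree_less[of x t] block_cost_le_card[OF t(1)] c by (auto simp: block_cost_def cost_def)
    then have "(\<Sum>u\<in>block s. 1) = block_cost s" if "s \<in> ld ` V" for s using one[OF that] c by (cases "s = t") auto
    then have "(\<Sum>u\<in>V. 1) = total_cost" unfolding sum_blocks[of "\<lambda>_. 1"] total_cost_def by simp
    moreover have "global_rd V r (\<lambda>_. 1)" unfolding global_rd_def by auto
    ultimately show ?thesis by blast
  next
    assume p: "block_cost t = 4 \<and> splitting_pair t x y"
    define f where "f u = (if u \<in> block t then if u \<in> {x,y} then 2 else 0 else (1::nat))" for u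
    have xy: "x \<in> block t" "y \<in> block t" "x \<noteq> y" "f x = 2" "f y = 2" "x \<in> V" "y \<in> V"
      using p block_subset by (auto simp: splitting_pair_def f_def)
    have "(\<Sum>u\<in>block s. f u) = block_cost s" if s: "s \<in> ld ` V" for s
    proof (cases "s = t")
      case True
      have "(\<Sum>u\<in>block t. f u) = (\<Sum>u\<in>block t. if u \<in> {x,y} then 2 else 0)"
        by (intro sum.cong) (auto simp: f_def)
      also have "\<dots> = (\<Sum>u\<in>block t \<inter> {x,y}. 2)"
        by (rule sum.inter_restrict[symmetric]) simp
      also have "block t \<inter> {x,y} = {x,y}" using xy by auto
      finally show ?thesis using p True xy by simp
    next
      case False
      then have "(\<Sum>u\<in>block s. f u) = (\<Sum>u\<in>block s. 1)" by (intro sum.cong) (auto simp: f_def block_def)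
      then show ?thesis using one[OF s False] by simp
    qed
    then have "(\<Sum>u\<in>V. f u) = total_cost" unfolding sum_blocks[of f] total_cost_def by simp
    moreover have "global_rd V r f" unfolding global_rd_def
    proof (intro conjI ballI impI)
      fix u assume u: "u \<in> V"
      show "f u \<le> 2" by (simp add: f_def)
      assume "f u = 0"
      then have uB: "u \<in> block t - {x,y}" by (auto simp: f_def split: if_splits)
      then have e: "r x u \<longleftrightarrow> \<not> r y u" using p by (auto simp: splitting_pair_def)
      have c: "compl_rel V r u v \<longleftrightarrow> \<not> r v u" if "v \<in> {x,y}" for v
        using that u uB xy r_sym unfolding compl_rel_def by auto
      show "\<exists>v\<in>V. r u v \<and> f v = 2" using e r_sym xy by blast
      show "\<exists>v\<in>V. compl_rel V r u v \<and> f v = 2" using e c xy by blast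
    qed
    ultimately show ?thesis by blast
  qed
qed

text \<open>The component is the join of two sides \<open>A\<close> and \<open>B\<close>, and a splitting pair has one vertex on each side, since two
  vertices of \<open>A\<close> would both be adjacent to all of \<open>B\<close>. Therefore each of the two is isolated within its own side,
  so it has the least degree on its side. A vertex of least degree in the component is then also isolated within its side
  and can replace the vertex of the pair on that side.\<close>

lemma splitting_pair_min_degree:
  assumes a: "a \<in> block t" and amin: "\<And>v. v \<in> block t \<Longrightarrow> degree a \<le> degree v"
    and p: "splitting_pair t x y"
  shows "\<exists>y. splitting_pair t a y"
proof -
  have xy: "x \<in> block t" "y \<in> block t" "x \<noteq> y" and one: "\<And>u. u \<in> block t - {x,y} \<Longrightarrow> r x u \<longleftrightarrow> \<not> r y u"
    using p by (auto simp: splitting_pair_def)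
  have "card {x,y} \<le> card (block t)" using xy by (intro card_mono) auto
  then have "2 \<le> card (block t)" using xy by simp
  then obtain A B where AB: "A \<noteq> {}" "B \<noteq> {}" "A \<inter> B = {}" "A \<union> B = block t"
    "\<forall>a\<in>A. \<forall>b\<in>B. r a b \<and> r b a" using block_join by metis
  have key: "splitting_pair t a y'"
    if AB: "A \<inter> B = {}" "A \<union> B = block t" "\<forall>a\<in>A. \<forall>b\<in>B. r a b \<and> r b a"
    and x': "x' \<in> A" "y' \<in> B" "a \<in> A" and one': "\<And>u. u \<in> block t - {x',y'} \<Longrightarrow> r x' u \<longleftrightarrow> \<not> r y' u" for A B x' y'
  proof -
    have xA: "\<not> r x' u" if u: "u \<in> A" for u
    proof (cases "u = x'")
      case False
      then have "u \<in> block t - {x', y'}" using AB(1,2) u x'(2) by blast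
      moreover have "r y' u" using AB(3) u x'(2) by blast
      ultimately show ?thesis using one' by blast
    qed (simp add: irrefl)
    have yB: "\<not> r y' u" if u: "u \<in> B" for u
    proof (cases "u = y'")
      case False
      then have "u \<in> block t - {x', y'}" using AB(1,2) u x'(1) by blast
      moreover have "r x' u" using AB(3) u x'(1) by blast
      ultimately show ?thesis using one' by blast
    qed (simp add: irrefl)
    have "x' \<in> block t" using AB(2) x'(1) by blast
    then have "{u. r x' u} \<subseteq> A \<union> B" unfolding AB(2) by (rule nbrs_subset[THEN subset_trans]) blast
    then have nx: "{u. r x' u} = B" using xA AB(3) x'(1) by blast
    have na: "B \<subseteq> {u. r a u}" using AB x' by blast
    have "card {u. r a u} \<le> card B" using amin[OF \<open>x' \<in> block t\<close>] nx unfolding degree_def by simp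
    then have "B = {u. r a u}" using na by (intro card_seteq) auto
    then have "r a u \<longleftrightarrow> \<not> r y' u" if "u \<in> block t - {a, y'}" for u
      using that AB yB x' by blast
    then show ?thesis using AB x' unfolding splitting_pair_def by blast
  qed
  have "\<not> (x \<in> A \<and> y \<in> A)" "\<not> (x \<in> B \<and> y \<in> B)" using one AB by blast+
  then consider "x \<in> A" "y \<in> B" | "x \<in> B" "y \<in> A" using xy AB by blast
  moreover have one2: "\<And>u. u \<in> block t - {y,x} \<Longrightarrow> r y u \<longleftrightarrow> \<not> r x u" using one by blast
  moreover have "a \<in> A \<or> a \<in> B" using a AB by blast
  ultimately show ?thesis
    using key[of A B x y] key[of A B y x] key[of B A x y] key[of B A y x] AB one by blast
qed

theorem Least_weight:
  assumes k: "\<And>t. big = {t} \<Longrightarrow> ld ` V \<noteq> {t}"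
  shows "(LEAST k. \<exists>f. global_rd V r f \<and> (\<Sum>u\<in>V. f u) = k) =
    (if \<exists>t. big = {t} \<and> card (block t) \<noteq> 2 \<and> (block_cost t = 4 \<longrightarrow> (\<nexists>x y. splitting_pair t x y))
     then Suc total_cost else total_cost)"
proof (cases "\<exists>t. big = {t} \<and> card (block t) \<noteq> 2 \<and> (block_cost t = 4 \<longrightarrow> (\<nexists>x y. splitting_pair t x y))")
  case True
  then obtain t where t: "big = {t}" "card (block t) \<noteq> 2"
    "block_cost t = 4 \<longrightarrow> (\<nexists>x y. splitting_pair t x y)" by blast
  have "(LEAST k. \<exists>f. global_rd V r f \<and> (\<Sum>u\<in>V. f u) = k) = Suc total_cost"
  proof (rule Least_equality)
    show "\<exists>f. global_rd V r f \<and> (\<Sum>u\<in>V. f u) = Suc total_cost" using Suc_total_attained[OF t(1) k[OF t(1)]] .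
    fix m assume "\<exists>f. global_rd V r f \<and> (\<Sum>u\<in>V. f u) = m"
    then obtain f where f: "global_rd V r f" "(\<Sum>u\<in>V. f u) = m" by blast
    then have "total_cost \<le> m" "m \<noteq> total_cost" using total_le_weight total_attained_only_if[OF t(1), of f] t by auto
    then show "Suc total_cost \<le> m" by simp
  qed
  then show ?thesis using True by simp
next
  case False
  have "\<exists>f. global_rd V r f \<and> (\<Sum>u\<in>V. f u) = total_cost"
  proof (cases "card big = 1")
    case True
    then obtain t where t: "big = {t}" by (auto simp: card_1_singleton_iff)
    then obtain x y where "card (block t) = 2 \<or> (block_cost t = 4 \<and> splitting_pair t x y)" using False by blast
    then show ?thesis by (rule total_attained_if[OF t])
  qed (rule total_attained)
  then have "(LEAST k. \<exists>f. global_rd V r f \<and> (\<Sum>u\<in>V. f u) = k) = total_cost"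
    by (intro Least_equality) (use total_le_weight in auto)
  then show ?thesis using False by simp
qed

end

section \<open>A structured language and its weakest preconditions\<close>

text \<open>\<open>Get x k y\<close> reads cell \<open>y\<close> of array \<open>k\<close> into register \<open>x\<close>, and \<open>Put k y z\<close> writes register \<open>z\<close> to it.
  \<open>For x y z c\<close> runs \<open>c\<close> with \<open>x\<close> counting from the value of \<open>y\<close> up to, but excluding, that of \<open>z\<close>.\<close>

datatype com =
    SetC nat nat
  | Copy nat nat
  | Plus nat nat nat
  | Minus nat nat nat
  | Get nat nat nat
  | Put nat nat nat
  | Seq com com  (infixr \<open>;;\<close> 60)
  | IfLt nat nat com com
  | For nat nat nat com

type_synonym assn = "(nat \<Rightarrow> nat) \<Rightarrow> (nat \<Rightarrow> nat \<Rightarrow> nat) \<Rightarrow> nat \<Rightarrow> bool"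

text \<open>The last argument of an assertion is a clock. The preconditions also exclude overflow (values stay below
  \<open>W\<close>), negative differences, and array accesses beyond the common array length \<open>L\<close>, so that registers can be
  treated as natural numbers. The number of rounds of a loop is fixed when it is entered.
  The clock may run faster than the machine.\<close>

primrec wp :: "nat \<Rightarrow> nat \<Rightarrow> com \<Rightarrow> assn \<Rightarrow> assn" where
  "wp L W (SetC x c) Q = (\<lambda>R A t. c < W \<and> Q (R(x := c)) A (t + 1))"
| "wp L W (Copy x y) Q = (\<lambda>R A t. Q (R(x := R y)) A (t + 1))"
| "wp L W (Plus x y z) Q = (\<lambda>R A t. R y + R z < W \<and> Q (R(x := R y + R z)) A (t + 1))"
| "wp L W (Minus x y z) Q = (\<lambda>R A t. R z \<le> R y \<and> Q (R(x := R y - R z)) A (t + 1))"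
| "wp L W (Get x k y) Q = (\<lambda>R A t. R y < L \<and> Q (R(x := A k (R y))) A (t + 2))"
| "wp L W (Put k y z) Q = (\<lambda>R A t. R y < L \<and> Q R (A(k := (A k)(R y := R z))) (t + 2))"
| "wp L W (Seq c d) Q = wp L W c (wp L W d Q)"
| "wp L W (IfLt y z c d) Q =
     (\<lambda>R A t. if R y < R z then wp L W c Q R A (t + 2) else wp L W d Q R A (t + 2))"
| "wp L W (For x y z c) Q =
     (\<lambda>R A t. ((\<lambda>P. wp L W c (\<lambda>R A t. P (R(x := Suc (R x))) A (t + 3))) ^^ (R z - R y)) Q
        (R(x := R y)) A (t + 3))"

primrec mods :: "com \<Rightarrow> nat set" where
  "mods (SetC x c) = {x}"
| "mods (Copy x y) = {x}"
| "mods (Plus x y z) = {x}"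
| "mods (Minus x y z) = {x}"
| "mods (Get x k y) = {x}"
| "mods (Put k y z) = {}"
| "mods (Seq c d) = mods c \<union> mods d"
| "mods (IfLt y z c d) = mods c \<union> mods d"
| "mods (For x y z c) = insert x (mods c)"

primrec puts :: "com \<Rightarrow> nat set" where
  "puts (SetC x c) = {}"
| "puts (Copy x y) = {}"
| "puts (Plus x y z) = {}"
| "puts (Minus x y z) = {}"
| "puts (Get x k y) = {}"
| "puts (Put k y z) = {k}"
| "puts (Seq c d) = puts c \<union> puts d"
| "puts (IfLt y z c d) = puts c \<union> puts d"
| "puts (For x y z c) = puts c"

abbreviation num_regs :: nat where "num_regs \<equiv> 32"
abbreviation num_arrays :: nat where "num_arrays \<equiv> 10"

text \<open>The loop conditions on \<open>x\<close> and \<open>z\<close> make the number of rounds known at entry agree with a test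
  before every round.\<close>

primrec wfc :: "com \<Rightarrow> bool" where
  "wfc (SetC x c) \<longleftrightarrow> x < num_regs"
| "wfc (Copy x y) \<longleftrightarrow> x < num_regs \<and> y < num_regs"
| "wfc (Plus x y z) \<longleftrightarrow> x < num_regs \<and> y < num_regs \<and> z < num_regs"
| "wfc (Minus x y z) \<longleftrightarrow> x < num_regs \<and> y < num_regs \<and> z < num_regs"
| "wfc (Get x k y) \<longleftrightarrow> x < num_regs \<and> k < num_arrays \<and> y < num_regs"
| "wfc (Put k y z) \<longleftrightarrow> k < num_arrays \<and> y < num_regs \<and> z < num_regs"
| "wfc (Seq c d) \<longleftrightarrow> wfc c \<and> wfc d"
| "wfc (IfLt y z c d) \<longleftrightarrow> y < num_regs \<and> z < num_regs \<and> wfc c \<and> wfc d"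
| "wfc (For x y z c) \<longleftrightarrow> x < num_regs \<and> y < num_regs \<and> z < num_regs \<and> x \<noteq> z \<and>
     x \<notin> mods c \<and> z \<notin> mods c \<and> wfc c"

lemma wp_mono:
  assumes "wp L W c Q R A t" and "\<And>R A t. Q R A t \<Longrightarrow> Q' R A t"
  shows "wp L W c Q' R A t"
  using assms
proof (induction c arbitrary: Q Q' R A t)
  case (Seq c d) then show ?case by simp
next
  case (IfLt y z c d) then show ?case by (simp split: if_splits)
next
  case (For x y z c)
  let ?F = "\<lambda>P. wp L W c (\<lambda>R A t. P (R(x := Suc (R x))) A (t + 3))"
  have "(?F ^^ m) Q' R A t" if "(?F ^^ m) Q R A t" for m R A t
    using that
  proof (induction m arbitrary: R A t)
    case 0 then show ?case using For.prems by simp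
  next
    case (Suc m) then show ?case by simp (erule For.IH, blast)
  qed
  then show ?case using For.prems by simp
qed auto

lemma wp_frame:
  assumes "wp L W c Q R A t"
  shows "wp L W c (\<lambda>R' A' t'. Q R' A' t' \<and> (\<forall>r. r \<notin> mods c \<longrightarrow> R' r = R r) \<and>
    (\<forall>k. k \<notin> puts c \<longrightarrow> A' k = A k)) R A t"
  using assms
proof (induction c arbitrary: Q R A t)
  case (Seq c d)
  from Seq.prems have "wp L W c (wp L W d Q) R A t" by simp
  from Seq.IH(1)[OF this] show ?case
    unfolding wp.simps
    by (rule wp_mono) (elim conjE, drule Seq.IH(2), erule wp_mono, simp)
next
  case (IfLt y z c d)
  show ?case
  proof (cases "R y < R z")
    case True
    then have "wp L W c Q R A (t + 2)" using IfLt.prems by simp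
    from IfLt.IH(1)[OF this] True show ?thesis by simp (erule wp_mono, simp)
  next
    case False
    then have "wp L W d Q R A (t + 2)" using IfLt.prems by simp
    from IfLt.IH(2)[OF this] False show ?thesis by simp (erule wp_mono, simp)
  qed
next
  case (For x y z c)
  let ?F = "\<lambda>P. wp L W c (\<lambda>R A t. P (R(x := Suc (R x))) A (t + 3))"
  let ?G = "\<lambda>R' A' t'. (\<forall>r. r \<notin> insert x (mods c) \<longrightarrow> R' r = R r) \<and> (\<forall>k. k \<notin> puts c \<longrightarrow> A' k = A k)"
  have "(?F ^^ m) (\<lambda>R' A' t'. Q R' A' t' \<and> ?G R' A' t') R1 A1 t1"
    if "(?F ^^ m) Q R1 A1 t1" "?G R1 A1 t1" for m R1 A1 t1
    using that
  proof (induction m arbitrary: R1 A1 t1)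
    case 0 then show ?case by simp
  next
    case (Suc m)
    have "wp L W c (\<lambda>R A t. (?F ^^ m) Q (R(x := Suc (R x))) A (t + 3)) R1 A1 t1"
      using Suc.prems(1) unfolding funpow.simps o_def .
    from For.IH[OF this] show ?case unfolding funpow.simps o_def
      by (rule wp_mono) (intro Suc.IH, use Suc.prems(2) in auto)
  qed
  then show ?case using For.prems by simp
qed auto

text \<open>Specifications mention only what a command writes; this rule adds the rest of the state.\<close>

lemma wp_conseq:
  assumes "wp L W c Q R A t"
    and "\<And>R' A' t'. Q R' A' t' \<Longrightarrow> \<forall>r. r \<notin> mods c \<longrightarrow> R' r = R r \<Longrightarrow> \<forall>k. k \<notin> puts c \<longrightarrow> A' k = A k \<Longrightarrow> Q' R' A' t'"
  shows "wp L W c Q' R A t"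
  using wp_frame[OF assms(1)] by (rule wp_mono) (use assms(2) in auto)

lemma wp_For:
  assumes x: "x \<notin> mods c" and le: "R0 y \<le> R0 z"
    and init: "I (R0 y) (R0(x := R0 y)) A0 (t0 + 3)"
    and step: "\<And>k R A t. R0 y \<le> k \<Longrightarrow> k < R0 z \<Longrightarrow> R x = k \<Longrightarrow> \<forall>r. r \<notin> insert x (mods c) \<longrightarrow> R r = R0 r \<Longrightarrow>
      \<forall>j. j \<notin> puts c \<longrightarrow> A j = A0 j \<Longrightarrow> I k R A t \<Longrightarrow>
      wp L W c (\<lambda>R A t. I (Suc k) (R(x := Suc k)) A (t + 3)) R A t"
    and fin: "\<And>R A t. R x = R0 z \<Longrightarrow> \<forall>r. r \<notin> insert x (mods c) \<longrightarrow> R r = R0 r \<Longrightarrow>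
      \<forall>j. j \<notin> puts c \<longrightarrow> A j = A0 j \<Longrightarrow> I (R0 z) R A t \<Longrightarrow> Q R A t"
  shows "wp L W (For x y z c) Q R0 A0 t0"
proof -
  let ?F = "\<lambda>P. wp L W c (\<lambda>R A t. P (R(x := Suc (R x))) A (t + 3))"
  have loop: "(?F ^^ m) Q R A t"
    if "R0 z = k + m" "R0 y \<le> k" "R x = k" "\<forall>r. r \<notin> insert x (mods c) \<longrightarrow> R r = R0 r"
      "\<forall>j. j \<notin> puts c \<longrightarrow> A j = A0 j" "I k R A t" for k m R A t
    using that
  proof (induction m arbitrary: k R A t)
    case 0 then show ?case using fin[of R A t] by simp
  next
    case (Suc m)
    have "wp L W c (\<lambda>R A t. I (Suc k) (R(x := Suc k)) A (t + 3)) R A t"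
      using Suc.prems by (intro step) auto
    then have "?F ((?F ^^ m) Q) R A t"
    proof (rule wp_conseq)
      fix R' A' t'
      assume h: "I (Suc k) (R'(x := Suc k)) A' (t' + 3)" "\<forall>r. r \<notin> mods c \<longrightarrow> R' r = R r"
        "\<forall>j. j \<notin> puts c \<longrightarrow> A' j = A j"
      have "R' x = k" using h(2) x Suc.prems(3) by simp
      moreover have "(?F ^^ m) Q (R'(x := Suc k)) A' (t' + 3)"
      proof (rule Suc.IH[of "Suc k"])
        show "I (Suc k) (R'(x := Suc k)) A' (t' + 3)" by (rule h(1))
      qed (use Suc.prems h in auto)
      ultimately show "(?F ^^ m) Q (R'(x := Suc (R' x))) A' (t' + 3)" by metis
    qed
    then show ?case unfolding funpow.simps o_def .
  qed
  show ?thesis using loop[of "R0 y" "R0 z - R0 y" "R0(x := R0 y)" A0 "t0 + 3"] le init by simp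
qed

section \<open>Compilation\<close>

text \<open>Three kinds of machine registers lie above those of the language: one holds the constant 1, one holds addresses, and the
  others hold the start addresses of the arrays. Array \<open>k\<close> occupies the cells from \<open>k * L\<close> on, so array 0 is the input.\<close>

abbreviation one_reg :: nat where "one_reg \<equiv> 32"
abbreviation addr_reg :: nat where "addr_reg \<equiv> 33"
abbreviation base_reg :: "nat \<Rightarrow> nat" where "base_reg k \<equiv> 34 + k"

primrec compile :: "com \<Rightarrow> nat \<Rightarrow> instr list" where
  "compile (SetC x c) p = [Const x c]"
| "compile (Copy x y) p = [Move x y]"
| "compile (Plus x y z) p = [Add x y z]"
| "compile (Minus x y z) p = [Sub x y z]"
| "compile (Get x k y) p = [Add addr_reg (base_reg k) y, Load x addr_reg]"
| "compile (Put k y z) p = [Add addr_reg (base_reg k) y, Store addr_reg z]"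
| "compile (Seq c d) p = (let C = compile c p in C @ compile d (p + length C))"
| "compile (IfLt y z c d) p =
    (let D = compile d (p + 1); C = compile c (p + 2 + length D)
     in JumpLess y z (p + 2 + length D) # D @ Jump (p + 2 + length D + length C) # C)"
| "compile (For x y z c) p =
    (let C = compile c (p + 3)
     in Move x y # JumpLess x z (p + 3) # Jump (p + 5 + length C) # C @ [Add x x one_reg, Jump (p + 1)])"

primrec code_at :: "instr list \<Rightarrow> nat \<Rightarrow> instr list \<Rightarrow> bool" where
  "code_at P p [] \<longleftrightarrow> True"
| "code_at P p (i # C) \<longleftrightarrow> p < length P \<and> P ! p = i \<and> code_at P (Suc p) C"

lemma code_at_append [simp]: "code_at P p (C @ D) \<longleftrightarrow> code_at P p C \<and> code_at P (p + length C) D"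
  by (induction C arbitrary: p) auto

lemma code_at_self: "code_at (B @ C @ D) (length B) C"
proof (induction C arbitrary: B)
  case (Cons i C)
  then show ?case using Cons[of "B @ [i]"] by (simp add: nth_append)
qed simp

text \<open>The argument of \<open>\<Phi>\<close> counts steps, which makes running times compose under sequential execution.\<close>

definition leads :: "nat \<Rightarrow> instr list \<Rightarrow> config \<Rightarrow> (nat \<Rightarrow> config \<Rightarrow> bool) \<Rightarrow> bool" where
  "leads w P s \<Phi> \<longleftrightarrow> (\<exists>k. \<Phi> k ((step w P ^^ k) s))"

lemma leads_now: "\<Phi> 0 s \<Longrightarrow> leads w P s \<Phi>"
  unfolding leads_def by (metis funpow_0)

lemma leads_trans:
  assumes "leads w P s \<Phi>" "\<And>k s'. \<Phi> k s' \<Longrightarrow> leads w P s' (\<lambda>j. \<Psi> (k + j))"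
  shows "leads w P s \<Psi>"
proof -
  obtain k where "\<Phi> k ((step w P ^^ k) s)" using assms(1) unfolding leads_def by blast
  from assms(2)[OF this] obtain j where "\<Psi> (k + j) ((step w P ^^ j) ((step w P ^^ k) s))"
    unfolding leads_def by blast
  moreover have "(step w P ^^ j) ((step w P ^^ k) s) = (step w P ^^ (k + j)) s"
    by (simp add: funpow_add add.commute)
  ultimately show ?thesis unfolding leads_def by auto
qed

lemma leads_step:
  assumes "p < length P" "leads w P (exec w (P ! p) (p, R, M)) (\<lambda>k. \<Phi> (Suc k))"
  shows "leads w P (p, R, M) \<Phi>"
proof (rule leads_trans[of w P _ "\<lambda>k s'. k = 1 \<and> s' = exec w (P ! p) (p, R, M)"])
  show "leads w P (p, R, M) (\<lambda>k s'. k = 1 \<and> s' = exec w (P ! p) (p, R, M))"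
    unfolding leads_def using assms(1) by (intro exI[of _ 1]) (simp add: step_def halted_def)
qed (use assms(2) in simp)

lemma leads_two_steps:
  assumes "Suc p < length P" "exec w (P ! p) (p, R, M) = (Suc p, S, N)"
    "\<Phi> 2 (exec w (P ! Suc p) (Suc p, S, N))"
  shows "leads w P (p, R, M) \<Phi>"
  using assms by (intro leads_step) (simp, simp, intro leads_step leads_now, simp_all add: numeral_2_eq_2)

lemma leads_mono: "leads w P s \<Phi> \<Longrightarrow> (\<And>k s'. \<Phi> k s' \<Longrightarrow> \<Psi> k s') \<Longrightarrow> leads w P s \<Psi>"
  unfolding leads_def by blast

definition represents ::
    "nat \<Rightarrow> nat \<Rightarrow> (nat \<Rightarrow> nat) \<Rightarrow> (nat \<Rightarrow> nat \<Rightarrow> nat) \<Rightarrow> (nat \<Rightarrow> nat) \<Rightarrow> (nat \<Rightarrow> nat) \<Rightarrow> bool" where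
  "represents L W R A R' M \<longleftrightarrow>
     (\<forall>x<num_regs. R' x = R x \<and> R x < W) \<and> R' one_reg = 1 \<and>
     (\<forall>k<num_arrays. R' (base_reg k) = k * L) \<and>
     (\<forall>k<num_arrays. \<forall>i<L. M (k * L + i) = A k i \<and> A k i < W)"

lemma represents_upd_reg:
  "represents L W R A R' M \<Longrightarrow> x < num_regs \<Longrightarrow> v < W \<Longrightarrow> represents L W (R(x := v)) A (R'(x := v)) M"
  unfolding represents_def by auto

lemma represents_addr: "represents L W R A (R'(addr_reg := v)) M \<longleftrightarrow> represents L W R A R' M"
  unfolding represents_def by auto

lemma address_inj:
  assumes "i < L" "j < L" "k * L + i = k' * L + (j::nat)" shows "k = k' \<and> i = j"
proof -
  have "(k * L + i) div L = k" "(k' * L + j) div L = k'" using assms(1,2) by auto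
  then have "k = k'" using assms(3) by simp
  then show ?thesis using assms(3) by simp
qed

lemma represents_upd_arr:
  assumes r: "represents L W R A R' M" and "k < num_arrays" "i < L" "v < W"
  shows "represents L W R (A(k := (A k)(i := v))) R' (M(k * L + i := v))"
  using assms address_inj[of _ L i _ k] unfolding represents_def by (auto simp: fun_upd_apply)

lemma address_less:
  assumes "k < num_arrays" "i < L" "num_arrays * L \<le> W" shows "k * L + i < W"
proof -
  have "k * L + i < Suc k * L" using assms(2) by simp
  also have "\<dots> \<le> num_arrays * L" using assms(1) by (intro mult_right_mono) auto
  finally show ?thesis using assms(3) by simp
qed

context
  fixes L W w :: nat and P :: "instr list"
  assumes W: "W = 2 ^ w" and LW: "num_arrays * L \<le> W"
begin

text \<open>The steps taken since clock time \<open>t\<close> are paid for by the advance of the clock.\<close>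

definition ends_at :: "nat \<Rightarrow> nat \<Rightarrow> assn \<Rightarrow> nat \<Rightarrow> config \<Rightarrow> bool" where
  "ends_at p t Q k s \<longleftrightarrow> fst s = p \<and>
     (\<exists>R A t'. represents L W R A (fst (snd s)) (snd (snd s)) \<and> Q R A t' \<and> t + k \<le> t')"

lemma ends_atI:
  "represents L W R A R' M \<Longrightarrow> Q R A t' \<Longrightarrow> t + k \<le> t' \<Longrightarrow> ends_at p t Q k (p, R', M)"
  unfolding ends_at_def by auto

lemma ends_atE:
  assumes "ends_at p t Q k s"
  obtains R A t' R' M where "s = (p, R', M)" "represents L W R A R' M" "Q R A t'" "t + k \<le> t'"
  using assms unfolding ends_at_def by (cases s) auto

lemma ends_at_mono:
  "ends_at p t Q k s \<Longrightarrow> p = p' \<Longrightarrow> t' + k' \<le> t + k \<Longrightarrow> ends_at p' t' Q k' s"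
  unfolding ends_at_def using le_trans by blast

text \<open>Induction on the command. A loop is handled by an inner induction on the number of remaining rounds, which is the
  difference of the two registers compared by the loop test.\<close>

lemma compile_correct:
  assumes "wfc c" "code_at P p (compile c p)" "represents L W R A R' M" "wp L W c Q R A t"
  shows "leads w P (p, R', M) (ends_at (p + length (compile c p)) t Q)"
  using assms
proof (induction c arbitrary: p R A t R' M Q)
  case (SetC x c)
  then have "c mod 2 ^ w = c" by (simp add: W)
  then show ?case using SetC
    by (intro leads_step leads_now) (auto intro!: ends_atI represents_upd_reg)
next
  case (Copy x y)
  then have "R' y = R y" "R y < W" by (auto simp: represents_def)
  then show ?case using Copy
    by (intro leads_step leads_now) (auto intro!: ends_atI represents_upd_reg)
next
  case (Plus x y z)
  then have "R' y = R y" "R' z = R z" "(R y + R z) mod 2 ^ w = R y + R z"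
    by (auto simp: represents_def W)
  then show ?case using Plus
    by (intro leads_step leads_now) (auto intro!: ends_atI represents_upd_reg)
next
  case (Minus x y z)
  then have r: "R' y = R y" "R' z = R z" "R y < W" "R z \<le> R y" by (auto simp: represents_def)
  then have "nat ((int (R y) - int (R z)) mod 2 ^ w) = R y - R z"
  proof -
    have "(int (R y) - int (R z)) mod 2 ^ w = int (R y) - int (R z)"
    proof (rule mod_pos_pos_trivial)
      have "int (R y) < int W" using r by simp
      also have "int W = 2 ^ w" by (simp add: W)
      finally show "int (R y) - int (R z) < 2 ^ w" by linarith
    qed (use r in simp)
    then show ?thesis by simp
  qed
  then show ?case using Minus r
    by (intro leads_step leads_now) (auto intro!: ends_atI represents_upd_reg)
next
  case (Get x k y)
  then have r: "R' y = R y" "R y < L" "R' (base_reg k) = k * L" "M (k * L + R y) = A k (R y)" "A k (R y) < W"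
    by (auto simp: represents_def)
  have "(k * L + R y) mod 2 ^ w = k * L + R y" using address_less[OF _ r(2) LW, of k] Get.prems W by simp
  then show ?case using Get r
    by (intro leads_two_steps[where S = "R'(addr_reg := k * L + R y)" and N = M])
      (auto simp: represents_addr intro!: ends_atI represents_upd_reg)
next
  case (Put k y z)
  then have r: "R' y = R y" "R y < L" "R' (base_reg k) = k * L" "R' z = R z" "R z < W" "z \<noteq> addr_reg"
    by (auto simp: represents_def)
  have "(k * L + R y) mod 2 ^ w = k * L + R y" using address_less[OF _ r(2) LW, of k] Put.prems W by simp
  then show ?case using Put r
    by (intro leads_two_steps[where S = "R'(addr_reg := k * L + R y)" and N = M])
      (auto simp: represents_addr intro!: ends_atI represents_upd_arr)
next
  case (Seq c d)
  let ?C = "compile c p"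
  from Seq.prems have "leads w P (p, R', M) (ends_at (p + length ?C) t (wp L W d Q))"
    by (intro Seq.IH) (auto simp: Let_def)
  then show ?case
  proof (rule leads_trans)
    fix k s assume "ends_at (p + length ?C) t (wp L W d Q) k s"
    then obtain R1 A1 t1 R1' M1 where s: "s = (p + length ?C, R1', M1)" "represents L W R1 A1 R1' M1"
      "wp L W d Q R1 A1 t1" "t + k \<le> t1" by (rule ends_atE)
    have "leads w P s (ends_at (p + length ?C + length (compile d (p + length ?C))) t1 Q)"
      unfolding s(1) by (rule Seq.IH) (use Seq.prems s in \<open>auto simp: Let_def\<close>)
    then show "leads w P s (\<lambda>j. ends_at (p + length (compile (Seq c d) p)) t Q (k + j))"
      by (rule leads_mono) (erule ends_at_mono, use s(4) in \<open>simp_all add: Let_def\<close>)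
  qed
next
  case (IfLt y z c d)
  let ?D = "compile d (p + 1)"
  let ?C = "compile c (p + 2 + length ?D)"
  have code: "p < length P" "P ! p = JumpLess y z (p + 2 + length ?D)" "code_at P (p + 1) ?D"
    "code_at P (p + 2 + length ?D) ?C" "p + 1 + length ?D < length P"
    "P ! (p + 1 + length ?D) = Jump (p + 2 + length ?D + length ?C)"
    using IfLt.prems(2) by (auto simp: Let_def)
  have r: "R' y = R y" "R' z = R z" using IfLt.prems by (auto simp: represents_def)
  have len: "p + length (compile (IfLt y z c d) p) = p + 2 + length ?D + length ?C" by (simp add: Let_def)
  show ?case unfolding len
  proof (rule leads_step[OF code(1)], cases "R y < R z")
    case True
    then have "leads w P (p + 2 + length ?D, R', M) (ends_at (p + 2 + length ?D + length ?C) (t + 2) Q)"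
      using IfLt.prems code by (intro IfLt.IH(1)) auto
    then have "leads w P (p + 2 + length ?D, R', M) (\<lambda>k. ends_at (p + 2 + length ?D + length ?C) t Q (Suc k))"
      by (rule leads_mono) (erule ends_at_mono, simp_all)
    then show "leads w P (exec w (P ! p) (p, R', M)) (\<lambda>k. ends_at (p + 2 + length ?D + length ?C) t Q (Suc k))"
      using True r code by simp
  next
    case False
    then have "leads w P (p + 1, R', M) (ends_at (p + 1 + length ?D) (t + 2) Q)"
      using IfLt.prems code by (intro IfLt.IH(2)) auto
    then have "leads w P (p + 1, R', M) (\<lambda>k. ends_at (p + 2 + length ?D + length ?C) t Q (Suc k))"
    proof (rule leads_trans)
      fix k s assume "ends_at (p + 1 + length ?D) (t + 2) Q k s"
      then obtain R1 A1 t1 R1' M1 where s: "s = (p + 1 + length ?D, R1', M1)" "represents L W R1 A1 R1' M1"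
        "Q R1 A1 t1" "t + 2 + k \<le> t1" by (rule ends_atE)
      show "leads w P s (\<lambda>j. ends_at (p + 2 + length ?D + length ?C) t Q (Suc (k + j)))"
        unfolding s(1) by (rule leads_step[OF code(5)], rule leads_now)
          (use s code(6) in \<open>auto simp: ends_at_def intro!: exI\<close>)
    qed
    then show "leads w P (exec w (P ! p) (p, R', M)) (\<lambda>k. ends_at (p + 2 + length ?D + length ?C) t Q (Suc k))"
      using False r code by simp
  qed
next
  case (For x y z c)
  let ?C = "compile c (p + 3)"
  let ?F = "\<lambda>B. wp L W c (\<lambda>R A t. B (R(x := Suc (R x))) A (t + 3))"
  let ?e = "p + 5 + length ?C"
  have code: "p < length P" "P ! p = Move x y" "p + 1 < length P" "P ! (p + 1) = JumpLess x z (p + 3)"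
    "p + 2 < length P" "P ! (p + 2) = Jump ?e" "code_at P (p + 3) ?C"
    "p + 3 + length ?C < length P" "P ! (p + 3 + length ?C) = Add x x one_reg"
    "p + 4 + length ?C < length P" "P ! (p + 4 + length ?C) = Jump (p + 1)"
    using For.prems(2) by (auto simp: Let_def numeral_eq_Suc)
  have wfc: "x < num_regs" "y < num_regs" "z < num_regs" "x \<noteq> z" "x \<notin> mods c" "z \<notin> mods c" "wfc c"
    using For.prems(1) by auto
  have len: "p + length (compile (For x y z c) p) = ?e" by (simp add: Let_def)
  \<comment> \<open>the two steps that leave the loop are paid for when the loop is entered\<close>
  have loop: "leads w P (p + 1, R', M) (\<lambda>k. ends_at ?e t Q (k - 2))"
    if "represents L W R A R' M" "(?F ^^ m) Q R A t" "m = R z - R x" for m R A t R' M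
    using that
  proof (induction m arbitrary: R A t R' M)
    case 0
    then have "R' x = R x" "R' z = R z" using wfc by (auto simp: represents_def)
    then have "exec w (P ! (p + 1)) (p + 1, R', M) = (Suc (p + 1), R', M)"
      "exec w (P ! Suc (p + 1)) (Suc (p + 1), R', M) = (?e, R', M)" using 0 code by simp_all
    then show ?case using 0 code(5)
      by (intro leads_two_steps[where S = R' and N = M]) (auto intro!: ends_atI)
  next
    case (Suc m)
    have r: "R' x = R x" "R' z = R z" "R x < R z" using wfc Suc.prems by (auto simp: represents_def)
    have "wp L W c (\<lambda>R A t. (?F ^^ m) Q (R(x := Suc (R x))) A (t + 3)) R A t"
      using Suc.prems(2) unfolding funpow.simps o_def .
    from For.IH[OF wfc(7) code(7) Suc.prems(1) wp_frame[OF this]] have "leads w P (p + 3, R', M) (ends_at (p + 3 + length ?C) t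
        (\<lambda>R1 A1 t1. (?F ^^ m) Q (R1(x := Suc (R1 x))) A1 (t1 + 3) \<and> (\<forall>r. r \<notin> mods c \<longrightarrow> R1 r = R r) \<and>
           (\<forall>k. k \<notin> puts c \<longrightarrow> A1 k = A k)))"
      .
    then have "leads w P (p + 3, R', M) (\<lambda>k. ends_at ?e t Q (Suc k - 2))"
    proof (rule leads_trans)
      fix k s assume "ends_at (p + 3 + length ?C) t
        (\<lambda>R1 A1 t1. (?F ^^ m) Q (R1(x := Suc (R1 x))) A1 (t1 + 3) \<and> (\<forall>r. r \<notin> mods c \<longrightarrow> R1 r = R r) \<and>
           (\<forall>k. k \<notin> puts c \<longrightarrow> A1 k = A k)) k s"
      then obtain R1 A1 t1 R1' M1 where s: "s = (p + 3 + length ?C, R1', M1)" "represents L W R1 A1 R1' M1"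
        "(?F ^^ m) Q (R1(x := Suc (R1 x))) A1 (t1 + 3) \<and> (\<forall>r. r \<notin> mods c \<longrightarrow> R1 r = R r) \<and>
           (\<forall>k. k \<notin> puts c \<longrightarrow> A1 k = A k)" "t + k \<le> t1" by (rule ends_atE)
      have R1: "R1 x = R x" "R1 z = R z" "R1' x = R1 x" "R1' one_reg = 1" "R1 z < W"
        using s wfc by (auto simp: represents_def)
      have r1: "represents L W (R1(x := Suc (R1 x))) A1 (R1'(x := Suc (R1 x))) M1"
        using s wfc R1 r by (intro represents_upd_reg) auto
      have eq: "m = (R1(x := Suc (R1 x))) z - (R1(x := Suc (R1 x))) x"
        using R1 Suc.prems(3) wfc by simp
      have "leads w P (p + 1, R1'(x := Suc (R1 x)), M1) (\<lambda>k. ends_at ?e (t1 + 3) Q (k - 2))"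
        by (rule Suc.IH[OF r1 conjunct1[OF s(3)] eq])
      then have l: "leads w P (p + 1, R1'(x := Suc (R1 x)), M1) (\<lambda>j. ends_at ?e t Q (Suc (k + Suc (Suc j)) - 2))"
        by (rule leads_mono) (erule ends_at_mono, use s(4) in simp_all)
      have "Suc (R1 x) mod 2 ^ w = Suc (R1 x)" using R1 r W by auto
      then have e1: "exec w (P ! (p + 3 + length ?C)) (p + 3 + length ?C, R1', M1) =
        (p + 4 + length ?C, R1'(x := Suc (R1 x)), M1)" using R1 code by simp
      have e2: "exec w (P ! (p + 4 + length ?C)) (p + 4 + length ?C, R1'(x := Suc (R1 x)), M1) =
        (p + 1, R1'(x := Suc (R1 x)), M1)" using code by simp
      show "leads w P s (\<lambda>j. ends_at ?e t Q (Suc (k + j) - 2))"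
        unfolding s(1)
        by (rule leads_step[OF code(8)], unfold e1, rule leads_step[OF code(10)], unfold e2, rule l)
    qed
    then show ?case using r code by (intro leads_step[OF code(3)]) simp
  qed
  have y: "R' y = R y" "R y < W" using For.prems wfc by (auto simp: represents_def)
  have "represents L W (R(x := R y)) A (R'(x := R y)) M"
    using For.prems wfc y by (intro represents_upd_reg) auto
  moreover have "(?F ^^ (R z - R y)) Q (R(x := R y)) A (t + 3)" using For.prems(4) unfolding wp.simps .
  moreover have "R z - R y = (R(x := R y)) z - (R(x := R y)) x" using wfc by simp
  ultimately have "leads w P (p + 1, R'(x := R y), M) (\<lambda>k. ends_at ?e (t + 3) Q (k - 2))" by (rule loop)
  then have "leads w P (p + 1, R'(x := R y), M) (\<lambda>k. ends_at ?e t Q (Suc k))"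
    by (rule leads_mono) (erule ends_at_mono, simp_all)
  moreover have "exec w (P ! p) (p, R', M) = (p + 1, R'(x := R y), M)" using y code by simp
  ultimately show ?case unfolding len by (intro leads_step[OF code(1)]) metis
qed

end

section \<open>The input in memory\<close>

definition offset :: "nat list list \<Rightarrow> nat \<Rightarrow> nat" where
  "offset adj u = length adj + 2 + length (concat (take u adj))"

lemma length_encode: "length (encode adj) = offset adj (length adj)"
  by (simp add: encode_def offset_def)

lemma offset_Suc: "u < length adj \<Longrightarrow> offset adj (Suc u) = offset adj u + length (adj ! u)"
  by (simp add: offset_def take_Suc_conv_app_nth)

lemma offset_mono: "u \<le> v \<Longrightarrow> offset adj u \<le> offset adj v"
  unfolding offset_def by (metis add_le_cancel_left concat_append le_add1 length_append min.absorb1 take_take append_take_drop_id)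

lemma encode_0: "encode adj ! 0 = length adj"
  by (simp add: encode_def)

lemma encode_Suc: "u \<le> length adj \<Longrightarrow> encode adj ! Suc u = offset adj u"
  unfolding encode_def offset_def by (simp add: nth_append del: upt_Suc)

lemma encode_nbr:
  assumes "u < length adj" "j < length (adj ! u)"
  shows "encode adj ! (offset adj u + j) = adj ! u ! j"
proof -
  have "concat adj = concat (take u adj) @ adj ! u @ concat (drop (Suc u) adj)"
    using id_take_nth_drop[OF assms(1)] by (metis concat.simps(2) concat_append)
  then have "concat adj ! (length (concat (take u adj)) + j) = adj ! u ! j"
    using assms by (simp add: nth_append)
  then show ?thesis unfolding encode_def offset_def by (simp add: nth_append)
qed

definition input_array :: "nat list \<Rightarrow> nat \<Rightarrow> nat \<Rightarrow> nat" where
  "input_array xs = (\<lambda>_ _. 0)(0 := \<lambda>i. if i < length xs then xs ! i else 0)"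

text \<open>Cell \<open>n + 1\<close> of the input contains the length of the input, from which the start addresses of the arrays are
  built by repeated addition.\<close>

definition prologue :: "instr list" where
  "prologue =
     [Const one_reg 1, Load addr_reg addr_reg, Add addr_reg addr_reg one_reg, Load addr_reg addr_reg,
      Add 35 34 addr_reg, Add 36 35 addr_reg, Add 37 36 addr_reg, Add 38 37 addr_reg, Add 39 38 addr_reg,
      Add 40 39 addr_reg, Add 41 40 addr_reg, Add 42 41 addr_reg, Add 43 42 addr_reg]"

lemma length_prologue: "length prologue = 13"
  by (simp add: prologue_def)

primrec exec_all :: "nat \<Rightarrow> instr list \<Rightarrow> config \<Rightarrow> config" where
  "exec_all w [] s = s"
| "exec_all w (i # C) s = exec_all w C (exec w i s)"

lemma leads_straight_line:
  assumes "\<And>i p R M. i \<in> set C \<Longrightarrow> \<exists>R' M'. exec w i (p, R, M) = (Suc p, R', M')"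
  shows "leads w (B @ C @ D) (length B, R, M) (\<lambda>k s. k = length C \<and> s = exec_all w C (length B, R, M))"
  using assms
proof (induction C arbitrary: B R M)
  case Nil then show ?case by (intro leads_now) simp
next
  case (Cons i C)
  obtain R' M' where e: "exec w i (length B, R, M) = (Suc (length B), R', M')" using Cons.prems[of i "length B" R M] by auto
  have "leads w ((B @ [i]) @ C @ D) (length (B @ [i]), R', M')
    (\<lambda>k s. k = length C \<and> s = exec_all w C (length (B @ [i]), R', M'))"
    by (rule Cons.IH) (use Cons.prems in auto)
  then show ?case by (intro leads_step) (simp_all add: nth_append e)
qed

lemma prologue_correct:
  assumes L: "L = length xs" "xs ! Suc (xs ! 0) = L" "Suc (xs ! 0) < L"
    and W: "num_arrays * L \<le> 2 ^ w" "\<And>x. x \<in> set xs \<Longrightarrow> x < 2 ^ w"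
  shows "leads w (prologue @ C) (initial_config xs)
    (\<lambda>k s. k = 13 \<and> (\<exists>R' M. s = (13, R', M) \<and> represents L (2 ^ w) (\<lambda>_. 0) (input_array xs) R' M))"
proof -
  define M where "M = (\<lambda>a. if a < length xs then xs ! a else 0)"
  define R' :: "nat \<Rightarrow> nat" where "R' = (\<lambda>_. 0)(32 := 1, 33 := L, 35 := L, 36 := 2 * L, 37 := 3 * L, 38 := 4 * L,
    39 := 5 * L, 40 := 6 * L, 41 := 7 * L, 42 := 8 * L, 43 := 9 * L)"
  have pos: "0 < L" using L(3) by simp
  have m: "M 0 = xs ! 0" "M (Suc (xs ! 0)) = L" using L(2,3) pos unfolding M_def L(1) by simp_all
  define W :: nat where "W = 2 ^ w"
  note ex = exec.simps[of w, folded W_def]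
  have LW: "num_arrays * L \<le> W" using W(1) by (simp add: W_def)
  have W1: "W \<noteq> Suc 0" using LW pos by linarith
  have md: "Suc 0 mod W = Suc 0" "Suc (xs ! 0) mod W = Suc (xs ! 0)"
    by (intro mod_less; use L(3) LW pos in linarith)+
  have lm: "L mod W = L" "(L + L) mod W = 2 * L" "(3 * L) mod W = 3 * L" "(4 * L) mod W = 4 * L" "(5 * L) mod W = 5 * L" "(6 * L) mod W = 6 * L" "(7 * L) mod W = 7 * L" "(8 * L) mod W = 8 * L" "(9 * L) mod W = 9 * L" "(2 * L + L) mod W = 3 * L" "(3 * L + L) mod W = 4 * L" "(4 * L + L) mod W = 5 * L" "(5 * L + L) mod W = 6 * L" "(6 * L + L) mod W = 7 * L" "(7 * L + L) mod W = 8 * L" "(8 * L + L) mod W = 9 * L"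
    by (subst mod_less; use pos LW in linarith)+
  have fin: "exec_all w prologue (0, \<lambda>_. 0, M) = (13, R', M)"
    unfolding prologue_def by (simp add: ex m md lm W1 R'_def del: exec.simps)
  have "leads w ([] @ prologue @ C) (length ([] :: instr list), \<lambda>_. 0, M)
    (\<lambda>k s. k = length prologue \<and> s = exec_all w prologue (length ([] :: instr list), \<lambda>_. 0, M))"
    by (rule leads_straight_line) (auto simp: prologue_def)
  then have run: "leads w (prologue @ C) (0, \<lambda>_. 0, M) (\<lambda>k s. k = 13 \<and> s = (13, R', M))"
    by (simp add: fin length_prologue)
  have "represents L (2 ^ w) (\<lambda>_. 0) (input_array xs) R' M"
    unfolding represents_def
  proof (intro conjI allI impI)
    fix k assume "k < num_arrays"
    then have "k = 0 \<or> k = 1 \<or> k = 2 \<or> k = 3 \<or> k = 4 \<or> k = 5 \<or> k = 6 \<or> k = 7 \<or> k = 8 \<or> k = 9" by presburger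
    then show "R' (base_reg k) = k * L" by (elim disjE) (simp_all add: R'_def)
    fix i assume i: "i < L"
    show "M (k * L + i) = input_array xs k i"
      using i L(1) by (cases k) (auto simp: M_def input_array_def)
    show "input_array xs k i < 2 ^ w" using i L(1) W(2) by (auto simp: input_array_def)
  qed (auto simp: R'_def)
  then show ?thesis unfolding initial_config_def M_def[symmetric]
    by (intro leads_mono[OF run]) blast
qed

text \<open>Every edge is counted at most once from each of its ends.\<close>

lemma sum_degrees_le:
  assumes "simple_graph {..<n} E" "adjacency_lists n E adj"
  shows "length (concat adj) \<le> 2 * card E"
proof -
  have len: "length adj = n" and adj: "\<And>u. u < n \<Longrightarrow> distinct (adj ! u)"
    "\<And>u. u < n \<Longrightarrow> set (adj ! u) = {v. v < n \<and> {u, v} \<in> E}" using assms(2) by (auto simp: adjacency_lists_def)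
  have E: "E \<subseteq> Pow {..<n}" "\<And>e. e \<in> E \<Longrightarrow> \<exists>u v. u \<noteq> v \<and> e = {u, v}"
    using assms(1) by (fastforce simp: simple_graph_def)+
  then have finE: "finite E" using finite_subset by blast
  let ?P = "SIGMA u:{..<n}. set (adj ! u)"
  have "length (concat adj) = (\<Sum>u<n. length (adj ! u))"
    by (simp add: length_concat sum_list_sum_nth len atLeast0LessThan)
  also have "\<dots> = (\<Sum>u<n. card (set (adj ! u)))" using adj(1) by (simp add: distinct_card)
  also have "\<dots> = card ?P" by simp
  also have "\<dots> \<le> card (\<Union>e\<in>E. {p. e = {fst p, snd p}})"
  proof (rule card_mono)
    have "finite {p. e = {fst p, snd p}}" if "e \<in> E" for e
    proof -
      have "finite (e \<times> e)" using E(2)[OF that] by auto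
      moreover have "{p. e = {fst p, snd p}} \<subseteq> e \<times> e" by auto
      ultimately show ?thesis by (rule rev_finite_subset)
    qed
    then show "finite (\<Union>e\<in>E. {p. e = {fst p, snd p}})" using finE by blast
    show "?P \<subseteq> (\<Union>e\<in>E. {p. e = {fst p, snd p}})" using adj(2) by auto
  qed
  also have "\<dots> \<le> (\<Sum>e\<in>E. card {p. e = {fst p, snd p}})" by (rule card_UN_le[OF finE])
  also have "\<dots> \<le> (\<Sum>e\<in>E. 2)"
  proof (rule sum_mono)
    fix e assume "e \<in> E"
    then obtain u v where uv: "u \<noteq> v" "e = {u, v}" using E(2) by blast
    have "p \<in> {(u, v), (v, u)}" if "e = {fst p, snd p}" for p
      using that unfolding uv(2) doubleton_eq_iff by (cases p) auto
    then have "card {p. e = {fst p, snd p}} \<le> card {(u, v), (v, u)}" by (intro card_mono) auto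
    then show "card {p. e = {fst p, snd p}} \<le> 2" using uv(1) by simp
  qed
  finally show ?thesis by simp
qed

text \<open>The arrays all have the length of the input, which is linear in the size of the graph. A word length linear in that size
  therefore covers all addresses.\<close>

theorem linear_time_computableI:
  assumes wfc: "wfc c"
    and simple: "\<And>n E. \<C> {..<n} E \<Longrightarrow> simple_graph {..<n} E"
    and correct: "\<And>n E adj W. \<C> {..<n} E \<Longrightarrow> adjacency_lists n E adj \<Longrightarrow>
      num_arrays * length (encode adj) \<le> W \<Longrightarrow>
      wp (length (encode adj)) W c (\<lambda>R A t. R 0 = \<pi> {..<n} E \<and> t \<le> b * (n + card E + 1))
        (\<lambda>_. 0) (input_array (encode adj)) 0"
  shows "linear_time_computable \<C> \<pi>"
  unfolding linear_time_computable_def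
proof (intro exI allI impI)
  fix n E adj w
  \<comment> \<open>10 arrays of length at most \<open>2 * (n + card E + 1)\<close>; 13 is the length of the prologue\<close>
  assume C: "\<C> {..<n} E" and adj: "adjacency_lists n E adj" and w: "20 * (n + card E + 1) \<le> 2 ^ w"
  let ?P = "prologue @ compile c 13" and ?L = "length (encode adj)" and ?T = "(b + 13) * (n + card E + 1)"
  have len: "length adj = n" using adj by (simp add: adjacency_lists_def)
  have "length (concat adj) \<le> 2 * card E" using sum_degrees_le[OF simple[OF C] adj] .
  then have L: "num_arrays * ?L \<le> 2 ^ w" using w len by (simp add: length_encode offset_def)
  have pos: "n + 2 \<le> ?L" using len by (simp add: length_encode offset_def)
  have entries: "x < 2 ^ w" if "x \<in> set (encode adj)" for x
  proof -
    have "x \<le> ?L"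
    proof -
      have "set (concat adj) \<subseteq> {..<n}" using adj by (fastforce simp: adjacency_lists_def in_set_conv_nth)
      moreover have "n + 2 + length (concat (take u adj)) \<le> ?L" if "u \<le> n" for u
        using offset_mono[OF that, of adj] len by (simp add: length_encode offset_def)
      ultimately show ?thesis using that pos len unfolding encode_def by fastforce
    qed
    moreover have "?L < 2 ^ w" using L pos by linarith
    ultimately show ?thesis by simp
  qed
  have "leads w ?P (initial_config (encode adj))
    (\<lambda>k s. k = 13 \<and> (\<exists>R' M. s = (13, R', M) \<and> represents ?L (2 ^ w) (\<lambda>_. 0) (input_array (encode adj)) R' M))"
    by (rule prologue_correct[OF refl _ _ L entries])
      (use pos len in \<open>simp_all add: encode_0 encode_Suc length_encode\<close>)
  then have "leads w ?P (initial_config (encode adj))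
    (\<lambda>k s. k \<le> ?T \<and> fst s = length ?P \<and> fst (snd s) 0 = \<pi> {..<n} E)"
  proof (rule leads_trans, elim conjE exE)
    fix k :: nat and R' M and s :: config assume k: "k = 13" and s: "s = (13, R', M)"
      and r: "represents ?L (2 ^ w) (\<lambda>_. 0) (input_array (encode adj)) R' M"
    have code: "code_at ?P 13 (compile c 13)"
      using code_at_self[of prologue "compile c 13" "[]"] by (simp add: length_prologue)
    have "leads w ?P s (ends_at ?L (2 ^ w) (13 + length (compile c 13)) 0
      (\<lambda>R A t. R 0 = \<pi> {..<n} E \<and> t \<le> b * (n + card E + 1)))"
      unfolding s by (rule compile_correct[OF refl L wfc code r correct[OF C adj L]])
    then show "leads w ?P s (\<lambda>j s. k + j \<le> ?T \<and> fst s = length ?P \<and> fst (snd s) 0 = \<pi> {..<n} E)"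
    proof (rule leads_mono)
      fix j s' assume e: "ends_at ?L (2 ^ w) (13 + length (compile c 13)) 0
        (\<lambda>R A t. R 0 = \<pi> {..<n} E \<and> t \<le> b * (n + card E + 1)) j s'"
      obtain R A t R' M where s': "s' = (13 + length (compile c 13), R', M)" "represents ?L (2 ^ w) R A R' M"
        "R 0 = \<pi> {..<n} E \<and> t \<le> b * (n + card E + 1)" "0 + j \<le> t" by (rule ends_atE[OF refl L e])
      have "R' 0 = R 0" using s'(2) by (simp add: represents_def)
      then show "k + j \<le> ?T \<and> fst s' = length ?P \<and> fst (snd s') 0 = \<pi> {..<n} E"
        using s' k by (simp add: length_prologue algebra_simps)
    qed
  qed
  then show "outputs_within w ?P (encode adj) ?T (\<pi> {..<n} E)"
    unfolding outputs_within_def leads_def halted_def Let_def by fastforce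
qed

section \<open>Loops over vertices and neighbours\<close>

text \<open>Only \<open>SetC\<close> has an immediate operand, so frequent constants are kept in registers. Registers initially hold 0, and
  \<open>rZero\<close> is never written.\<close>

abbreviation (input) rOne :: nat where "rOne \<equiv> 2"
abbreviation (input) rTwo :: nat where "rTwo \<equiv> 3"
abbreviation (input) rZero :: nat where "rZero \<equiv> 4"
abbreviation (input) rN :: nat where "rN \<equiv> 5"
abbreviation (input) rV :: nat where "rV \<equiv> 6"
abbreviation (input) rE :: nat where "rE \<equiv> 7"
abbreviation (input) rFrom :: nat where "rFrom \<equiv> 8"
abbreviation (input) rTo :: nat where "rTo \<equiv> 9"
abbreviation (input) rU :: nat where "rU \<equiv> 10"
abbreviation (input) rX :: nat where "rX \<equiv> 11"
abbreviation (input) rY :: nat where "rY \<equiv> 12"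
abbreviation (input) rBest :: nat where "rBest \<equiv> 13"
abbreviation (input) rI :: nat where "rI \<equiv> 14"
abbreviation (input) rLen :: nat where "rLen \<equiv> 15"
abbreviation (input) rFlag :: nat where "rFlag \<equiv> 16"
abbreviation (input) rSum :: nat where "rSum \<equiv> 17"
abbreviation (input) rBig :: nat where "rBig \<equiv> 18"
abbreviation (input) rSize :: nat where "rSize \<equiv> 19"
abbreviation (input) rCost :: nat where "rCost \<equiv> 20"
abbreviation (input) rA :: nat where "rA \<equiv> 21"
abbreviation (input) rC :: nat where "rC \<equiv> 22"
abbreviation (input) rDegA :: nat where "rDegA \<equiv> 23"
abbreviation (input) rThree :: nat where "rThree \<equiv> 24"
abbreviation (input) rFour :: nat where "rFour \<equiv> 25"

abbreviation (input) aInput :: nat where "aInput \<equiv> 0"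
abbreviation (input) aLabel :: nat where "aLabel \<equiv> 2"
abbreviation (input) aNew :: nat where "aNew \<equiv> 3"
abbreviation (input) aCount :: nat where "aCount \<equiv> 4"
abbreviation (input) aValues :: nat where "aValues \<equiv> 5"
abbreviation (input) aDegree :: nat where "aDegree \<equiv> 6"
abbreviation (input) aSize :: nat where "aSize \<equiv> 7"
abbreviation (input) aMax :: nat where "aMax \<equiv> 8"
abbreviation (input) aMark :: nat where "aMark \<equiv> 9"

definition skip :: com where "skip = Copy rX rX"

definition for_vertices :: "com \<Rightarrow> com" where
  "for_vertices c = For rV rZero rN c"

definition for_nbrs :: "nat \<Rightarrow> com \<Rightarrow> com" where
  "for_nbrs v c = (Plus rFrom v rOne;; Get rFrom aInput rFrom;; Plus rTo v rTwo;; Get rTo aInput rTo;;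
     For rE rFrom rTo (Get rU aInput rE;; c))"

lemma mods_loops [simp]:
  "mods skip = {rX}" "puts skip = {}" "wfc skip"
  "mods (for_vertices c) = insert rV (mods c)" "puts (for_vertices c) = puts c"
  "mods (for_nbrs v c) = {rFrom, rTo, rE, rU} \<union> mods c" "puts (for_nbrs v c) = puts c"
  "wfc (for_vertices c) \<longleftrightarrow> rV \<notin> mods c \<and> rN \<notin> mods c \<and> wfc c"
  "wfc (for_nbrs v c) \<longleftrightarrow> v < num_regs \<and> rE \<notin> mods c \<and> rTo \<notin> mods c \<and> wfc c"
  by (auto simp: for_vertices_def for_nbrs_def skip_def)

locale program_input =
  fixes n :: nat and adj :: "nat list list" and L W :: nat
  assumes len: "length adj = n"
    and distinct: "\<And>u. u < n \<Longrightarrow> distinct (adj ! u)"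
    and nbrs: "\<And>u. u < n \<Longrightarrow> set (adj ! u) \<subseteq> {..<n} - {u}"
    and L: "L = length (encode adj)"
    and W: "num_arrays * L \<le> W"
begin

abbreviation "off \<equiv> offset adj"
abbreviation "deg u \<equiv> length (adj ! u)"
abbreviation "nb u \<equiv> set (adj ! u)"

definition inp :: "nat \<Rightarrow> nat" where "inp = input_array (encode adj) 0"

lemma L_off: "L = off n" using L len by (simp add: length_encode)

lemma off_0: "off 0 = n + 2" using len by (simp add: offset_def)

lemma n_less_L: "n + 2 \<le> L" using offset_mono[of 0 n adj] by (simp add: L_off off_0)

lemma off_le_L: "u \<le> n \<Longrightarrow> off u \<le> L" using offset_mono L_off by simp

lemma off_Suc: "u < n \<Longrightarrow> off (Suc u) = off u + deg u" using offset_Suc len by simp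

lemma inp_simps: "inp 0 = n" "u \<le> n \<Longrightarrow> inp (Suc u) = off u"
  "u < n \<Longrightarrow> j < deg u \<Longrightarrow> inp (off u + j) = adj ! u ! j"
proof -
  have "encode adj \<noteq> []" using n_less_L L by auto
  then show "inp 0 = n" using len by (simp add: inp_def input_array_def encode_0)
  show "inp (Suc u) = off u" if "u \<le> n" using that n_less_L L len by (simp add: inp_def input_array_def encode_Suc)
  show "inp (off u + j) = adj ! u ! j" if "u < n" "j < deg u"
    using that off_le_L[of "Suc u"] off_Suc[of u] L len by (simp add: inp_def input_array_def encode_nbr)
qed

lemma nbr_less: "u < n \<Longrightarrow> j < deg u \<Longrightarrow> adj ! u ! j < n"
  using nbrs nth_mem by fastforce

lemma deg_eq_card: "u < n \<Longrightarrow> deg u = card (nb u)"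
  using distinct distinct_card by metis

lemma deg_less: assumes "u < n" shows "deg u < n"
proof -
  have "card (nb u) \<le> card ({..<n} - {u})" using nbrs[OF assms] by (intro card_mono) auto
  also have "\<dots> < n" using assms by simp
  finally show ?thesis using deg_eq_card[OF assms] by simp
qed

text \<open>The part of the state that no command after the start of the program changes.\<close>

definition std :: "(nat \<Rightarrow> nat) \<Rightarrow> (nat \<Rightarrow> nat \<Rightarrow> nat) \<Rightarrow> bool" where
  "std R A \<longleftrightarrow> R rOne = 1 \<and> R rTwo = 2 \<and> R rZero = 0 \<and> R rN = n \<and> A aInput = inp"

lemma stdD: "std R A \<Longrightarrow> R rOne = Suc 0" "std R A \<Longrightarrow> R rTwo = 2" "std R A \<Longrightarrow> R rZero = 0"
  "std R A \<Longrightarrow> R rN = n" "std R A \<Longrightarrow> A aInput = inp"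
  by (auto simp: std_def)

lemma std_frame:
  assumes "std R A" "\<forall>r. r \<notin> X \<longrightarrow> R' r = R r" "\<forall>k. k \<notin> Y \<longrightarrow> A' k = A k"
    "rOne \<notin> X" "rTwo \<notin> X" "rZero \<notin> X" "rN \<notin> X" "aInput \<notin> Y"
  shows "std R' A'"
  using assms unfolding std_def by metis

abbreviation reserved :: "nat set" where "reserved \<equiv> {rOne, rTwo, rZero, rN}"

lemma wp_for_vertices:
  assumes s: "std R0 A0" and c: "mods c \<inter> insert rV reserved = {}" "aInput \<notin> puts c"
    and init: "I 0 (R0(rV := 0)) A0 (t0 + 3)"
    and step: "\<And>k R A t. k < n \<Longrightarrow> R rV = k \<Longrightarrow> std R A \<Longrightarrow>
      \<forall>r. r \<notin> insert rV (mods c) \<longrightarrow> R r = R0 r \<Longrightarrow> \<forall>j. j \<notin> puts c \<longrightarrow> A j = A0 j \<Longrightarrow>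
      I k R A t \<Longrightarrow> wp L W c (\<lambda>R A t. I (Suc k) (R(rV := Suc k)) A (t + 3)) R A t"
    and fin: "\<And>R A t. std R A \<Longrightarrow> \<forall>r. r \<notin> insert rV (mods c) \<longrightarrow> R r = R0 r \<Longrightarrow>
      \<forall>j. j \<notin> puts c \<longrightarrow> A j = A0 j \<Longrightarrow> I n R A t \<Longrightarrow> Q R A t"
  shows "wp L W (for_vertices c) Q R0 A0 t0"
  unfolding for_vertices_def
proof (rule wp_For[where I = I])
  show "I (R0 rZero) (R0(rV := R0 rZero)) A0 (t0 + 3)" using init stdD[OF s] by simp
next
  fix k R A t
  assume h: "k < R0 rN" "R rV = k" and f: "\<forall>r. r \<notin> insert rV (mods c) \<longrightarrow> R r = R0 r"
    "\<forall>j. j \<notin> puts c \<longrightarrow> A j = A0 j" and "I k R A t"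
  moreover have "std R A" by (rule std_frame[OF s f]) (use c in auto)
  ultimately show "wp L W c (\<lambda>R A t. I (Suc k) (R(rV := Suc k)) A (t + 3)) R A t"
    using stdD[OF s] by (intro step) auto
next
  fix R A t
  assume f: "\<forall>r. r \<notin> insert rV (mods c) \<longrightarrow> R r = R0 r"
    "\<forall>j. j \<notin> puts c \<longrightarrow> A j = A0 j" and "I (R0 rN) R A t"
  moreover have "std R A" by (rule std_frame[OF s f]) (use c in auto)
  ultimately show "Q R A t" using stdD[OF s] by (intro fin) auto
qed (use c stdD[OF s] in auto)

text \<open>The invariant counts the neighbours already visited. Over all vertices \<open>v\<close>, running times that are linear in
  the degree add up to differences of \<open>off\<close>, which is why the invariants of enclosing loops measure time by \<open>off\<close>. The coefficients of \<open>j\<close>, \<open>k\<close> and \<open>off k\<close> in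
  these invariants count clock ticks per round; the resulting multiples of \<open>L\<close> are generous.\<close>

lemma wp_for_nbrs:
  assumes s: "std R0 A0" and c: "mods c \<inter> insert rE reserved = {}" "aInput \<notin> puts c"
    and u: "R0 v = u" "u < n" "v \<noteq> rFrom"
    and init: "I 0 (R0(rFrom := off u, rTo := off (Suc u), rE := off u)) A0 (t0 + 9)"
    and step: "\<And>j R A t. j < deg u \<Longrightarrow> adj ! u ! j < n \<Longrightarrow> std R A \<Longrightarrow>
      \<forall>r. r \<notin> {rE, rFrom, rTo, rU} \<union> mods c \<longrightarrow> R r = R0 r \<Longrightarrow> \<forall>j. j \<notin> puts c \<longrightarrow> A j = A0 j \<Longrightarrow>
      I j R A t \<Longrightarrow>
      wp L W c (\<lambda>R A t. I (Suc j) (R(rE := Suc (off u + j))) A (t + 3)) (R(rU := adj ! u ! j)) A (t + 2)"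
    and fin: "\<And>R A t. std R A \<Longrightarrow> \<forall>r. r \<notin> {rE, rFrom, rTo, rU} \<union> mods c \<longrightarrow> R r = R0 r \<Longrightarrow>
      \<forall>j. j \<notin> puts c \<longrightarrow> A j = A0 j \<Longrightarrow>
      (rFrom \<notin> mods c \<longrightarrow> rTo \<notin> mods c \<longrightarrow> R rFrom = off u \<and> R rTo = off u + deg u) \<Longrightarrow>
      I (deg u) R A t \<Longrightarrow> Q R A t"
  shows "wp L W (for_nbrs v c) Q R0 A0 t0"
proof -
  have uL: "u + 2 < L" "Suc (Suc u) < W" using u n_less_L W by auto
  let ?R = "R0(rFrom := off u, rTo := off (Suc u))"
  have "wp L W (For rE rFrom rTo (Get rU aInput rE;; c)) Q ?R A0 (t0 + 6)"
  proof (rule wp_For[where I = "\<lambda>k. I (k - off u)"])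
    show "I (?R rFrom - off u) (?R(rE := ?R rFrom)) A0 (t0 + 6 + 3)"
      using init by (simp add: numeral_eq_Suc)
  next
    fix k R A t
    assume k: "?R rFrom \<le> k" "k < ?R rTo" "R rE = k"
      and f: "\<forall>r. r \<notin> insert rE (mods (Get rU aInput rE;; c)) \<longrightarrow> R r = ?R r"
        "\<forall>j. j \<notin> puts (Get rU aInput rE;; c) \<longrightarrow> A j = A0 j" and i: "I (k - off u) R A t"
    define j where "j = k - off u"
    have j: "k = off u + j" "j < deg u" using k off_Suc[OF u(2)] by (auto simp: j_def)
    have f': "\<forall>r. r \<notin> {rE, rFrom, rTo, rU} \<union> mods c \<longrightarrow> R r = R0 r" "\<forall>j. j \<notin> puts c \<longrightarrow> A j = A0 j"
      using f by auto
    have s': "std R A" by (rule std_frame[OF s f']) (use c in auto)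
    have kL: "k < L" using off_le_L[of "Suc u"] u k by simp
    have kv: "A aInput k = adj ! u ! j" using stdD(5)[OF s'] inp_simps(3)[OF u(2) j(2)] j(1) by simp
    have "wp L W c (\<lambda>R A t. I (Suc j) (R(rE := Suc (off u + j))) A (t + 3)) (R(rU := adj ! u ! j)) A (t + 2)"
      using i j by (intro step[OF j(2) nbr_less[OF u(2) j(2)] s' f']) simp
    moreover have "Suc j = Suc k - off u" "Suc (off u + j) = Suc k" using j by auto
    ultimately show "wp L W (Get rU aInput rE;; c)
      (\<lambda>R A t. I (Suc k - off u) (R(rE := Suc k)) A (t + 3)) R A t"
      using kL kv k(3) by simp
  next
    fix R A t
    assume f: "\<forall>r. r \<notin> insert rE (mods (Get rU aInput rE;; c)) \<longrightarrow> R r = ?R r"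
        "\<forall>j. j \<notin> puts (Get rU aInput rE;; c) \<longrightarrow> A j = A0 j" and i: "I (?R rTo - off u) R A t"
    have f': "\<forall>r. r \<notin> {rE, rFrom, rTo, rU} \<union> mods c \<longrightarrow> R r = R0 r" "\<forall>j. j \<notin> puts c \<longrightarrow> A j = A0 j"
      using f by auto
    have s': "std R A" by (rule std_frame[OF s f']) (use c in auto)
    show "Q R A t" by (rule fin[OF s' f']) (use f i off_Suc[OF u(2)] in auto)
  qed (use c off_Suc[OF u(2)] in auto)
  then show ?thesis
    unfolding for_nbrs_def using stdD[OF s] u uL inp_simps(2)[of u] inp_simps(2)[of "Suc u"]
    by (simp add: numeral_eq_Suc fun_upd_twist[of _ _ _]) 
qed

end

section \<open>Least vertices of components\<close>

definition init_labels :: com where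
  "init_labels = for_vertices (Put aLabel rV rV)"

definition init_degrees :: com where
  "init_degrees = for_vertices
     (Plus rX rV rOne;; Get rX aInput rX;; Plus rY rV rTwo;; Get rY aInput rY;; Minus rY rY rX;; Put aDegree rV rY)"

definition copy_labels :: com where
  "copy_labels = for_vertices (Get rX aNew rV;; Put aLabel rV rX)"

text \<open>New labels are collected in a second array and copied back at the end, so that all minima are taken over
  the old labels.\<close>

definition closed_pass :: com where
  "closed_pass =
     for_vertices
       (Get rBest aLabel rV;;
        for_nbrs rV (Get rX aLabel rU;; IfLt rX rBest (Copy rBest rX) skip);;
        Put aNew rV rBest);;
     copy_labels"

context program_input
begin

lemma wp_skip: "wp L W skip Q R A t \<longleftrightarrow> Q R A (t + 1)"
  by (simp add: skip_def)

lemma wp_init_labels: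
  assumes s: "std R A"
  shows "wp L W init_labels (\<lambda>R' A' t'. (\<forall>v<n. A' aLabel v = v) \<and> t' \<le> t + 8 * L) R A t"
  unfolding init_labels_def
proof (rule wp_for_vertices[OF s, where I = "\<lambda>k R' A' t'. (\<forall>v<k. A' aLabel v = v) \<and> t' \<le> t + 3 + 5 * k"])
  fix k R' A' t'
  assume "k < n" "R' rV = k" "(\<forall>v<k. A' aLabel v = v) \<and> t' \<le> t + 3 + 5 * k"
  then show "wp L W (Put aLabel rV rV) (\<lambda>R A t'. (\<forall>v<Suc k. A aLabel v = v) \<and> t' + 3 \<le> t + 3 + 5 * Suc k) R' A' t'"
    using n_less_L by (auto simp: less_Suc_eq)
qed (use n_less_L in auto)

lemma wp_init_degrees:
  assumes s: "std R A"
  shows "wp L W init_degrees (\<lambda>R' A' t'. (\<forall>v<n. A' aDegree v = deg v) \<and> t' \<le> t + 15 * L) R A t"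
  unfolding init_degrees_def
proof (rule wp_for_vertices[OF s, where I = "\<lambda>k R' A' t'. (\<forall>v<k. A' aDegree v = deg v) \<and> t' \<le> t + 3 + 12 * k"])
  fix k R' A' t'
  assume k: "k < n" "R' rV = k" and s': "std R' A'" and I: "(\<forall>v<k. A' aDegree v = deg v) \<and> t' \<le> t + 3 + 12 * k"
  have "Suc k < L" "Suc (Suc k) < L" "Suc (Suc k) < W" "k < L" using k n_less_L W by auto
  moreover have "off (Suc k) = off k + deg k" using off_Suc k by simp
  ultimately show "wp L W (Plus rX rV rOne;; Get rX aInput rX;; Plus rY rV rTwo;; Get rY aInput rY;; Minus rY rY rX;;
      Put aDegree rV rY) (\<lambda>R A t'. (\<forall>v<Suc k. A aDegree v = deg v) \<and> t' + 3 \<le> t + 3 + 12 * Suc k) R' A' t'"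
    using k I stdD[OF s'] inp_simps(2)[of k] inp_simps(2)[of "Suc k"] by (auto simp: less_Suc_eq)
qed (use n_less_L in auto)

lemma wp_copy_labels:
  assumes s: "std R A"
  shows "wp L W copy_labels (\<lambda>R' A' t'. (\<forall>v<n. A' aLabel v = A aNew v) \<and> t' \<le> t + 10 * L) R A t"
  unfolding copy_labels_def
proof (rule wp_for_vertices[OF s, where I = "\<lambda>k R' A' t'. (\<forall>v<k. A' aLabel v = A aNew v) \<and> t' \<le> t + 3 + 7 * k"])
  fix k R' A' t'
  assume "k < n" "R' rV = k" "(\<forall>v<k. A' aLabel v = A aNew v) \<and> t' \<le> t + 3 + 7 * k"
    "\<forall>j. j \<notin> puts (Get rX aNew rV;; Put aLabel rV rX) \<longrightarrow> A' j = A j"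
  then show "wp L W (Get rX aNew rV;; Put aLabel rV rX)
    (\<lambda>R' A' t'. (\<forall>v<Suc k. A' aLabel v = A aNew v) \<and> t' + 3 \<le> t + 3 + 7 * Suc k) R' A' t'"
    using n_less_L by (auto simp: less_Suc_eq)
qed (use n_less_L in auto)

lemma wp_closed_pass:
  assumes s: "std R A"
  shows "wp L W closed_pass
    (\<lambda>R' A' t'. (\<forall>v<n. A' aLabel v = Min (A aLabel ` insert v (nb v))) \<and> t' \<le> t + 40 * L) R A t"
  unfolding closed_pass_def wp.simps(7)
proof (rule wp_for_vertices[OF s, where I = "\<lambda>k R' A' t'.
    (\<forall>v<k. A' aNew v = Min (A aLabel ` insert v (nb v))) \<and> t' + 10 * off 0 \<le> t + 3 + 16 * k + 10 * off k"])
  let ?c = "Get rBest aLabel rV;; for_nbrs rV (Get rX aLabel rU;; IfLt rX rBest (Copy rBest rX) skip);; Put aNew rV rBest"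
  fix k R1 A1 t1
  assume k: "k < n" "R1 rV = k" and s1: "std R1 A1"
    and I: "(\<forall>v<k. A1 aNew v = Min (A aLabel ` insert v (nb v))) \<and> t1 + 10 * off 0 \<le> t + 3 + 16 * k + 10 * off k"
    and f: "\<forall>j. j \<notin> puts ?c \<longrightarrow> A1 j = A j"
  have lab: "A1 aLabel = A aLabel" using f by simp
  define m where "m j = Min (A aLabel ` insert k (set (take j (adj ! k))))" for j
  have m_Suc: "m (Suc j) = min (A aLabel (adj ! k ! j)) (m j)" if "j < deg k" for j
    using that unfolding m_def by (simp add: take_Suc_conv_app_nth insert_commute[of k])
  have "wp L W (for_nbrs rV (Get rX aLabel rU;; IfLt rX rBest (Copy rBest rX) skip))
     (wp L W (Put aNew rV rBest) (\<lambda>R A' t'. (\<forall>v<Suc k. A' aNew v = Min (A aLabel ` insert v (nb v))) \<and>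
       t' + 3 + 10 * off 0 \<le> t + 3 + 16 * Suc k + 10 * off (Suc k)))
     (R1(rBest := A1 aLabel k)) A1 (t1 + 2)"
  proof (rule wp_for_nbrs[where u = k and I = "\<lambda>j R' A' t'.
        R' rBest = m j \<and> t' \<le> t1 + 11 + 10 * j"])
    show "std (R1(rBest := A1 aLabel k)) A1" using s1 by (simp add: std_def)
  next
    fix j R2 A2 t2
    assume j: "j < deg k" "adj ! k ! j < n" and f2: "\<forall>j. j \<notin> puts (Get rX aLabel rU;; IfLt rX rBest (Copy rBest rX) skip) \<longrightarrow> A2 j = A1 j"
      and I2: "R2 rBest = m j \<and> t2 \<le> t1 + 11 + 10 * j"
    have "A2 aLabel = A aLabel" using f2 lab by simp
    then show "wp L W (Get rX aLabel rU;; IfLt rX rBest (Copy rBest rX) skip)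
      (\<lambda>R' A' t'. (R'(rE := Suc (off k + j))) rBest = m (Suc j) \<and>
         t' + 3 \<le> t1 + 11 + 10 * Suc j) (R2(rU := adj ! k ! j)) A2 (t2 + 2)"
      using I2 j n_less_L m_Suc[OF j(1)] by (simp add: wp_skip min_def)
  next
    fix R2 A2 t2
    assume f2: "\<forall>r. r \<notin> {rE, rFrom, rTo, rU} \<union> mods (Get rX aLabel rU;; IfLt rX rBest (Copy rBest rX) skip) \<longrightarrow>
        R2 r = (R1(rBest := A1 aLabel k)) r"
      "\<forall>j. j \<notin> puts (Get rX aLabel rU;; IfLt rX rBest (Copy rBest rX) skip) \<longrightarrow> A2 j = A1 j"
      and I2: "R2 rBest = m (deg k) \<and> t2 \<le> t1 + 11 + 10 * deg k"
    show "wp L W (Put aNew rV rBest) (\<lambda>R A' t'. (\<forall>v<Suc k. A' aNew v = Min (A aLabel ` insert v (nb v))) \<and>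
       t' + 3 + 10 * off 0 \<le> t + 3 + 16 * Suc k + 10 * off (Suc k)) R2 A2 t2"
      using f2 I2 I k n_less_L off_Suc[OF k(1)] by (auto simp: less_Suc_eq m_def)
  qed (use k lab in \<open>auto simp: m_def\<close>)
  then show "wp L W ?c (\<lambda>R A' t'. (\<forall>v<Suc k. A' aNew v = Min (A aLabel ` insert v (nb v))) \<and>
       t' + 3 + 10 * off 0 \<le> t + 3 + 16 * Suc k + 10 * off (Suc k)) R1 A1 t1"
    using k n_less_L by simp
next
  fix R1 A1 t1
  assume s1: "std R1 A1" and I: "(\<forall>v<n. A1 aNew v = Min (A aLabel ` insert v (nb v))) \<and>
    t1 + 10 * off 0 \<le> t + 3 + 16 * n + 10 * off n"
  show "wp L W copy_labels
    (\<lambda>R' A' t'. (\<forall>v<n. A' aLabel v = Min (A aLabel ` insert v (nb v))) \<and> t' \<le> t + 40 * L) R1 A1 t1"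
    by (rule wp_mono[OF wp_copy_labels[OF s1]]) (use I n_less_L off_0 L_off in auto)
qed auto

end

text \<open>The number of vertices in \<open>S\<close> with label \<open>x\<close>.\<close>

definition cnt :: "(nat \<Rightarrow> nat) \<Rightarrow> nat set \<Rightarrow> nat \<Rightarrow> nat" where
  "cnt a S x = card {u \<in> S. a u = x}"

lemma cnt_insert: "finite S \<Longrightarrow> u \<notin> S \<Longrightarrow> cnt a (insert u S) x = cnt a S x + (if a u = x then 1 else 0)"
proof -
  assume S: "finite S" "u \<notin> S"
  have "{w \<in> insert u S. a w = x} = (if a u = x then insert u {w \<in> S. a w = x} else {w \<in> S. a w = x})" by auto
  then show ?thesis using S by (simp add: cnt_def)
qed

lemma cnt_le_card: "finite S \<Longrightarrow> cnt a S x \<le> card S"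
  unfolding cnt_def by (intro card_mono) auto

lemma cnt_pos_iff: "finite S \<Longrightarrow> 0 < cnt a S x \<longleftrightarrow> x \<in> a ` S"
  unfolding cnt_def by (auto simp: card_gt_0_iff)

definition clear_counts :: com where
  "clear_counts = for_vertices (Put aCount rV rZero;; Put aValues rV rZero)"

definition add_count :: com where
  "add_count = (Get rY aCount rX;; Plus rY rY rOne;; Put aCount rX rY)"

definition remove_count :: com where
  "remove_count = (Get rY aCount rX;; Minus rY rY rOne;; Put aCount rX rY)"

definition count_labels :: com where
  "count_labels = for_vertices (Get rX aLabel rV;; add_count)"

definition collect_values :: com where
  "collect_values = (Copy rI rZero;;
     for_vertices (Get rX aCount rV;; IfLt rZero rX (Put aValues rI rV;; Plus rI rI rOne) skip))"

definition remove_nbrs :: com where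
  "remove_nbrs = for_nbrs rV (Get rX aLabel rU;; remove_count)"

definition restore_nbrs :: com where
  "restore_nbrs = for_nbrs rV (Get rX aLabel rU;; add_count)"

definition scan_values :: com where
  "scan_values = (Get rBest aLabel rV;; Get rLen aDegree rV;; Plus rLen rLen rOne;;
     For rI rZero rLen
       (Get rX aValues rI;; Get rY aCount rX;; IfLt rZero rY (IfLt rX rBest (Copy rBest rX) skip) skip))"

text \<open>For every vertex the counts of its neighbours' labels are removed, so that a positive count marks a label that
  occurs at a non-neighbour. Afterwards the counts are restored.\<close>

definition co_pass :: com where
  "co_pass = (clear_counts;; count_labels;; collect_values;;
     for_vertices (remove_nbrs;; scan_values;; restore_nbrs;; Put aNew rV rBest);;
     copy_labels)"

lemma mods_count [simp]:
  "mods add_count = {rY}" "puts add_count = {aCount}" "wfc add_count"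
  "mods remove_count = {rY}" "puts remove_count = {aCount}" "wfc remove_count"
  by (simp_all add: add_count_def remove_count_def)

lemma mods_co_pass_parts [simp]:
  "mods clear_counts = {rV}" "puts clear_counts = {aCount, aValues}"
  "mods count_labels = {rV, rX, rY}" "puts count_labels = {aCount}"
  "mods collect_values = {rV, rX, rI}" "puts collect_values = {aValues}"
  "mods remove_nbrs = {rFrom, rTo, rE, rU, rX, rY}" "puts remove_nbrs = {aCount}"
  "mods restore_nbrs = {rFrom, rTo, rE, rU, rX, rY}" "puts restore_nbrs = {aCount}"
  "mods scan_values = {rBest, rLen, rI, rX, rY}" "puts scan_values = {}"
  by (auto simp: clear_counts_def count_labels_def collect_values_def remove_nbrs_def restore_nbrs_def scan_values_def)

context program_input
begin

lemma wp_add_count: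
  "wp L W add_count Q R A t \<longleftrightarrow> R rX < L \<and> A aCount (R rX) + R rOne < W \<and>
     Q (R(rY := A aCount (R rX) + R rOne)) (A(aCount := (A aCount)(R rX := A aCount (R rX) + R rOne))) (t + 5)"
  by (auto simp: add_count_def numeral_eq_Suc)

lemma wp_remove_count:
  "wp L W remove_count Q R A t \<longleftrightarrow> R rX < L \<and> R rOne \<le> A aCount (R rX) \<and>
     Q (R(rY := A aCount (R rX) - R rOne)) (A(aCount := (A aCount)(R rX := A aCount (R rX) - R rOne))) (t + 5)"
  by (auto simp: remove_count_def numeral_eq_Suc)

lemma wp_clear_counts:
  assumes s: "std R A"
  shows "wp L W clear_counts
    (\<lambda>R' A' t'. (\<forall>v<n. A' aCount v = 0 \<and> A' aValues v = 0) \<and> t' \<le> t + 10 * L) R A t"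
  unfolding clear_counts_def
proof (rule wp_for_vertices[OF s, where I = "\<lambda>k R' A' t'. (\<forall>v<k. A' aCount v = 0 \<and> A' aValues v = 0) \<and> t' \<le> t + 3 + 7 * k"])
  fix k R' A' t'
  assume "k < n" "R' rV = k" "(\<forall>v<k. A' aCount v = 0 \<and> A' aValues v = 0) \<and> t' \<le> t + 3 + 7 * k" "std R' A'"
  then show "wp L W (Put aCount rV rZero;; Put aValues rV rZero)
    (\<lambda>R' A' t'. (\<forall>v<Suc k. A' aCount v = 0 \<and> A' aValues v = 0) \<and> t' + 3 \<le> t + 3 + 7 * Suc k) R' A' t'"
    using n_less_L by (auto simp: less_Suc_eq dest: stdD)
qed (use n_less_L in auto)

lemma wp_count_labels:
  assumes s: "std R A" and a: "\<forall>v<n. A aLabel v < n" and z: "\<forall>x<n. A aCount x = 0"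
  shows "wp L W count_labels
    (\<lambda>R' A' t'. (\<forall>x<n. A' aCount x = cnt (A aLabel) {..<n} x) \<and> t' \<le> t + 13 * L) R A t"
  unfolding count_labels_def
proof (rule wp_for_vertices[OF s, where I = "\<lambda>k R' A' t'. (\<forall>x<n. A' aCount x = cnt (A aLabel) {..<k} x) \<and> t' \<le> t + 3 + 10 * k"])
  fix k R' A' t'
  assume k: "k < n" "R' rV = k" and I: "(\<forall>x<n. A' aCount x = cnt (A aLabel) {..<k} x) \<and> t' \<le> t + 3 + 10 * k"
    and s': "std R' A'" and f: "\<forall>j. j \<notin> puts (Get rX aLabel rV;; add_count) \<longrightarrow> A' j = A j"
  have "cnt (A aLabel) {..<k} (A aLabel k) \<le> k" using cnt_le_card[of "{..<k}"] by simp
  moreover have "A aLabel k < n" using a k by simp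
  ultimately show "wp L W (Get rX aLabel rV;; add_count)
    (\<lambda>R' A' t'. (\<forall>x<n. A' aCount x = cnt (A aLabel) {..<Suc k} x) \<and> t' + 3 \<le> t + 3 + 10 * Suc k) R' A' t'"
    using n_less_L W k I f stdD[OF s'] by (simp add: wp_add_count lessThan_Suc cnt_insert)
qed (use n_less_L z in \<open>auto simp: cnt_def\<close>)

lemma wp_collect_values:
  assumes s: "std R A" and z: "\<forall>p<n. A aValues p = 0"
  defines "vs \<equiv> filter (\<lambda>x. 0 < A aCount x) [0..<n]"
  shows "wp L W collect_values
    (\<lambda>R' A' t'. (\<forall>p<n. A' aValues p = (if p < length vs then vs ! p else 0)) \<and> t' \<le> t + 14 * L) R A t"
proof -
  define v where "v k = filter (\<lambda>x. 0 < A aCount x) [0..<k]" for k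
  have v_Suc: "v (Suc k) = v k @ (if 0 < A aCount k then [k] else [])" for k by (simp add: v_def)
  have v_len: "length (v k) \<le> k" for k unfolding v_def using length_filter_le[of _ "[0..<k]"] by simp
  have "wp L W (for_vertices (Get rX aCount rV;; IfLt rZero rX (Put aValues rI rV;; Plus rI rI rOne) skip))
    (\<lambda>R' A' t'. (\<forall>p<n. A' aValues p = (if p < length vs then vs ! p else 0)) \<and> t' \<le> t + 14 * L)
    (R(rI := 0)) A (t + 1)"
  proof (rule wp_for_vertices[where I = "\<lambda>k R' A' t'. R' rI = length (v k) \<and>
       (\<forall>p<n. A' aValues p = (if p < length (v k) then v k ! p else 0)) \<and> t' \<le> t + 4 + 10 * k"])
    let ?c = "Get rX aCount rV;; IfLt rZero rX (Put aValues rI rV;; Plus rI rI rOne) skip"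
    fix k R' A' t'
    assume k: "k < n" "R' rV = k" and I: "R' rI = length (v k) \<and>
       (\<forall>p<n. A' aValues p = (if p < length (v k) then v k ! p else 0)) \<and> t' \<le> t + 4 + 10 * k"
      and s': "std R' A'" and f: "\<forall>j. j \<notin> puts ?c \<longrightarrow> A' j = A j"
    have "length (v k) < n" using v_len[of k] k by simp
    then show "wp L W ?c (\<lambda>R' A' t'. (R'(rV := Suc k)) rI = length (v (Suc k)) \<and>
       (\<forall>p<n. A' aValues p = (if p < length (v (Suc k)) then v (Suc k) ! p else 0)) \<and> t' + 3 \<le> t + 4 + 10 * Suc k) R' A' t'"
      using k I f n_less_L W stdD[OF s'] by (auto simp: v_Suc wp_skip nth_append less_Suc_eq)
  qed (use s z n_less_L in \<open>auto simp: std_def v_def vs_def\<close>)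
  then show ?thesis unfolding collect_values_def using stdD[OF s] by simp
qed

lemma wp_remove_nbrs:
  assumes s: "std R A" and v: "R rV = v" "v < n" and a: "\<forall>u<n. A aLabel u < n"
    and c: "\<forall>x<n. A aCount x = cnt (A aLabel) {..<n} x"
  shows "wp L W remove_nbrs
    (\<lambda>R' A' t'. (\<forall>x<n. A' aCount x = cnt (A aLabel) ({..<n} - nb v) x) \<and> t' \<le> t + 9 + 12 * deg v) R A t"
  unfolding remove_nbrs_def
proof (rule wp_for_nbrs[OF s _ _ v, where I = "\<lambda>j R' A' t'.
    (\<forall>x<n. A' aCount x = cnt (A aLabel) ({..<n} - set (take j (adj ! v))) x) \<and> t' \<le> t + 9 + 12 * j"])
  let ?c = "Get rX aLabel rU;; remove_count"
  fix j R' A' t'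
  assume j: "j < deg v" "adj ! v ! j < n" and s': "std R' A'" and f: "\<forall>j. j \<notin> puts ?c \<longrightarrow> A' j = A j"
    and I: "(\<forall>x<n. A' aCount x = cnt (A aLabel) ({..<n} - set (take j (adj ! v))) x) \<and> t' \<le> t + 9 + 12 * j"
  let ?S = "{..<n} - set (take (Suc j) (adj ! v))"
  have nt: "adj ! v ! j \<notin> set (take j (adj ! v))"
    using j distinct[OF v(2)] by (auto simp: in_set_conv_nth nth_eq_iff_index_eq)
  then have eq: "{..<n} - set (take j (adj ! v)) = insert (adj ! v ! j) ?S" "adj ! v ! j \<notin> ?S"
    using j by (auto simp: take_Suc_conv_app_nth)
  have "A aLabel (adj ! v ! j) < n" using a j by simp
  then show "wp L W ?c (\<lambda>R' A' t'. (\<forall>x<n. A' aCount x = cnt (A aLabel) ({..<n} - set (take (Suc j) (adj ! v))) x) \<and>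
      t' + 3 \<le> t + 9 + 12 * Suc j) (R'(rU := adj ! v ! j)) A' (t' + 2)"
    using I j n_less_L f stdD[OF s'] eq(2) unfolding eq(1) by (simp add: wp_remove_count cnt_insert)
qed (use c in auto)

lemma wp_restore_nbrs:
  assumes s: "std R A" and v: "R rV = v" "v < n" and a: "\<forall>u<n. A aLabel u < n"
    and c: "\<forall>x<n. A aCount x = cnt (A aLabel) ({..<n} - nb v) x"
  shows "wp L W restore_nbrs
    (\<lambda>R' A' t'. (\<forall>x<n. A' aCount x = cnt (A aLabel) {..<n} x) \<and> t' \<le> t + 9 + 12 * deg v) R A t"
  unfolding restore_nbrs_def
proof (rule wp_for_nbrs[OF s _ _ v, where I = "\<lambda>j R' A' t'.
    (\<forall>x<n. A' aCount x = cnt (A aLabel) ({..<n} - nb v \<union> set (take j (adj ! v))) x) \<and> t' \<le> t + 9 + 12 * j"])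
  let ?c = "Get rX aLabel rU;; add_count"
  fix j R' A' t'
  assume j: "j < deg v" "adj ! v ! j < n" and s': "std R' A'" and f: "\<forall>j. j \<notin> puts ?c \<longrightarrow> A' j = A j"
    and I: "(\<forall>x<n. A' aCount x = cnt (A aLabel) ({..<n} - nb v \<union> set (take j (adj ! v))) x) \<and> t' \<le> t + 9 + 12 * j"
  let ?S = "{..<n} - nb v \<union> set (take j (adj ! v))"
  have nt: "adj ! v ! j \<notin> ?S"
    using j distinct[OF v(2)] by (auto simp: in_set_conv_nth nth_eq_iff_index_eq)
  have eq: "{..<n} - nb v \<union> set (take (Suc j) (adj ! v)) = insert (adj ! v ! j) ?S"
    using j by (auto simp: take_Suc_conv_app_nth)
  have "?S \<subseteq> {..<n}" using nbrs[OF v(2)] set_take_subset[of j "adj ! v"] by blast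
  then have "card ?S \<le> n" using card_mono[of "{..<n}" ?S] by simp
  then have "cnt (A aLabel) ?S (A aLabel (adj ! v ! j)) \<le> n" using cnt_le_card[of ?S] le_trans by blast
  moreover have "A aLabel (adj ! v ! j) < n" using a j by simp
  ultimately show "wp L W ?c (\<lambda>R' A' t'. (\<forall>x<n. A' aCount x = cnt (A aLabel) ({..<n} - nb v \<union> set (take (Suc j) (adj ! v))) x) \<and>
      t' + 3 \<le> t + 9 + 12 * Suc j) (R'(rU := adj ! v ! j)) A' (t' + 2)"
    using I j n_less_L W f stdD[OF s'] nt unfolding eq by (simp add: wp_add_count cnt_insert)
next
  fix R' A' t'
  assume "(\<forall>x<n. A' aCount x = cnt (A aLabel) ({..<n} - nb v \<union> set (take (deg v) (adj ! v))) x) \<and> t' \<le> t + 9 + 12 * deg v"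
  moreover have "{..<n} - nb v \<union> nb v = {..<n}" using nbrs[OF v(2)] by auto
  ultimately show "(\<forall>x<n. A' aCount x = cnt (A aLabel) {..<n} x) \<and> t' \<le> t + 9 + 12 * deg v" by simp
qed (use c in auto)

end

text \<open>Read \<open>S\<close> as the set of non-neighbours of a vertex. All values that precede the minimum over \<open>S\<close> in the sorted list occur only
  outside \<open>S\<close>, so there are at most as many of them as neighbours.\<close>

lemma Min_among_first_values:
  fixes a :: "nat \<Rightarrow> nat"
  assumes S: "S \<subseteq> {..<n}" "S \<noteq> {}" and a: "\<And>u. u < n \<Longrightarrow> a u < n"
  defines "vs \<equiv> filter (\<lambda>x. 0 < cnt a {..<n} x) [0..<n]"
  shows "\<exists>p\<le>card ({..<n} - S). p < length vs \<and> vs ! p = Min (a ` S)"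
proof -
  have fin: "finite S" using S(1) finite_subset by blast
  then have m: "Min (a ` S) \<in> a ` S" using S(2) by (intro Min_in) auto
  have vs: "set vs = a ` {..<n}" using a by (auto simp: vs_def cnt_pos_iff)
  have sorted: "sorted_wrt (<) vs" unfolding vs_def by (intro sorted_wrt_filter sorted_wrt_upt)
  have "Min (a ` S) \<in> set vs" unfolding vs using m S(1) by blast
  then obtain p where p: "p < length vs" "vs ! p = Min (a ` S)" by (auto simp: in_set_conv_nth)
  have "set (take p vs) \<subseteq> a ` ({..<n} - S)"
  proof
    fix x assume x: "x \<in> set (take p vs)"
    then obtain i where "i < p" "x = vs ! i" using p(1) by (auto simp: in_set_conv_nth)
    then have less: "x < Min (a ` S)" using sorted_wrt_nth_less[OF sorted, of i p] p by simp
    have "x \<in> a ` {..<n}" using x vs set_take_subset by fast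
    moreover have "x \<notin> a ` S" using less fin by (meson Min_le finite_imageI leD)
    ultimately show "x \<in> a ` ({..<n} - S)" by blast
  qed
  then have "card (set (take p vs)) \<le> card (a ` ({..<n} - S))" by (intro card_mono) auto
  also have "\<dots> \<le> card ({..<n} - S)" by (intro card_image_le) auto
  finally have "card (set (take p vs)) \<le> card ({..<n} - S)" .
  moreover have "card (set (take p vs)) = p"
    using p(1) by (subst distinct_card) (auto simp: vs_def intro!: distinct_take)
  ultimately show ?thesis using p by auto
qed

context program_input
begin

text \<open>Cells after the last value hold 0, the least of all labels, so reading them is harmless:
  if the count of 0 is positive, then 0 is indeed a label of a non-neighbour.\<close>

lemma wp_scan_values:
  fixes a defines "vs \<equiv> filter (\<lambda>x. 0 < cnt a {..<n} x) [0..<n]"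
  assumes s: "std R A" and v: "R rV = v" "v < n" and a: "\<forall>u<n. a u < n" "A aLabel v = a v"
    and d: "A aDegree v = deg v"
    and c: "\<forall>x<n. A aCount x = cnt a ({..<n} - nb v) x"
    and vals: "\<forall>p<n. A aValues p = (if p < length vs then vs ! p else 0)"
  shows "wp L W scan_values
    (\<lambda>R' A' t'. R' rBest = Min (a ` ({..<n} - nb v)) \<and> t' \<le> t + 20 + 12 * deg v) R A t"
proof -
  let ?S = "{..<n} - nb v"
  let ?c = "Get rX aValues rI;; Get rY aCount rX;; IfLt rZero rY (IfLt rX rBest (Copy rBest rX) skip) skip"
  let ?R = "R(rBest := a v, rLen := Suc (deg v))"
  have vS: "v \<in> ?S" using v(2) nbrs[OF v(2)] by auto
  have dn: "deg v < n" using deg_less[OF v(2)] .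
  have nbS: "{..<n} - ?S = nb v" using nbrs[OF v(2)] by auto
  have val_less: "A aValues p < n" if "p < n" for p
  proof (cases "p < length vs")
    case True
    then have "vs ! p \<in> set vs" by simp
    then show ?thesis using vals that True by (simp add: vs_def)
  qed (use vals that v in auto)
  have "wp L W (For rI rZero rLen ?c)
    (\<lambda>R' A' t'. R' rBest = Min (a ` ?S) \<and> t' \<le> t + 20 + 12 * deg v) ?R A (t + 2 + 2 + 1)"
  proof (rule wp_For[where I = "\<lambda>k R' A' t'. R' rBest \<in> a ` ?S \<and>
      (\<forall>p<k. A aValues p \<in> a ` ?S \<longrightarrow> R' rBest \<le> A aValues p) \<and> t' \<le> t + 8 + 12 * k"])
    fix k R' A' t'
    assume k: "k < ?R rLen" "R' rI = k" and f: "\<forall>r. r \<notin> insert rI (mods ?c) \<longrightarrow> R' r = ?R r"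
      "\<forall>j. j \<notin> puts ?c \<longrightarrow> A' j = A j"
      and I: "R' rBest \<in> a ` ?S \<and> (\<forall>p<k. A aValues p \<in> a ` ?S \<longrightarrow> R' rBest \<le> A aValues p) \<and> t' \<le> t + 8 + 12 * k"
    have kn: "k < n" using k(1) dn by simp
    have "R' rZero = 0" using f(1) stdD[OF s] by simp
    moreover have "A' = A" using f(2) by (intro ext) simp
    moreover have "0 < A aCount (A aValues k) \<longleftrightarrow> A aValues k \<in> a ` ?S"
      using c val_less[OF kn] by (simp add: cnt_pos_iff)
    ultimately show "wp L W ?c (\<lambda>R' A' t'. (R'(rI := Suc k)) rBest \<in> a ` ?S \<and>
      (\<forall>p<Suc k. A aValues p \<in> a ` ?S \<longrightarrow> (R'(rI := Suc k)) rBest \<le> A aValues p) \<and> t' + 3 \<le> t + 8 + 12 * Suc k) R' A' t'"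
      using I k kn val_less[OF kn] n_less_L by (auto simp: wp_skip less_Suc_eq)
  next
    fix R' A' t'
    assume I: "R' rBest \<in> a ` ?S \<and> (\<forall>p<?R rLen. A aValues p \<in> a ` ?S \<longrightarrow> R' rBest \<le> A aValues p) \<and> t' \<le> t + 8 + 12 * ?R rLen"
    obtain p where p: "p \<le> card (nb v)" "p < length vs" "vs ! p = Min (a ` ?S)"
      using Min_among_first_values[of ?S n a] vS a(1) nbS unfolding vs_def by auto
    have pn: "p \<le> deg v" using p(1) deg_eq_card[OF v(2)] by simp
    have eq: "A aValues p = Min (a ` ?S)" using vals p pn dn by simp
    have "Min (a ` ?S) \<in> a ` ?S" using vS by (intro Min_in) auto
    moreover have "p < ?R rLen" using pn by simp
    ultimately have "R' rBest \<le> Min (a ` ?S)" using I unfolding eq[symmetric] by blast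
    moreover have "Min (a ` ?S) \<le> R' rBest" using I by (intro Min_le) auto
    ultimately show "R' rBest = Min (a ` ?S) \<and> t' \<le> t + 20 + 12 * deg v" using I by simp
  qed (use vS v stdD[OF s] in auto)
  then show ?thesis unfolding scan_values_def
    using stdD[OF s] v a d dn n_less_L W by (simp del: wp.simps(9))
qed

lemma wp_co_pass:
  assumes s: "std R A" and a: "\<forall>v<n. A aLabel v < n" and d: "\<forall>v<n. A aDegree v = deg v"
  shows "wp L W co_pass
    (\<lambda>R' A' t'. (\<forall>v<n. A' aLabel v = Min (A aLabel ` ({..<n} - nb v))) \<and> t' \<le> t + 200 * L) R A t"
proof -
  let ?a = "A aLabel"
  define vs where "vs = filter (\<lambda>x. 0 < cnt ?a {..<n} x) [0..<n]"
  let ?c = "remove_nbrs;; scan_values;; restore_nbrs;; Put aNew rV rBest"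
  let ?Q = "\<lambda>R' A' t'. (\<forall>v<n. A' aLabel v = Min (?a ` ({..<n} - nb v))) \<and> t' \<le> t + 200 * L"
  have main: "wp L W (for_vertices ?c) (wp L W copy_labels ?Q) R0 A0 t0"
    if s: "std R0 A0" and lab: "A0 aLabel = ?a" and d: "A0 aDegree = A aDegree"
      and c: "\<forall>x<n. A0 aCount x = cnt ?a {..<n} x"
      and vals: "\<forall>p<n. A0 aValues p = (if p < length vs then vs ! p else 0)"
      and t0: "t0 \<le> t + 37 * L" for R0 A0 t0
  proof (rule wp_for_vertices[OF s, where I = "\<lambda>k R' A' t'.
      (\<forall>v<k. A' aNew v = Min (?a ` ({..<n} - nb v))) \<and> (\<forall>x<n. A' aCount x = cnt ?a {..<n} x) \<and>
      t' + 36 * off 0 \<le> t0 + 3 + 43 * k + 36 * off k"])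
    fix k R1 A1 t1
    assume k: "k < n" "R1 rV = k" and s1: "std R1 A1"
      and f: "\<forall>j. j \<notin> puts ?c \<longrightarrow> A1 j = A0 j"
      and I: "(\<forall>v<k. A1 aNew v = Min (?a ` ({..<n} - nb v))) \<and> (\<forall>x<n. A1 aCount x = cnt ?a {..<n} x) \<and>
        t1 + 36 * off 0 \<le> t0 + 3 + 43 * k + 36 * off k"
    have f1: "A1 aLabel = ?a" "A1 aDegree k = deg k" "\<forall>p<n. A1 aValues p = (if p < length vs then vs ! p else 0)"
      using f lab d vals assms(3) k by auto
    show "wp L W ?c (\<lambda>R' A' t'. (\<forall>v<Suc k. A' aNew v = Min (?a ` ({..<n} - nb v))) \<and>
        (\<forall>x<n. A' aCount x = cnt ?a {..<n} x) \<and> t' + 3 + 36 * off 0 \<le> t0 + 3 + 43 * Suc k + 36 * off (Suc k)) R1 A1 t1"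
      unfolding wp.simps(7)
    proof (rule wp_conseq[OF wp_remove_nbrs[OF s1 k(2,1)]])
      show "\<forall>u<n. A1 aLabel u < n" "\<forall>x<n. A1 aCount x = cnt (A1 aLabel) {..<n} x" using f1 a I by auto
      fix R2 A2 t2
      assume p2: "(\<forall>x<n. A2 aCount x = cnt (A1 aLabel) ({..<n} - nb k) x) \<and> t2 \<le> t1 + 9 + 12 * deg k"
        and f2: "\<forall>r. r \<notin> mods remove_nbrs \<longrightarrow> R2 r = R1 r" "\<forall>k. k \<notin> puts remove_nbrs \<longrightarrow> A2 k = A1 k"
      have s2: "std R2 A2" by (rule std_frame[OF s1 f2]) auto
      have k2: "R2 rV = k" using f2(1) k by simp
      show "wp L W scan_values (wp L W restore_nbrs (wp L W (Put aNew rV rBest)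
        (\<lambda>R' A' t'. (\<forall>v<Suc k. A' aNew v = Min (?a ` ({..<n} - nb v))) \<and>
        (\<forall>x<n. A' aCount x = cnt ?a {..<n} x) \<and> t' + 3 + 36 * off 0 \<le> t0 + 3 + 43 * Suc k + 36 * off (Suc k)))) R2 A2 t2"
      proof (rule wp_conseq[OF wp_scan_values[OF s2 k2 k(1), where a = ?a]])
        show "\<forall>u<n. ?a u < n" "A2 aLabel k = ?a k" "A2 aDegree k = deg k"
          "\<forall>x<n. A2 aCount x = cnt ?a ({..<n} - nb k) x"
          "\<forall>p<n. A2 aValues p = (if p < length (filter (\<lambda>x. 0 < cnt ?a {..<n} x) [0..<n])
              then filter (\<lambda>x. 0 < cnt ?a {..<n} x) [0..<n] ! p else 0)"
          using a p2 f1 f2 by (simp_all add: vs_def)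
        fix R3 A3 t3
        assume p3: "R3 rBest = Min (?a ` ({..<n} - nb k)) \<and> t3 \<le> t2 + 20 + 12 * deg k"
          and f3: "\<forall>r. r \<notin> mods scan_values \<longrightarrow> R3 r = R2 r" "\<forall>k. k \<notin> puts scan_values \<longrightarrow> A3 k = A2 k"
        have s3: "std R3 A3" by (rule std_frame[OF s2 f3]) auto
        have k3: "R3 rV = k" and A3: "A3 = A2" using f3 k2 by (auto intro!: ext)
        show "wp L W restore_nbrs (wp L W (Put aNew rV rBest)
          (\<lambda>R' A' t'. (\<forall>v<Suc k. A' aNew v = Min (?a ` ({..<n} - nb v))) \<and>
          (\<forall>x<n. A' aCount x = cnt ?a {..<n} x) \<and> t' + 3 + 36 * off 0 \<le> t0 + 3 + 43 * Suc k + 36 * off (Suc k))) R3 A3 t3"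
        proof (rule wp_conseq[OF wp_restore_nbrs[OF s3 k3 k(1)]])
          show "\<forall>u<n. A3 aLabel u < n" "\<forall>x<n. A3 aCount x = cnt (A3 aLabel) ({..<n} - nb k) x"
            using p2 f2 f1 a A3 by auto
          fix R4 A4 t4
          assume p4: "(\<forall>x<n. A4 aCount x = cnt (A3 aLabel) {..<n} x) \<and> t4 \<le> t3 + 9 + 12 * deg k"
            and f4: "\<forall>r. r \<notin> mods restore_nbrs \<longrightarrow> R4 r = R3 r" "\<forall>k. k \<notin> puts restore_nbrs \<longrightarrow> A4 k = A3 k"
          have e: "R4 rV = k" "R4 rBest = Min (?a ` ({..<n} - nb k))" "A3 aLabel = ?a" "A4 aNew = A1 aNew"
            using f4 k3 p3 A3 f2 f1 by auto
          have "off (Suc k) = off k + deg k" using off_Suc k by simp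
          then show "wp L W (Put aNew rV rBest)
            (\<lambda>R' A' t'. (\<forall>v<Suc k. A' aNew v = Min (?a ` ({..<n} - nb v))) \<and>
            (\<forall>x<n. A' aCount x = cnt ?a {..<n} x) \<and> t' + 3 + 36 * off 0 \<le> t0 + 3 + 43 * Suc k + 36 * off (Suc k)) R4 A4 t4"
            using e p2 p3 p4 I k n_less_L by (auto simp: less_Suc_eq)
        qed
      qed
    qed
  next
    fix R1 A1 t1
    assume s1: "std R1 A1" and I: "(\<forall>v<n. A1 aNew v = Min (?a ` ({..<n} - nb v))) \<and>
      (\<forall>x<n. A1 aCount x = cnt ?a {..<n} x) \<and> t1 + 36 * off 0 \<le> t0 + 3 + 43 * n + 36 * off n"
    show "wp L W copy_labels ?Q R1 A1 t1"
      by (rule wp_mono[OF wp_copy_labels[OF s1]]) (use I t0 n_less_L off_0 L_off in auto)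
  qed (use c in auto)
  show ?thesis unfolding co_pass_def wp.simps(7)
  proof (rule wp_conseq[OF wp_clear_counts[OF s]])
    fix R1 A1 t1
    assume p1: "(\<forall>v<n. A1 aCount v = 0 \<and> A1 aValues v = 0) \<and> t1 \<le> t + 10 * L"
      and f1: "\<forall>r. r \<notin> mods clear_counts \<longrightarrow> R1 r = R r" "\<forall>k. k \<notin> puts clear_counts \<longrightarrow> A1 k = A k"
    have s1: "std R1 A1" by (rule std_frame[OF s f1]) auto
    show "wp L W count_labels (wp L W collect_values (wp L W (for_vertices ?c) (wp L W copy_labels ?Q))) R1 A1 t1"
    proof (rule wp_conseq[OF wp_count_labels[OF s1]])
      show "\<forall>v<n. A1 aLabel v < n" "\<forall>x<n. A1 aCount x = 0" using p1 f1 a by auto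
      fix R2 A2 t2
      assume p2: "(\<forall>x<n. A2 aCount x = cnt (A1 aLabel) {..<n} x) \<and> t2 \<le> t1 + 13 * L"
        and f2: "\<forall>r. r \<notin> mods count_labels \<longrightarrow> R2 r = R1 r" "\<forall>k. k \<notin> puts count_labels \<longrightarrow> A2 k = A1 k"
      have s2: "std R2 A2" by (rule std_frame[OF s1 f2]) auto
      have vs: "vs = filter (\<lambda>x. 0 < A2 aCount x) [0..<n]"
        unfolding vs_def using p2 f1 by (intro filter_cong) auto
      show "wp L W collect_values (wp L W (for_vertices ?c) (wp L W copy_labels ?Q)) R2 A2 t2"
      proof (rule wp_conseq[OF wp_collect_values[OF s2]])
        show "\<forall>p<n. A2 aValues p = 0" using p1 f2 by simp
        fix R3 A3 t3
        assume p3: "(\<forall>p<n. A3 aValues p = (if p < length (filter (\<lambda>x. 0 < A2 aCount x) [0..<n])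
              then filter (\<lambda>x. 0 < A2 aCount x) [0..<n] ! p else 0)) \<and> t3 \<le> t2 + 14 * L"
          and f3: "\<forall>r. r \<notin> mods collect_values \<longrightarrow> R3 r = R2 r" "\<forall>k. k \<notin> puts collect_values \<longrightarrow> A3 k = A2 k"
        have s3: "std R3 A3" by (rule std_frame[OF s2 f3]) auto
        show "wp L W (for_vertices ?c) (wp L W copy_labels ?Q) R3 A3 t3"
          by (rule main[OF s3]) (use p1 p2 p3 f1 f2 f3 vs in auto)
      qed
    qed
  qed
qed

end

section \<open>The program\<close>

definition test_labels :: com where
  "test_labels = (SetC rFlag 0;; for_vertices (Get rX aLabel rV;; IfLt rZero rX (SetC rFlag 1) skip))"

definition complement_degrees :: com where
  "complement_degrees = for_vertices (Get rX aDegree rV;; Minus rY rN rOne;; Minus rY rY rX;; Put aDegree rV rY)"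

text \<open>The graph is connected if and only if all labels are 0; then the complement is used.\<close>

definition find_blocks :: com where
  "find_blocks = (init_labels;; init_degrees;; closed_pass;; closed_pass;; test_labels;;
     IfLt rZero rFlag skip (init_labels;; co_pass;; co_pass;; complement_degrees))"

definition measure_blocks :: com where
  "measure_blocks = for_vertices
     (Get rX aLabel rV;; Get rY aSize rX;; Plus rY rY rOne;; Put aSize rX rY;;
      Get rY aMax rX;; Get rU aDegree rV;; IfLt rY rU (Put aMax rX rU) skip)"

text \<open>If just one component is big, then the values recorded last are its size and its cost.\<close>

definition add_cost :: com where
  "add_cost =
     (Plus rBig rBig rOne;; Get rY aMax rV;; Minus rY rX rY;; Plus rY rY rOne;; IfLt rFour rY (Copy rY rFour) skip;;
      Plus rSum rSum rY;; Copy rSize rX;; Copy rCost rY)"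

definition sum_costs :: com where
  "sum_costs = (SetC rSum 0;; SetC rBig 0;; SetC rFour 4;;
     for_vertices (Get rX aSize rV;; IfLt rZero rX (IfLt rX rTwo (Plus rSum rSum rOne) add_cost) skip))"

definition find_min_degree :: com where
  "find_min_degree = (Copy rBest rN;; Copy rA rZero;;
     for_vertices (Get rX aDegree rV;; IfLt rZero rX (IfLt rX rBest (Copy rBest rX;; Copy rA rV) skip) skip))"

definition mark_nbrs :: com where
  "mark_nbrs = (for_nbrs rA (Put aMark rU rOne);; Minus rDegA rTo rFrom)"

text \<open>With \<open>c\<close> common neighbours, \<open>deg v + deg a - 2 * c\<close> vertices are adjacent to exactly one of \<open>v\<close> and \<open>a\<close>, including
  \<open>v\<close> and \<open>a\<close> themselves if they are adjacent. For a splitting pair of a component of size \<open>s\<close>, the others must be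
  \<open>s - 2\<close> in number. The equation is arranged without subtraction.\<close>

definition check_pair :: com where
  "check_pair =
     (SetC rC 0;; for_nbrs rV (Get rX aMark rU;; Plus rC rC rX);; Minus rY rTo rFrom;; Plus rY rY rDegA;;
      Plus rY rY rTwo;; Get rX aMark rV;; Plus rX rX rC;; Plus rX rX rX;; Plus rX rX rSize;;
      IfLt rX rY skip (IfLt rY rX skip (SetC rFlag 1)))"

definition search_pair :: com where
  "search_pair = for_vertices (Get rX aDegree rV;; IfLt rZero rX check_pair skip)"

text \<open>With no big component or with several of them, the sum is already the minimum weight.\<close>

definition adjust :: com where
  "adjust = IfLt rOne rBig skip (IfLt rBig rOne skip
     (SetC rFlag 0;; SetC rThree 3;; IfLt rSize rThree (SetC rFlag 1) skip;;
      IfLt rCost rFour skip (find_min_degree;; mark_nbrs;; search_pair);;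
      IfLt rZero rFlag skip (Plus rSum rSum rOne)))"

definition program :: com where
  "program = (SetC rOne 1;; SetC rTwo 2;; Get rN aInput rZero;;
     find_blocks;; measure_blocks;; sum_costs;; adjust;; Copy 0 rSum)"

lemma mods_program_parts [simp]:
  "mods init_labels = {rV}" "puts init_labels = {aLabel}"
  "mods init_degrees = {rV, rX, rY}" "puts init_degrees = {aDegree}"
  "mods copy_labels = {rV, rX}" "puts copy_labels = {aLabel}"
  "mods closed_pass = {rV, rX, rBest, rFrom, rTo, rE, rU}" "puts closed_pass = {aNew, aLabel}"
  "mods co_pass = {rV, rX, rY, rI, rBest, rLen, rFrom, rTo, rE, rU}" "puts co_pass = {aCount, aValues, aNew, aLabel}"
  "mods test_labels = {rFlag, rV, rX}" "puts test_labels = {}"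
  "mods complement_degrees = {rV, rX, rY}" "puts complement_degrees = {aDegree}"
  by (auto simp: init_labels_def init_degrees_def copy_labels_def closed_pass_def co_pass_def test_labels_def
      complement_degrees_def)

lemma mods_program_parts2 [simp]:
  "mods find_blocks = {rV, rX, rY, rI, rBest, rLen, rFrom, rTo, rE, rU, rFlag}"
  "puts find_blocks = {aCount, aValues, aNew, aLabel, aDegree}"
  "mods measure_blocks = {rV, rX, rY, rU}" "puts measure_blocks = {aSize, aMax}"
  "mods add_cost = {rBig, rX, rY, rSum, rSize, rCost}" "puts add_cost = {}"
  "mods sum_costs = {rSum, rBig, rFour, rV, rX, rY, rSize, rCost}" "puts sum_costs = {}"
  "mods find_min_degree = {rBest, rA, rV, rX}" "puts find_min_degree = {}"
  "mods mark_nbrs = {rFrom, rTo, rE, rU, rDegA}" "puts mark_nbrs = {aMark}"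
  "mods check_pair = {rC, rFrom, rTo, rE, rU, rX, rY, rFlag}" "puts check_pair = {}"
  "mods search_pair = {rV, rC, rFrom, rTo, rE, rU, rX, rY, rFlag}" "puts search_pair = {}"
  by (auto simp: find_blocks_def measure_blocks_def add_cost_def sum_costs_def find_min_degree_def mark_nbrs_def
      check_pair_def search_pair_def)

lemma wf_program: "wfc program"
  by (simp add: program_def find_blocks_def measure_blocks_def sum_costs_def add_cost_def adjust_def
      find_min_degree_def mark_nbrs_def search_pair_def check_pair_def init_labels_def init_degrees_def
      closed_pass_def copy_labels_def co_pass_def clear_counts_def count_labels_def collect_values_def
      remove_nbrs_def restore_nbrs_def scan_values_def test_labels_def complement_degrees_def
      add_count_def remove_count_def)

context program_input
begin

lemma wp_test_labels:
  assumes s: "std R A"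
  shows "wp L W test_labels
    (\<lambda>R' A' t'. R' rFlag = (if \<forall>v<n. A aLabel v = 0 then 0 else 1) \<and> t' \<le> t + 14 * L) R A t"
proof -
  let ?c = "Get rX aLabel rV;; IfLt rZero rX (SetC rFlag 1) skip"
  have "wp L W (for_vertices ?c)
    (\<lambda>R' A' t'. R' rFlag = (if \<forall>v<n. A aLabel v = 0 then 0 else 1) \<and> t' \<le> t + 14 * L) (R(rFlag := 0)) A (t + 1)"
  proof (rule wp_for_vertices[where I = "\<lambda>k R' A' t'.
      R' rFlag = (if \<forall>v<k. A aLabel v = 0 then 0 else 1) \<and> t' \<le> t + 4 + 8 * k"])
    fix k R' A' t'
    assume k: "k < n" "R' rV = k" and s': "std R' A'" and f: "\<forall>j. j \<notin> puts ?c \<longrightarrow> A' j = A j"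
      and I: "R' rFlag = (if \<forall>v<k. A aLabel v = 0 then 0 else 1) \<and> t' \<le> t + 4 + 8 * k"
    then show "wp L W ?c (\<lambda>R' A' t'. (R'(rV := Suc k)) rFlag = (if \<forall>v<Suc k. A aLabel v = 0 then 0 else 1) \<and>
        t' + 3 \<le> t + 4 + 8 * Suc k) R' A' t'"
      using stdD[OF s'] n_less_L W by (auto simp: wp_skip less_Suc_eq)
  qed (use s n_less_L in \<open>auto simp: std_def\<close>)
  then show ?thesis unfolding test_labels_def using n_less_L W by (simp del: One_nat_def)
qed

lemma wp_complement_degrees:
  assumes s: "std R A" and d: "\<forall>v<n. A aDegree v < n"
  shows "wp L W complement_degrees
    (\<lambda>R' A' t'. (\<forall>v<n. A' aDegree v = n - 1 - A aDegree v) \<and> t' \<le> t + 12 * L) R A t"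
  unfolding complement_degrees_def
proof (rule wp_for_vertices[OF s, where I = "\<lambda>k R' A' t'. (\<forall>v<k. A' aDegree v = n - 1 - A aDegree v) \<and>
    (\<forall>v. k \<le> v \<longrightarrow> A' aDegree v = A aDegree v) \<and> t' \<le> t + 3 + 9 * k"])
  fix k R' A' t'
  assume k: "k < n" "R' rV = k" and s': "std R' A'"
    and I: "(\<forall>v<k. A' aDegree v = n - 1 - A aDegree v) \<and>
      (\<forall>v. k \<le> v \<longrightarrow> A' aDegree v = A aDegree v) \<and> t' \<le> t + 3 + 9 * k"
  have "A aDegree k < n" using d k by simp
  then show "wp L W (Get rX aDegree rV;; Minus rY rN rOne;; Minus rY rY rX;; Put aDegree rV rY)
    (\<lambda>R' A' t'. (\<forall>v<Suc k. A' aDegree v = n - 1 - A aDegree v) \<and>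
      (\<forall>v. Suc k \<le> v \<longrightarrow> A' aDegree v = A aDegree v) \<and> t' + 3 \<le> t + 3 + 9 * Suc k) R' A' t'"
    using k I stdD[OF s'] n_less_L by (auto simp: less_Suc_eq)
qed (use n_less_L in auto)

definition closed_leader :: "nat \<Rightarrow> nat" where
  "closed_leader v = Min ((\<lambda>u. Min (insert u (nb u))) ` insert v (nb v))"

definition co_leader :: "nat \<Rightarrow> nat" where
  "co_leader v = Min ((\<lambda>u. Min ({..<n} - nb u)) ` ({..<n} - nb v))"

lemma co_nbrs: "v < n \<Longrightarrow> v \<in> {..<n} - nb v" "v < n \<Longrightarrow> nb v \<subseteq> {..<n}"
  using nbrs by auto

lemma Min_co_less: "v < n \<Longrightarrow> Min ({..<n} - nb v) < n"
  using Min_in[of "{..<n} - nb v"] co_nbrs by auto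

lemma wp_find_blocks:
  assumes s: "std R A"
  shows "wp L W find_blocks
    (\<lambda>R' A' t'. (if \<forall>v<n. closed_leader v = 0
       then \<forall>v<n. A' aLabel v = co_leader v \<and> A' aDegree v = n - 1 - deg v
       else \<forall>v<n. A' aLabel v = closed_leader v \<and> A' aDegree v = deg v) \<and> t' \<le> t + 600 * L) R A t"
    (is "wp L W _ ?Q R A t")
  unfolding find_blocks_def wp.simps(7)
proof (rule wp_conseq[OF wp_init_labels[OF s]])
  fix R1 A1 t1
  assume p1: "(\<forall>v<n. A1 aLabel v = v) \<and> t1 \<le> t + 8 * L"
    and f1: "\<forall>r. r \<notin> mods init_labels \<longrightarrow> R1 r = R r" "\<forall>k. k \<notin> puts init_labels \<longrightarrow> A1 k = A k"
  have s1: "std R1 A1" by (rule std_frame[OF s f1]) auto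
  let ?P5 = "IfLt rZero rFlag skip (init_labels;; co_pass;; co_pass;; complement_degrees)"
  show "wp L W init_degrees (wp L W closed_pass (wp L W closed_pass (wp L W test_labels (wp L W ?P5 ?Q)))) R1 A1 t1"
  proof (rule wp_conseq[OF wp_init_degrees[OF s1]])
    fix R2 A2 t2
    assume p2: "(\<forall>v<n. A2 aDegree v = deg v) \<and> t2 \<le> t1 + 15 * L"
      and f2: "\<forall>r. r \<notin> mods init_degrees \<longrightarrow> R2 r = R1 r" "\<forall>k. k \<notin> puts init_degrees \<longrightarrow> A2 k = A1 k"
    have s2: "std R2 A2" by (rule std_frame[OF s1 f2]) auto
    show "wp L W closed_pass (wp L W closed_pass (wp L W test_labels (wp L W ?P5 ?Q))) R2 A2 t2"
    proof (rule wp_conseq[OF wp_closed_pass[OF s2]])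
      fix R3 A3 t3
      assume p3: "(\<forall>v<n. A3 aLabel v = Min (A2 aLabel ` insert v (nb v))) \<and> t3 \<le> t2 + 40 * L"
        and f3: "\<forall>r. r \<notin> mods closed_pass \<longrightarrow> R3 r = R2 r" "\<forall>k. k \<notin> puts closed_pass \<longrightarrow> A3 k = A2 k"
      have s3: "std R3 A3" by (rule std_frame[OF s2 f3]) auto
      have l3: "A3 aLabel v = Min (insert v (nb v))" if "v < n" for v
      proof -
        have "A2 aLabel ` insert v (nb v) = (\<lambda>u. u) ` insert v (nb v)"
          using f2 p1 that co_nbrs(2)[OF that] by (intro image_cong) auto
        then show ?thesis using p3 that by simp
      qed
      show "wp L W closed_pass (wp L W test_labels (wp L W ?P5 ?Q)) R3 A3 t3"
      proof (rule wp_conseq[OF wp_closed_pass[OF s3]])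
        fix R4 A4 t4
        assume p4: "(\<forall>v<n. A4 aLabel v = Min (A3 aLabel ` insert v (nb v))) \<and> t4 \<le> t3 + 40 * L"
          and f4: "\<forall>r. r \<notin> mods closed_pass \<longrightarrow> R4 r = R3 r" "\<forall>k. k \<notin> puts closed_pass \<longrightarrow> A4 k = A3 k"
        have s4: "std R4 A4" by (rule std_frame[OF s3 f4]) auto
        have l4: "A4 aLabel v = closed_leader v" if "v < n" for v
        proof -
          have "A3 aLabel ` insert v (nb v) = (\<lambda>u. Min (insert u (nb u))) ` insert v (nb v)"
            using l3 that co_nbrs(2)[OF that] by (intro image_cong) auto
          then show ?thesis using p4 that by (simp add: closed_leader_def)
        qed
        show "wp L W test_labels (wp L W ?P5 ?Q) R4 A4 t4"
        proof (rule wp_conseq[OF wp_test_labels[OF s4]])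
          fix R5 A5 t5
          assume p5: "R5 rFlag = (if \<forall>v<n. A4 aLabel v = 0 then 0 else 1) \<and> t5 \<le> t4 + 14 * L"
            and f5: "\<forall>r. r \<notin> mods test_labels \<longrightarrow> R5 r = R4 r" "\<forall>k. k \<notin> puts test_labels \<longrightarrow> A5 k = A4 k"
          have s5: "std R5 A5" by (rule std_frame[OF s4 f5]) auto
          have flag: "R5 rFlag = (if \<forall>v<n. closed_leader v = 0 then 0 else 1)" using p5 l4 by simp
          have t5: "t5 \<le> t + 117 * L" using p1 p2 p3 p4 p5 by linarith
          have d5: "\<forall>v<n. A5 aDegree v = deg v" using f5 f4 f3 p2 by simp
          show "wp L W ?P5 ?Q R5 A5 t5"
          proof (cases "\<forall>v<n. closed_leader v = 0")
            case False
            then have q: "?Q R5 A5 (t5 + 2 + 1)" using l4 f5 d5 t5 n_less_L by auto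
            have "R5 rZero < R5 rFlag" using False flag stdD[OF s5] by simp
            then show ?thesis unfolding wp.simps(8) wp_skip if_P[OF \<open>R5 rZero < R5 rFlag\<close>] using q by blast
          next
            case True
            have q: "wp L W (init_labels;; co_pass;; co_pass;; complement_degrees) ?Q R5 A5 (t5 + 2)"
              unfolding wp.simps(7)
            proof (rule wp_conseq[OF wp_init_labels[OF s5]])
              fix R6 A6 t6
              assume p6: "(\<forall>v<n. A6 aLabel v = v) \<and> t6 \<le> t5 + 2 + 8 * L"
                and f6: "\<forall>r. r \<notin> mods init_labels \<longrightarrow> R6 r = R5 r" "\<forall>k. k \<notin> puts init_labels \<longrightarrow> A6 k = A5 k"
              have s6: "std R6 A6" by (rule std_frame[OF s5 f6]) auto
              have d6: "\<forall>v<n. A6 aDegree v = deg v" using f6 d5 by simp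
              show "wp L W co_pass (wp L W co_pass (wp L W complement_degrees ?Q)) R6 A6 t6"
              proof (rule wp_conseq[OF wp_co_pass[OF s6 _ d6]])
                show "\<forall>v<n. A6 aLabel v < n" using p6 by simp
                fix R7 A7 t7
                assume p7: "(\<forall>v<n. A7 aLabel v = Min (A6 aLabel ` ({..<n} - nb v))) \<and> t7 \<le> t6 + 200 * L"
                  and f7: "\<forall>r. r \<notin> mods co_pass \<longrightarrow> R7 r = R6 r" "\<forall>k. k \<notin> puts co_pass \<longrightarrow> A7 k = A6 k"
                have s7: "std R7 A7" by (rule std_frame[OF s6 f7]) auto
                have d7: "\<forall>v<n. A7 aDegree v = deg v" using f7 d6 by simp
                have l7: "A7 aLabel v = Min ({..<n} - nb v)" if "v < n" for v
                proof -
                  have "A6 aLabel ` ({..<n} - nb v) = (\<lambda>u. u) ` ({..<n} - nb v)"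
                    using p6 by (intro image_cong) auto
                  then show ?thesis using p7 that by simp
                qed
                show "wp L W co_pass (wp L W complement_degrees ?Q) R7 A7 t7"
                proof (rule wp_conseq[OF wp_co_pass[OF s7 _ d7]])
                  show "\<forall>v<n. A7 aLabel v < n" using l7 Min_co_less by simp
                  fix R8 A8 t8
                  assume p8: "(\<forall>v<n. A8 aLabel v = Min (A7 aLabel ` ({..<n} - nb v))) \<and> t8 \<le> t7 + 200 * L"
                    and f8: "\<forall>r. r \<notin> mods co_pass \<longrightarrow> R8 r = R7 r" "\<forall>k. k \<notin> puts co_pass \<longrightarrow> A8 k = A7 k"
                  have s8: "std R8 A8" by (rule std_frame[OF s7 f8]) auto
                  have d8: "\<forall>v<n. A8 aDegree v = deg v" using f8 d7 by simp
                  have l8: "A8 aLabel v = co_leader v" if "v < n" for v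
                  proof -
                    have "A7 aLabel ` ({..<n} - nb v) = (\<lambda>u. Min ({..<n} - nb u)) ` ({..<n} - nb v)"
                      using l7 by (intro image_cong) auto
                    then show ?thesis using p8 that by (simp add: co_leader_def)
                  qed
                  show "wp L W complement_degrees ?Q R8 A8 t8"
                  proof (rule wp_conseq[OF wp_complement_degrees[OF s8]])
                    show "\<forall>v<n. A8 aDegree v < n" using d8 deg_less by simp
                    fix R9 A9 t9
                    assume p9: "(\<forall>v<n. A9 aDegree v = n - 1 - A8 aDegree v) \<and> t9 \<le> t8 + 12 * L"
                      and f9: "\<forall>k. k \<notin> puts complement_degrees \<longrightarrow> A9 k = A8 k"
                    have "t9 \<le> t + 600 * L" using t5 p6 p7 p8 p9 n_less_L by linarith
                    then show "?Q R9 A9 t9" using True p9 f9 d8 l8 by auto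
                  qed
                qed
              qed
            qed
            have "\<not> R5 rZero < R5 rFlag" using True flag stdD[OF s5] by simp
            then show ?thesis unfolding wp.simps(8) if_not_P[OF \<open>\<not> R5 rZero < R5 rFlag\<close>] using q by simp
          qed
        qed
      qed
    qed
  qed
qed

end

lemma sum_cost_le: "finite X \<Longrightarrow> (\<Sum>x\<in>X. cost (s x) (m x)) \<le> 4 * card X"
  using sum_bounded_above[of X "\<lambda>x. cost (s x) (m x)" 4] by (simp add: cost_def mult.commute)

context program_input
begin

lemma wp_measure_blocks:
  assumes s: "std R A" and a: "\<forall>v<n. A aLabel v < n" and z: "\<forall>x<n. A aSize x = 0 \<and> A aMax x = 0"
  shows "wp L W measure_blocks
    (\<lambda>R' A' t'. (\<forall>x<n. A' aSize x = cnt (A aLabel) {..<n} x \<and>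
       A' aMax x = Max (insert 0 (A aDegree ` {v. v < n \<and> A aLabel v = x}))) \<and> t' \<le> t + 21 * L) R A t"
  unfolding measure_blocks_def
proof (rule wp_for_vertices[OF s, where I = "\<lambda>k R' A' t'. (\<forall>x<n. A' aSize x = cnt (A aLabel) {..<k} x \<and>
    A' aMax x = Max (insert 0 (A aDegree ` {v. v < k \<and> A aLabel v = x}))) \<and> t' \<le> t + 3 + 18 * k"])
  let ?c = "Get rX aLabel rV;; Get rY aSize rX;; Plus rY rY rOne;; Put aSize rX rY;;
      Get rY aMax rX;; Get rU aDegree rV;; IfLt rY rU (Put aMax rX rU) skip"
  fix k R' A' t'
  assume k: "k < n" "R' rV = k" and s': "std R' A'" and f: "\<forall>j. j \<notin> puts ?c \<longrightarrow> A' j = A j"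
    and I: "(\<forall>x<n. A' aSize x = cnt (A aLabel) {..<k} x \<and>
      A' aMax x = Max (insert 0 (A aDegree ` {v. v < k \<and> A aLabel v = x}))) \<and> t' \<le> t + 3 + 18 * k"
  define m where "m k x = Max (insert 0 (A aDegree ` {v. v < k \<and> A aLabel v = x}))" for k x
  have m_Suc: "m (Suc k) x = (if A aLabel k = x then max (A aDegree k) (m k x) else m k x)" for x
  proof -
    have "{v. v < Suc k \<and> A aLabel v = x} =
      (if A aLabel k = x then insert k {v. v < k \<and> A aLabel v = x} else {v. v < k \<and> A aLabel v = x})"
      by (auto simp: less_Suc_eq)
    then show ?thesis unfolding m_def by (simp add: insert_commute[of 0])
  qed
  have "cnt (A aLabel) {..<k} (A aLabel k) \<le> k" using cnt_le_card[of "{..<k}"] by simp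
  moreover have "A aLabel k < n" using a k by simp
  ultimately show "wp L W ?c (\<lambda>R' A' t'. (\<forall>x<n. A' aSize x = cnt (A aLabel) {..<Suc k} x \<and>
      A' aMax x = Max (insert 0 (A aDegree ` {v. v < Suc k \<and> A aLabel v = x}))) \<and> t' + 3 \<le> t + 3 + 18 * Suc k) R' A' t'"
    using I k f n_less_L W stdD[OF s'] unfolding m_def[symmetric]
    by (auto simp: wp_skip m_Suc lessThan_Suc cnt_insert)
qed (use z n_less_L in \<open>auto simp: cnt_def\<close>)

lemma wp_sum_costs:
  fixes A defines "sz \<equiv> A aSize" and "cs \<equiv> \<lambda>x. cost (A aSize x) (A aMax x)"
  assumes s: "std R A" and m: "\<forall>x<n. A aMax x \<le> A aSize x" and b: "\<forall>x<n. A aSize x \<le> n"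
  shows "wp L W sum_costs
    (\<lambda>R' A' t'. R' rSum = (\<Sum>x | x < n \<and> 0 < sz x. cs x) \<and> R' rBig = card {x. x < n \<and> 2 \<le> sz x} \<and>
       (\<forall>x. {x. x < n \<and> 2 \<le> sz x} = {x} \<longrightarrow> R' rSize = sz x \<and> R' rCost = cs x) \<and>
       R' rFour = 4 \<and> t' \<le> t + 24 * L) R A t" (is "wp L W _ ?Q R A t")
proof -
  let ?c = "Get rX aSize rV;; IfLt rZero rX (IfLt rX rTwo (Plus rSum rSum rOne) add_cost) skip"
  define S where "S k = (\<Sum>x | x < k \<and> 0 < sz x. cs x)" for k
  define B where "B k = {x. x < k \<and> 2 \<le> sz x}" for k
  have S_Suc: "S (Suc k) = S k + (if 0 < sz k then cs k else 0)" for k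
  proof -
    have "{x. x < Suc k \<and> 0 < sz x} =
      (if 0 < sz k then insert k {x. x < k \<and> 0 < sz x} else {x. x < k \<and> 0 < sz x})"
      by (auto simp: less_Suc_eq)
    then show ?thesis by (simp add: S_def)
  qed
  have B_Suc: "B (Suc k) = (if 2 \<le> sz k then insert k (B k) else B k)" for k
    by (auto simp: B_def less_Suc_eq)
  have finB: "finite (B k)" and nB: "k \<notin> B k" for k by (auto simp: B_def)
  have S_le: "S k \<le> 4 * k" for k
  proof -
    have "card {x. x < k \<and> 0 < sz x} \<le> card {..<k}" by (intro card_mono) auto
    then show ?thesis unfolding S_def cs_def using sum_cost_le[of "{x. x < k \<and> 0 < sz x}" "A aSize" "A aMax"] by simp
  qed
  have B_le: "card (B k) \<le> k" for k using card_mono[of "{..<k}" "B k"] by (auto simp: B_def)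
  have "wp L W (for_vertices ?c) ?Q (R(rSum := 0, rBig := 0, rFour := 4)) A (t + 3)"
  proof (rule wp_for_vertices[where I = "\<lambda>k R' A' t'. R' rSum = S k \<and> R' rBig = card (B k) \<and>
       (\<forall>x. B k = {x} \<longrightarrow> R' rSize = sz x \<and> R' rCost = cs x) \<and> t' \<le> t + 6 + 20 * k"])
    fix k R' A' t'
    assume k: "k < n" "R' rV = k" and s': "std R' A'" and f: "\<forall>r. r \<notin> insert rV (mods ?c) \<longrightarrow> R' r = (R(rSum := 0, rBig := 0, rFour := 4)) r"
       "\<forall>j. j \<notin> puts ?c \<longrightarrow> A' j = A j"
      and I: "R' rSum = S k \<and> R' rBig = card (B k) \<and>
       (\<forall>x. B k = {x} \<longrightarrow> R' rSize = sz x \<and> R' rCost = cs x) \<and> t' \<le> t + 6 + 20 * k"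
    have A': "A' aSize k = sz k" "A' aMax k = A aMax k" using f(2) by (auto simp: sz_def)
    have four: "R' rFour = 4" using f(1) by simp
    have bnd: "A aMax k \<le> sz k" "sz k \<le> n" "S k \<le> 4 * n" "card (B k) \<le> n"
      using m b k S_le[of k] B_le[of k] by (auto simp: sz_def)
    consider "sz k = 0" | "sz k = 1" | "2 \<le> sz k" by linarith
    then show "wp L W ?c (\<lambda>R' A' t'. (R'(rV := Suc k)) rSum = S (Suc k) \<and> (R'(rV := Suc k)) rBig = card (B (Suc k)) \<and>
       (\<forall>x. B (Suc k) = {x} \<longrightarrow> (R'(rV := Suc k)) rSize = sz x \<and> (R'(rV := Suc k)) rCost = cs x) \<and>
       t' + 3 \<le> t + 6 + 20 * Suc k) R' A' t'"
    proof cases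
      case 1
      then show ?thesis using I k n_less_L A' stdD[OF s'] by (simp add: wp_skip S_Suc B_Suc)
    next
      case 2
      then have "cs k = 1" by (simp add: cs_def cost_def sz_def)
      then show ?thesis using I k n_less_L W 2 A' bnd stdD[OF s'] by (simp add: S_Suc B_Suc)
    next
      case 3
      have c: "cs k = min 4 (Suc (sz k - A aMax k))" using 3 by (simp add: cs_def cost_def sz_def)
      have "x = k" if "insert k (B k) = {x}" for x using that by blast
      then have B1: "(\<forall>x. insert k (B k) = {x} \<longrightarrow> P x) \<longleftrightarrow> (B k \<subseteq> {k} \<longrightarrow> P k)" for P by blast
      show ?thesis using I k n_less_L W 3 A' bnd four stdD[OF s'] nB finB
        by (auto simp: add_cost_def wp_skip S_Suc B_Suc c B1 min_def)
    qed
  next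
    fix R' A' t'
    assume f: "\<forall>r. r \<notin> insert rV (mods ?c) \<longrightarrow> R' r = (R(rSum := 0, rBig := 0, rFour := 4)) r"
      and I: "R' rSum = S n \<and> R' rBig = card (B n) \<and>
       (\<forall>x. B n = {x} \<longrightarrow> R' rSize = sz x \<and> R' rCost = cs x) \<and> t' \<le> t + 6 + 20 * n"
    have "R' rFour = 4" using f by simp
    then show "?Q R' A' t'" using I n_less_L unfolding S_def B_def by auto
  qed (use s in \<open>auto simp: std_def S_def B_def\<close>)
  then show ?thesis unfolding sum_costs_def using n_less_L W by (simp add: eval_nat_numeral)
qed

text \<open>Degree 0 identifies the isolated vertices, so the search is confined to the only big component.\<close>

lemma wp_find_min_degree:
  assumes s: "std R A" and d: "\<forall>v<n. A aDegree v < n" and ex: "\<exists>v<n. 0 < A aDegree v"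
  shows "wp L W find_min_degree
    (\<lambda>R' A' t'. R' rA < n \<and> 0 < A aDegree (R' rA) \<and> (\<forall>v<n. 0 < A aDegree v \<longrightarrow> A aDegree (R' rA) \<le> A aDegree v) \<and>
       t' \<le> t + 16 * L) R A t" (is "wp L W _ ?Q R A t")
proof -
  let ?c = "Get rX aDegree rV;; IfLt rZero rX (IfLt rX rBest (Copy rBest rX;; Copy rA rV) skip) skip"
  have "wp L W (for_vertices ?c) ?Q (R(rBest := n, rA := 0)) A (t + 2)"
  proof (rule wp_for_vertices[where I = "\<lambda>k R' A' t'. R' rBest \<le> n \<and>
      (\<forall>v<k. 0 < A aDegree v \<longrightarrow> R' rBest \<le> A aDegree v) \<and>
      (R' rBest < n \<longrightarrow> R' rA < n \<and> 0 < A aDegree (R' rA) \<and> A aDegree (R' rA) = R' rBest) \<and> t' \<le> t + 5 + 11 * k"])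
    fix k R' A' t'
    assume k: "k < n" "R' rV = k" and s': "std R' A'" and f: "\<forall>j. j \<notin> puts ?c \<longrightarrow> A' j = A j"
      and I: "R' rBest \<le> n \<and> (\<forall>v<k. 0 < A aDegree v \<longrightarrow> R' rBest \<le> A aDegree v) \<and>
      (R' rBest < n \<longrightarrow> R' rA < n \<and> 0 < A aDegree (R' rA) \<and> A aDegree (R' rA) = R' rBest) \<and> t' \<le> t + 5 + 11 * k"
    have "A' = A" using f by (intro ext) simp
    then show "wp L W ?c (\<lambda>R' A' t'. (R'(rV := Suc k)) rBest \<le> n \<and>
      (\<forall>v<Suc k. 0 < A aDegree v \<longrightarrow> (R'(rV := Suc k)) rBest \<le> A aDegree v) \<and>
      ((R'(rV := Suc k)) rBest < n \<longrightarrow> (R'(rV := Suc k)) rA < n \<and> 0 < A aDegree ((R'(rV := Suc k)) rA) \<and>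
        A aDegree ((R'(rV := Suc k)) rA) = (R'(rV := Suc k)) rBest) \<and> t' + 3 \<le> t + 5 + 11 * Suc k) R' A' t'"
      using I k n_less_L stdD[OF s'] by (auto simp: wp_skip less_Suc_eq)
  next
    fix R' A' t'
    assume I: "R' rBest \<le> n \<and> (\<forall>v<n. 0 < A aDegree v \<longrightarrow> R' rBest \<le> A aDegree v) \<and>
      (R' rBest < n \<longrightarrow> R' rA < n \<and> 0 < A aDegree (R' rA) \<and> A aDegree (R' rA) = R' rBest) \<and> t' \<le> t + 5 + 11 * n"
    have "R' rBest < n" using I ex d by (meson le_less_trans)
    then show "?Q R' A' t'" using I n_less_L by auto
  qed (use s in \<open>auto simp: std_def\<close>)
  then show ?thesis unfolding find_min_degree_def using stdD[OF s] by (simp add: eval_nat_numeral)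
qed

lemma wp_mark_nbrs:
  assumes s: "std R A" and a: "R rA = a" "a < n" and z: "\<forall>u<n. A aMark u = 0"
  shows "wp L W mark_nbrs
    (\<lambda>R' A' t'. (\<forall>u<n. A' aMark u = (if u \<in> nb a then 1 else 0)) \<and> R' rDegA = deg a \<and> t' \<le> t + 20 * L) R A t"
    (is "wp L W _ ?Q R A t")
proof -
  have "wp L W (for_nbrs rA (Put aMark rU rOne)) (wp L W (Minus rDegA rTo rFrom) ?Q) R A t"
  proof (rule wp_for_nbrs[OF s _ _ a, where I = "\<lambda>j R' A' t'.
      (\<forall>u<n. A' aMark u = (if u \<in> set (take j (adj ! a)) then 1 else 0)) \<and> t' \<le> t + 9 + 7 * j"])
    fix j R' A' t'
    assume "j < deg a" "adj ! a ! j < n" and s': "std R' A'"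
      and "(\<forall>u<n. A' aMark u = (if u \<in> set (take j (adj ! a)) then 1 else 0)) \<and> t' \<le> t + 9 + 7 * j"
    then show "wp L W (Put aMark rU rOne) (\<lambda>R' A' t'.
      (\<forall>u<n. A' aMark u = (if u \<in> set (take (Suc j) (adj ! a)) then 1 else 0)) \<and> t' + 3 \<le> t + 9 + 7 * Suc j)
      (R'(rU := adj ! a ! j)) A' (t' + 2)"
      using n_less_L stdD[OF s'] by (auto simp: take_Suc_conv_app_nth)
  next
    fix R' t' and A' :: "nat \<Rightarrow> nat \<Rightarrow> nat"
    assume "rFrom \<notin> mods (Put aMark rU rOne) \<longrightarrow> rTo \<notin> mods (Put aMark rU rOne) \<longrightarrow>
        R' rFrom = off a \<and> R' rTo = off a + deg a"
      "(\<forall>u<n. A' aMark u = (if u \<in> set (take (deg a) (adj ! a)) then 1 else 0)) \<and> t' \<le> t + 9 + 7 * deg a"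
    then show "wp L W (Minus rDegA rTo rFrom) ?Q R' A' t'" using deg_less[OF a(2)] n_less_L by auto
  qed (use z in auto)
  then show ?thesis unfolding mark_nbrs_def wp.simps(7) .
qed

text \<open>The equation tested by \<open>check_pair\<close>.\<close>

definition balanced :: "nat \<Rightarrow> nat \<Rightarrow> nat \<Rightarrow> bool" where
  "balanced s a v \<longleftrightarrow> deg v + deg a + 2 = s + 2 * (card (nb v \<inter> nb a) + (if v \<in> nb a then 1 else 0))"

lemma wp_check_pair:
  assumes s: "std R A" and v: "R rV = v" "v < n" and a: "a < n" and mk: "\<forall>u<n. A aMark u = (if u \<in> nb a then 1 else 0)"
    and r: "R rDegA = deg a" "R rSize \<le> n"
  shows "wp L W check_pair
    (\<lambda>R' A' t'. R' rFlag = (if balanced (R rSize) a v then 1 else R rFlag) \<and> t' \<le> t + 25 + 8 * deg v) R A t"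
proof -
  let ?P = "Minus rY rTo rFrom;; Plus rY rY rDegA;; Plus rY rY rTwo;; Get rX aMark rV;; Plus rX rX rC;; Plus rX rX rX;;
      Plus rX rX rSize;; IfLt rX rY skip (IfLt rY rX skip (SetC rFlag 1))"
  let ?Q = "\<lambda>R' A' t'. R' rFlag = (if balanced (R rSize) a v then 1 else R rFlag) \<and> t' \<le> t + 25 + 8 * deg v"
  have bnd: "card (set (take j (adj ! v)) \<inter> nb a) \<le> n" for j
  proof -
    have "card (set (take j (adj ! v)) \<inter> nb a) \<le> card {..<n}" using nbrs[OF a] by (intro card_mono) auto
    then show ?thesis by simp
  qed
  have "wp L W (for_nbrs rV (Get rX aMark rU;; Plus rC rC rX)) (wp L W ?P ?Q) (R(rC := 0)) A (t + 1)"
  proof (rule wp_for_nbrs[where u = v and I = "\<lambda>j R' A' t'.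
      R' rC = card (set (take j (adj ! v)) \<inter> nb a) \<and> t' \<le> t + 10 + 8 * j"])
    let ?c = "Get rX aMark rU;; Plus rC rC rX"
    fix j R' A' t'
    assume j: "j < deg v" "adj ! v ! j < n" and s': "std R' A'" and f: "\<forall>j. j \<notin> puts ?c \<longrightarrow> A' j = A j"
      and I: "R' rC = card (set (take j (adj ! v)) \<inter> nb a) \<and> t' \<le> t + 10 + 8 * j"
    have "adj ! v ! j \<notin> set (take j (adj ! v))"
      using j distinct[OF v(2)] by (auto simp: in_set_conv_nth nth_eq_iff_index_eq)
    then have "card (set (take (Suc j) (adj ! v)) \<inter> nb a) =
      card (set (take j (adj ! v)) \<inter> nb a) + (if adj ! v ! j \<in> nb a then 1 else 0)"
      using j by (simp add: take_Suc_conv_app_nth Int_insert_left)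
    then show "wp L W ?c (\<lambda>R' A' t'. (R'(rE := Suc (off v + j))) rC = card (set (take (Suc j) (adj ! v)) \<inter> nb a) \<and>
        t' + 3 \<le> t + 10 + 8 * Suc j) (R'(rU := adj ! v ! j)) A' (t' + 2)"
      using I j f mk n_less_L W bnd[of j] by simp
  next
    let ?c = "Get rX aMark rU;; Plus rC rC rX"
    fix R' A' t'
    assume s': "std R' A'" and f: "\<forall>r. r \<notin> {rE, rFrom, rTo, rU} \<union> mods ?c \<longrightarrow> R' r = (R(rC := 0)) r"
        "\<forall>j. j \<notin> puts ?c \<longrightarrow> A' j = A j"
        "rFrom \<notin> mods ?c \<longrightarrow> rTo \<notin> mods ?c \<longrightarrow> R' rFrom = off v \<and> R' rTo = off v + deg v"
      and I: "R' rC = card (set (take (deg v) (adj ! v)) \<inter> nb a) \<and> t' \<le> t + 10 + 8 * deg v"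
    have e: "R' rFrom = off v" "R' rTo = off v + deg v" "R' rV = v" "R' rDegA = deg a" "R' rSize = R rSize"
      "A' aMark v = (if v \<in> nb a then 1 else 0)" "R' rFlag = R rFlag" "R' rC = card (nb v \<inter> nb a)"
      using f v r mk I by auto
    have "card (nb v \<inter> nb a) \<le> n" using bnd[of "deg v"] by simp
    moreover have "num_arrays * (n + 2) \<le> W" using n_less_L W mult_le_mono2 le_trans by blast
    ultimately show "wp L W ?P ?Q R' A' t'"
      using e I v(2) n_less_L r(2) deg_less[OF v(2)] deg_less[OF a] stdD[OF s']
      by (auto simp: wp_skip balanced_def)
  qed (use s v in \<open>auto simp: std_def\<close>)
  then show ?thesis unfolding check_pair_def using W n_less_L by (simp del: One_nat_def)
qed

lemma wp_search_pair:
  assumes s: "std R A" and a: "a < n" and mk: "\<forall>u<n. A aMark u = (if u \<in> nb a then 1 else 0)"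
    and r: "R rDegA = deg a" "R rSize \<le> n"
  shows "wp L W search_pair
    (\<lambda>R' A' t'. R' rFlag = (if \<exists>v<n. 0 < A aDegree v \<and> balanced (R rSize) a v then 1 else R rFlag) \<and>
       t' \<le> t + 45 * L) R A t" (is "wp L W _ ?Q R A t")
  unfolding search_pair_def
proof (rule wp_for_vertices[OF s, where I = "\<lambda>k R' A' t'.
    R' rFlag = (if \<exists>v<k. 0 < A aDegree v \<and> balanced (R rSize) a v then 1 else R rFlag) \<and>
    t' + 8 * off 0 \<le> t + 3 + 32 * k + 8 * off k"])
  let ?c = "Get rX aDegree rV;; IfLt rZero rX check_pair skip"
  fix k R' A' t'
  assume k: "k < n" "R' rV = k" and s': "std R' A'"
    and f: "\<forall>r. r \<notin> insert rV (mods ?c) \<longrightarrow> R' r = R r" "\<forall>j. j \<notin> puts ?c \<longrightarrow> A' j = A j"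
    and I: "R' rFlag = (if \<exists>v<k. 0 < A aDegree v \<and> balanced (R rSize) a v then 1 else R rFlag) \<and>
      t' + 8 * off 0 \<le> t + 3 + 32 * k + 8 * off k"
  let ?J = "\<lambda>R' A' t'. (R'(rV := Suc k)) rFlag = (if \<exists>v<Suc k. 0 < A aDegree v \<and> balanced (R rSize) a v then 1 else R rFlag) \<and>
      t' + 3 + 8 * off 0 \<le> t + 3 + 32 * Suc k + 8 * off (Suc k)"
  have A': "A' = A" using f(2) by (intro ext) simp
  have off: "off (Suc k) = off k + deg k" using off_Suc k by simp
  show "wp L W ?c ?J R' A' t'"
  proof (cases "0 < A aDegree k")
    case False
    then show ?thesis using k A' I off n_less_L stdD[OF s'] by (auto simp: wp_skip less_Suc_eq)
  next
    case True
    let ?R = "R'(rX := A aDegree k)"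
    have sz: "R' rSize = R rSize" "R' rDegA = deg a" using f(1) r by auto
    have "wp L W check_pair ?J ?R A (t' + 2 + 2)"
    proof (rule wp_mono[OF wp_check_pair[where a = a and v = k]])
      show "std ?R A" using s' A' by (simp add: std_def)
      fix R1 A1 t1
      assume "R1 rFlag = (if balanced (?R rSize) a k then 1 else ?R rFlag) \<and> t1 \<le> t' + 2 + 2 + 25 + 8 * deg k"
      then show "?J R1 A1 t1" using I off True sz by (auto simp: less_Suc_eq)
    qed (use k a mk sz r in auto)
    then show ?thesis using k n_less_L A' True stdD[OF s'] by simp
  qed
next
  fix R' A' t'
  assume "R' rFlag = (if \<exists>v<n. 0 < A aDegree v \<and> balanced (R rSize) a v then 1 else R rFlag) \<and>
    t' + 8 * off 0 \<le> t + 3 + 32 * n + 8 * off n"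
  then show "?Q R' A' t'" using off_0 L_off n_less_L by auto
qed auto

text \<open>The beginning of \<open>adjust\<close> for one big component, with an arbitrary continuation \<open>c\<close>.\<close>

lemma wp_one_big_block:
  assumes s: "std R A" and b: "R rBig = 1"
    and c: "wp L W c Q (R(rFlag := if R rSize < 3 then 1 else 0, rThree := 3)) A (t + 9)"
  shows "wp L W (IfLt rOne rBig skip (IfLt rBig rOne skip
    (SetC rFlag 0;; SetC rThree 3;; IfLt rSize rThree (SetC rFlag 1) skip;; c))) Q R A t"
proof -
  have "3 < W" using n_less_L W by linarith
  moreover have "R(rFlag := 0, rThree := 3, rFlag := Suc 0) = R(rFlag := Suc 0, rThree := 3)"
    by (auto simp: fun_upd_def)
  moreover have t9: "t + 9 = Suc (Suc (Suc (Suc (Suc (Suc (Suc (Suc (Suc t))))))))" by simp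
  ultimately show ?thesis using c[unfolded t9] b stdD[OF s] by (simp add: wp_skip split: if_splits)
qed

lemma wp_adjust:
  assumes s: "std R A" and d: "\<forall>v<n. A aDegree v < n"
    and ex: "R rBig = 1 \<Longrightarrow> 4 \<le> R rCost \<Longrightarrow> \<exists>v<n. 0 < A aDegree v"
    and sz: "R rBig = 1 \<Longrightarrow> R rSize \<le> n" and z: "\<forall>u<n. A aMark u = 0"
    and four: "R rFour = 4" and sm: "R rSum + 1 < W"
  shows "wp L W adjust (\<lambda>R' A' t'.
    (\<exists>a. (R rBig = 1 \<and> 4 \<le> R rCost \<longrightarrow> a < n \<and> 0 < A aDegree a \<and> (\<forall>v<n. 0 < A aDegree v \<longrightarrow> A aDegree a \<le> A aDegree v)) \<and>
      R' rSum = R rSum + (if R rBig = 1 \<and> 3 \<le> R rSize \<and>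
        \<not> (4 \<le> R rCost \<and> (\<exists>v<n. 0 < A aDegree v \<and> balanced (R rSize) a v)) then 1 else 0)) \<and>
    t' \<le> t + 100 * L) R A t" (is "wp L W _ ?Q R A t")
proof (cases "R rBig = 1")
  case False
  then show ?thesis unfolding adjust_def using stdD[OF s] n_less_L by (auto simp: wp_skip)
next
  case True
  let ?last = "IfLt rZero rFlag skip (Plus rSum rSum rOne)"
  let ?mid = "IfLt rCost rFour skip (find_min_degree;; mark_nbrs;; search_pair)"
  let ?R = "R(rFlag := if R rSize < 3 then 1 else 0, rThree := 3)"
  have fin: "wp L W ?last ?Q R1 A1 t1"
    if "std R1 A1" "R1 rSum = R rSum" "t1 \<le> t + 90 * L"
      "4 \<le> R rCost \<longrightarrow> a < n \<and> 0 < A aDegree a \<and> (\<forall>v<n. 0 < A aDegree v \<longrightarrow> A aDegree a \<le> A aDegree v)"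
      "R1 rFlag = (if R rSize < 3 \<or> 4 \<le> R rCost \<and> (\<exists>v<n. 0 < A aDegree v \<and> balanced (R rSize) a v) then 1 else 0)"
    for R1 A1 t1 a
  proof -
    have "wp L W ?last (\<lambda>R' A' t'. R' rSum = R rSum + (if R1 rFlag = 0 then 1 else 0) \<and> t' \<le> t + 100 * L) R1 A1 t1"
      using that(1-3) stdD[OF that(1)] n_less_L sm by (auto simp: wp_skip)
    then show ?thesis
    proof (rule wp_mono)
      fix R' A' t' assume "R' rSum = R rSum + (if R1 rFlag = 0 then 1 else 0) \<and> t' \<le> t + 100 * L"
      then show "?Q R' A' t'" using that(4,5) True by (intro conjI exI[of _ a]) auto
    qed
  qed
  have mid: "wp L W ?mid (wp L W ?last ?Q) ?R A t0" if t0: "t0 \<le> t + 10" for t0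
  proof (cases "4 \<le> R rCost")
    case False
    have "wp L W ?last ?Q ?R A (t0 + 2 + 1)"
      by (rule fin) (use s t0 False n_less_L in \<open>auto simp: std_def\<close>)
    moreover have "?R rCost < ?R rFour" using False four by simp
    ultimately show ?thesis unfolding wp.simps(8) wp_skip by (simp only: if_True)
  next
    case c: True
    have s0: "std ?R A" using s by (simp add: std_def)
    have "wp L W (find_min_degree;; mark_nbrs;; search_pair) (wp L W ?last ?Q) ?R A (t0 + 2)"
      unfolding wp.simps(7)
    proof (rule wp_conseq[OF wp_find_min_degree[OF s0 d ex[OF True c]]])
      fix R1 A1 t1
      assume p1: "R1 rA < n \<and> 0 < A aDegree (R1 rA) \<and> (\<forall>v<n. 0 < A aDegree v \<longrightarrow> A aDegree (R1 rA) \<le> A aDegree v) \<and>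
          t1 \<le> t0 + 2 + 16 * L"
        and f1: "\<forall>r. r \<notin> mods find_min_degree \<longrightarrow> R1 r = ?R r" "\<forall>k. k \<notin> puts find_min_degree \<longrightarrow> A1 k = A k"
      have s1: "std R1 A1" by (rule std_frame[OF s0 f1]) auto
      have A1: "A1 = A" using f1(2) by (intro ext) simp
      define a where "a = R1 rA"
      have a: "R1 rA = a" "a < n" using p1 by (simp_all add: a_def)
      show "wp L W mark_nbrs (wp L W search_pair (wp L W ?last ?Q)) R1 A1 t1"
      proof (rule wp_conseq[OF wp_mark_nbrs[OF s1 a]])
        show "\<forall>u<n. A1 aMark u = 0" using z A1 by simp
        fix R2 A2 t2
        assume p2: "(\<forall>u<n. A2 aMark u = (if u \<in> nb a then 1 else 0)) \<and> R2 rDegA = deg a \<and> t2 \<le> t1 + 20 * L"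
          and f2: "\<forall>r. r \<notin> mods mark_nbrs \<longrightarrow> R2 r = R1 r" "\<forall>k. k \<notin> puts mark_nbrs \<longrightarrow> A2 k = A1 k"
        have s2: "std R2 A2" by (rule std_frame[OF s1 f2]) auto
        have r2: "R2 rSize = R rSize" "R2 rFlag = (if R rSize < 3 then 1 else 0)" "R2 rSum = R rSum"
          "A2 aDegree = A aDegree" using f1 f2 A1 by auto
        show "wp L W search_pair (wp L W ?last ?Q) R2 A2 t2"
        proof (rule wp_conseq[OF wp_search_pair[OF s2 a(2)]])
          show "\<forall>u<n. A2 aMark u = (if u \<in> nb a then 1 else 0)" "R2 rDegA = deg a" "R2 rSize \<le> n"
            using p2 r2 sz True by auto
          fix R3 A3 t3
          assume p3: "R3 rFlag = (if \<exists>v<n. 0 < A2 aDegree v \<and> balanced (R2 rSize) a v then 1 else R2 rFlag) \<and> t3 \<le> t2 + 45 * L"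
            and f3: "\<forall>r. r \<notin> mods search_pair \<longrightarrow> R3 r = R2 r" "\<forall>k. k \<notin> puts search_pair \<longrightarrow> A3 k = A2 k"
          have s3: "std R3 A3" by (rule std_frame[OF s2 f3]) auto
          show "wp L W ?last ?Q R3 A3 t3"
          proof (rule fin[OF s3, where a = a])
            show "t3 \<le> t + 90 * L" using p1 p2 p3 t0 n_less_L by linarith
          qed (use p1 p3 f3 r2 a c in auto)
        qed
      qed
    qed
    moreover have "\<not> ?R rCost < ?R rFour" using c four by simp
    ultimately show ?thesis unfolding wp.simps(8) by (simp only: if_False)
  qed
  have "wp L W (?mid;; ?last) ?Q ?R A (t + 9)" unfolding wp.simps(7) by (rule mid) simp
  then show ?thesis unfolding adjust_def by (rule wp_one_big_block[OF s True])
qed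

end

section \<open>From the graph to the output of the program\<close>

definition edge_rel :: "'a set set \<Rightarrow> 'a \<Rightarrow> 'a \<Rightarrow> bool" where
  "edge_rel E u v \<longleftrightarrow> {u, v} \<in> E"

lemma simple_graph_edge: "simple_graph V E \<Longrightarrow> {u, v} \<in> E \<Longrightarrow> u \<in> V \<and> v \<in> V \<and> u \<noteq> v"
  unfolding simple_graph_def by (metis doubleton_eq_iff)

lemma induced_path_4I:
  assumes e: "{a, b} \<in> E" "{b, c} \<in> E" "{c, d} \<in> E" "{a, c} \<notin> E" "{b, d} \<notin> E" "{a, d} \<notin> E"
    and V: "simple_graph V E"
  shows "\<exists>p. induced_path V E 4 p"
proof -
  define p where "p i = (if i = 0 then a else if i = 1 then b else if i = 2 then c else d)" for i :: nat
  have p: "p 0 = a" "p (Suc 0) = b" "p 2 = c" "p 3 = d" by (auto simp: p_def)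
  have ins: "a \<in> V" "b \<in> V" "c \<in> V" "d \<in> V" "a \<noteq> b" "b \<noteq> c" "c \<noteq> d"
    using e simple_graph_edge[OF V] by blast+
  have ne: "a \<noteq> c" "b \<noteq> d" "a \<noteq> d"
    using e by (metis insert_commute)+
  have loop: "{x} \<notin> E" for x using simple_graph_edge[OF V, of x x] by auto
  have e': "{b, a} \<in> E" "{c, b} \<in> E" "{d, c} \<in> E" "{c, a} \<notin> E" "{d, b} \<notin> E" "{d, a} \<notin> E"
    using e by (metis insert_commute)+
  have cases: "i = 0 \<or> i = Suc 0 \<or> i = 2 \<or> i = 3" if "i < 4" for i :: nat using that by presburger
  have "induced_path V E 4 p"
    unfolding induced_path_def
  proof (intro conjI allI impI)
    show "p ` {..<4} \<subseteq> V" using ins by (auto simp: p_def)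
    show "inj_on p {..<4}"
    proof (rule inj_onI)
      fix i j assume ij: "i \<in> {..<4::nat}" "j \<in> {..<4::nat}" and eq: "p i = p j"
      have "i < 4" "j < 4" using ij by simp_all
      from cases[OF this(1)] cases[OF this(2)] eq show "i = j" using ins ne ne[symmetric] ins(5-7)[symmetric]
        by (elim disjE) (simp_all add: p)
    qed
    fix i j :: nat assume ij: "i < 4" "j < 4"
    from cases[OF ij(1)] cases[OF ij(2)] show "{p i, p j} \<in> E \<longleftrightarrow> j = Suc i \<or> i = Suc j"
      by (elim disjE) (simp_all add: p e e' loop)
  qed
  then show ?thesis by blast
qed

lemma cograph_rel_edge_rel: assumes "cograph V E" shows "cograph_rel V (edge_rel E)"
proof
  have sg: "simple_graph V E" and no: "\<not> (\<exists>p. induced_path V E 4 p)" using assms by (auto simp: cograph_def)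
  show "finite V" using sg by (simp add: simple_graph_def)
  show "u \<in> V" if "edge_rel E u v" for u v using that simple_graph_edge[OF sg] by (auto simp: edge_rel_def)
  show "edge_rel E v u" if "edge_rel E u v" for u v using that by (simp add: edge_rel_def insert_commute)
  show "\<not> edge_rel E u u" for u using simple_graph_edge[OF sg, of u u] by (auto simp: edge_rel_def)
  show "edge_rel E a c \<or> edge_rel E b d \<or> edge_rel E a d"
    if "edge_rel E a b" "edge_rel E b c" "edge_rel E c d" for a b c d
    using induced_path_4I[OF _ _ _ _ _ _ sg, of a b c d] no that unfolding edge_rel_def by blast
qed

lemma global_roman_dominating_iff_global_rd: "global_roman_dominating V E f \<longleftrightarrow> global_rd V (edge_rel E) f"
proof -
  have c: "{u, v} \<in> complement_edges V E \<longleftrightarrow> compl_rel V (edge_rel E) u v" for u v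
    unfolding complement_edges_def compl_rel_def edge_rel_def by (auto simp: doubleton_eq_iff insert_commute)
  have "f u \<in> {0, 1, 2} \<longleftrightarrow> f u \<le> 2" for u by auto
  then show ?thesis unfolding global_roman_dominating_def roman_dominating_def global_rd_def c edge_rel_def by blast
qed

lemma global_roman_number_eq:
  "global_roman_number V E = (LEAST k. \<exists>f. global_rd V (edge_rel E) f \<and> (\<Sum>u\<in>V. f u) = k)"
  unfolding global_roman_number_def global_roman_dominating_iff_global_rd ..

lemma (in cograph_rel) global_rd_complement: "global_rd V (compl_rel V r) f \<longleftrightarrow> global_rd V r f"
proof -
  have "compl_rel V (compl_rel V r) u v \<longleftrightarrow> r u v" if "u \<in> V" "v \<in> V" for u v
    using that irrefl by (auto simp: compl_rel_def)
  then show ?thesis unfolding global_rd_def by blast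
qed

text \<open>Two rounds of minima over closed neighbourhoods. For the complement of a graph, the closed neighbourhood of a vertex consists of
  its non-neighbours, itself included.\<close>

definition leader :: "('a::linorder \<Rightarrow> 'a \<Rightarrow> bool) \<Rightarrow> 'a \<Rightarrow> 'a" where
  "leader r v = Min ((\<lambda>u. Min (insert u {w. r u w})) ` insert v {u. r v u})"

locale cograph_order = cograph_rel V r for V :: "'a::linorder set" and r
begin

lemma leader_eq_Min_near:
  assumes "v \<in> V" shows "leader r v = Min {x. near r v x}"
proof (rule Min_eqI[symmetric])
  have fn: "finite {u. r v u}" for v by (rule finite_subset[OF _ fin]) (auto intro: in_V')
  show "finite {x. near r v x}"
    by (rule finite_subset[of _ "insert v V"]) (auto simp: near_def fin intro: in_V')
  let ?m = "\<lambda>u. Min (insert u {w. r u w})"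
  have "leader r v \<in> ?m ` insert v {u. r v u}" unfolding leader_def using fn by (intro Min_in) auto
  then obtain u where u: "u \<in> insert v {u. r v u}" "leader r v = ?m u" by blast
  have "?m u \<in> insert u {w. r u w}" using fn by (intro Min_in) auto
  then show "leader r v \<in> {x. near r v x}" using u unfolding near_def by auto
  fix x assume "x \<in> {x. near r v x}"
  then obtain u where u: "u \<in> insert v {u. r v u}" "x \<in> insert u {w. r u w}" unfolding near_def by auto
  have "leader r v \<le> ?m u" unfolding leader_def using u fn by (intro Min_le) auto
  also have "\<dots> \<le> x" using u fn by (intro Min_le) auto
  finally show "leader r v \<le> x" .
qed

lemma near_leader: assumes "v \<in> V" shows "near r v (leader r v)"
proof -
  have "finite {x. near r v x}"
    by (rule finite_subset[of _ "insert v V"]) (auto simp: near_def fin intro: in_V')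
  moreover have "v \<in> {x. near r v x}" by (simp add: near_def)
  ultimately show ?thesis using Min_in[of "{x. near r v x}"] leader_eq_Min_near[OF assms] by auto
qed

lemma leader_in_V: "v \<in> V \<Longrightarrow> leader r v \<in> V"
  using near_leader[of v] by (auto simp: near_def intro: in_V')

lemma cograph_components_leader: "cograph_components V r (leader r)"
proof
  fix u v assume uv: "u \<in> V" "v \<in> V"
  show "leader r u = leader r v \<longleftrightarrow> near r u v"
  proof
    assume "leader r u = leader r v"
    then show "near r u v" using near_leader uv near_sym near_trans by metis
  next
    assume "near r u v"
    then have "{x. near r u x} = {x. near r v x}" using near_sym near_trans by blast
    then show "leader r u = leader r v" using leader_eq_Min_near uv by simp
  qed
qed

end

text \<open>A graph that is connected together with its complement would have no partition as in \<open>cograph_splits\<close>.\<close>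

lemma not_both_connected:
  assumes "cograph_components V r ld" "cograph_components V (compl_rel V r) ld'" "2 \<le> card V"
    and "ld ` V = {t}" "ld' ` V = {t'}"
  shows False
proof -
  interpret a: cograph_components V r ld by fact
  interpret b: cograph_components V "compl_rel V r" ld' by fact
  have "a.block t = V" "b.block t' = V" using assms(4,5) unfolding a.block_def b.block_def by auto
  then have "\<not> splits (\<lambda>a b. \<not> r a b) V" "\<not> splits (\<lambda>a b. \<not> compl_rel V r a b) V"
    using a.block_connected[of t] b.block_connected[of t'] by simp_all
  then show False using a.cograph_splits[OF order_refl assms(3)] a.splits_compl_iff(2)[OF order_refl] by blast
qed

context cograph_components
begin

lemma degree_pos_iff:
  assumes "big = {t}" "v \<in> V" shows "0 < degree v \<longleftrightarrow> v \<in> block t"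
proof
  assume "0 < degree v"
  then have "{u. r v u} \<noteq> {}" unfolding degree_def by (metis card.empty less_irrefl)
  then obtain u where "r v u" by blast
  then have "ld v \<in> big" by (rule adj_in_big)
  then show "v \<in> block t" using assms by (simp add: block_def)
next
  assume v: "v \<in> block t"
  have "2 \<le> card (block t)" using assms(1) by (auto simp: big_def)
  then obtain A B where AB: "A \<noteq> {}" "B \<noteq> {}" "A \<inter> B = {}" "A \<union> B = block t"
    "\<forall>a\<in>A. \<forall>b\<in>B. r a b \<and> r b a" using block_join by metis
  then have "\<exists>u. r v u" using v by blast
  then show "0 < degree v" by (auto simp: degree_def card_gt_0_iff)
qed

text \<open>Being adjacent to exactly one of two other vertices means the same in a graph and in its complement. The sets
  \<open>Na\<close> and \<open>Nv\<close> can therefore be neighbourhoods in the input graph even if \<open>r\<close> is adjacency in its complement.\<close>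

lemma splitting_pair_iff_card:
  assumes a: "a \<in> block t" and v: "v \<in> block t" "a \<noteq> v"
    and N: "\<And>u. u \<in> V - {a, v} \<Longrightarrow> (r a u \<longleftrightarrow> r v u) \<longleftrightarrow> (u \<in> Na \<longleftrightarrow> u \<in> Nv)"
    and Na: "Na \<subseteq> V - {a}" and Nv: "Nv \<subseteq> V - {v}" and sym: "v \<in> Na \<longleftrightarrow> a \<in> Nv"
  shows "splitting_pair t a v \<longleftrightarrow>
    card Nv + card Na + 2 = card (block t) + 2 * (card (Nv \<inter> Na) + (if v \<in> Na then 1 else 0))"
proof -
  define X where "X = {u \<in> V - {a, v}. r a u \<noteq> r v u}"
  have fN: "finite Na" "finite Nv" using Na Nv fin finite_subset by (meson Diff_subset)+
  have X: "X \<subseteq> block t - {a, v}"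
  proof
    fix u assume "u \<in> X"
    then have u: "u \<noteq> a" "u \<noteq> v" "r a u \<or> r v u" by (auto simp: X_def)
    then have "u \<in> block t" using adj_same_block[of a u t] adj_same_block[of v u t] a v by blast
    then show "u \<in> block t - {a, v}" using u by blast
  qed
  have sp: "splitting_pair t a v \<longleftrightarrow> X = block t - {a, v}"
    using a v X block_subset unfolding splitting_pair_def X_def by blast
  also have "\<dots> \<longleftrightarrow> card X = card (block t - {a, v})" using X card_subset_eq[OF _ X] by auto
  also have "card (block t - {a, v}) = card (block t) - 2" using a v by (simp add: card_Diff_subset)
  finally have 1: "splitting_pair t a v \<longleftrightarrow> card X = card (block t) - 2" .
  have two: "2 \<le> card (block t)" using card_mono[of "block t" "{a, v}"] a v by simp
  have XN: "X = (Na - Nv - {v}) \<union> (Nv - Na - {a})"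
    using N Na Nv unfolding X_def by blast
  have "card X = card (Na - Nv - {v}) + card (Nv - Na - {a})"
    unfolding XN using fN by (intro card_Un_disjoint) auto
  moreover have "card (Na - Nv) + card (Na \<inter> Nv) = card Na" "card (Nv - Na) + card (Nv \<inter> Na) = card Nv"
    using fN by (simp_all add: card_Diff_subset_Int Int_commute card_mono)
  moreover have "card (Na - Nv - {v}) + (if v \<in> Na then 1 else 0) = card (Na - Nv) \<and>
    card (Nv - Na - {a}) + (if v \<in> Na then 1 else 0) = card (Nv - Na)"
  proof (cases "v \<in> Na")
    case True
    then have "v \<in> Na - Nv" "a \<in> Nv - Na" using Na Nv sym by auto
    then show ?thesis
      using True card_Suc_Diff1[of "Na - Nv" v] card_Suc_Diff1[of "Nv - Na" a] fN by simp
  next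
    case False
    then have "Na - Nv - {v} = Na - Nv" "Nv - Na - {a} = Nv - Na" using sym by auto
    then show ?thesis using False by simp
  qed
  ultimately have "card X + 2 * (card (Nv \<inter> Na) + (if v \<in> Na then 1 else 0)) = card Nv + card Na"
    by (simp add: Int_commute split: if_splits)
  then show ?thesis using 1 two by linarith
qed

end

context program_input
begin

text \<open>The number that the program computes from labels \<open>lab\<close>, degrees \<open>D\<close> and a vertex \<open>a\<close> of least positive degree. In the
  complement, \<open>D\<close> differs from the degrees in \<open>balanced\<close>, which are those of the input graph.\<close>

definition blocks_value :: "(nat \<Rightarrow> nat) \<Rightarrow> (nat \<Rightarrow> nat) \<Rightarrow> nat \<Rightarrow> nat" where
  "blocks_value lab D a =
     (let sz = cnt lab {..<n}; cs = (\<lambda>x. cost (sz x) (Max (insert 0 (D ` {v. v < n \<and> lab v = x}))))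
      in (\<Sum>x | x < n \<and> 0 < sz x. cs x) +
         (if \<exists>x. {x. x < n \<and> 2 \<le> sz x} = {x} \<and> 3 \<le> sz x \<and>
            \<not> (4 \<le> cs x \<and> (\<exists>v<n. 0 < D v \<and> balanced (sz x) a v)) then 1 else 0))"

lemma wp_program:
  assumes lab: "\<And>v. v < n \<Longrightarrow> lab v = (if \<forall>u<n. closed_leader u = 0 then co_leader v else closed_leader v)"
    and D: "\<And>v. v < n \<Longrightarrow> D v = (if \<forall>u<n. closed_leader u = 0 then n - 1 - deg v else deg v)"
    and lab_less: "\<And>v. v < n \<Longrightarrow> lab v < n"
    and D_less: "\<And>v. v < n \<Longrightarrow> D v < cnt lab {..<n} (lab v)"
    and pos: "\<And>x. {x. x < n \<and> 2 \<le> cnt lab {..<n} x} = {x} \<Longrightarrow> \<exists>v<n. 0 < D v"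
    and goal: "\<And>a. (\<exists>x. {x. x < n \<and> 2 \<le> cnt lab {..<n} x} = {x}) \<Longrightarrow>
      a < n \<Longrightarrow> 0 < D a \<Longrightarrow> \<forall>v<n. 0 < D v \<longrightarrow> D a \<le> D v \<Longrightarrow> blocks_value lab D a = g"
    and goal': "\<And>a. (\<nexists>x. {x. x < n \<and> 2 \<le> cnt lab {..<n} x} = {x} \<and>
      4 \<le> cost (cnt lab {..<n} x) (Max (insert 0 (D ` {v. v < n \<and> lab v = x})))) \<Longrightarrow> blocks_value lab D a = g"
  shows "wp L W program (\<lambda>R A t. R 0 = g \<and> t \<le> 750 * L) (\<lambda>_. 0) (input_array (encode adj)) 0"
proof -
  let ?Q = "\<lambda>R A t. R 0 = g \<and> t \<le> 750 * L"
  define A0 where "A0 = input_array (encode adj)"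
  define R0 :: "nat \<Rightarrow> nat" where "R0 = (\<lambda>_. 0)(rOne := 1, rTwo := 2, rN := n)"
  define sz where "sz = cnt lab {..<n}"
  define mx where "mx x = Max (insert 0 (D ` {v. v < n \<and> lab v = x}))" for x
  define cs where "cs x = cost (sz x) (mx x)" for x
  have A0: "A0 aInput = inp" "\<And>k. k \<noteq> 0 \<Longrightarrow> A0 k = (\<lambda>_. 0)"
    by (auto simp: A0_def inp_def input_array_def)
  have s0: "std R0 A0" using A0 by (simp add: std_def R0_def)
  have mx_le: "mx x \<le> sz x" for x
  proof -
    have "y \<le> sz x" if "y \<in> insert 0 (D ` {v. v < n \<and> lab v = x})" for y
      using that D_less by (fastforce simp: sz_def)
    then show ?thesis unfolding mx_def by (intro Max.boundedI) auto
  qed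
  have sz_le: "sz x \<le> n" for x using cnt_le_card[of "{..<n}" lab x] by (simp add: sz_def)
  have Dn: "D v < n" if "v < n" for v using D_less[OF that] sz_le[of "lab v"] unfolding sz_def by simp
  have "wp L W (find_blocks;; measure_blocks;; sum_costs;; adjust;; Copy 0 rSum) ?Q R0 A0 (Suc (Suc (Suc (Suc 0))))"
    unfolding wp.simps(7)
  proof (rule wp_conseq[OF wp_find_blocks[OF s0]])
    fix R1 A1 t1
    assume p1: "(if \<forall>v<n. closed_leader v = 0
       then \<forall>v<n. A1 aLabel v = co_leader v \<and> A1 aDegree v = n - 1 - deg v
       else \<forall>v<n. A1 aLabel v = closed_leader v \<and> A1 aDegree v = deg v) \<and> t1 \<le> Suc (Suc (Suc (Suc 0))) + 600 * L"
      and f1: "\<forall>r. r \<notin> mods find_blocks \<longrightarrow> R1 r = R0 r" "\<forall>k. k \<notin> puts find_blocks \<longrightarrow> A1 k = A0 k"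
    have s1: "std R1 A1" by (rule std_frame[OF s0 f1]) auto
    have l1: "A1 aLabel v = lab v" "A1 aDegree v = D v" if "v < n" for v
      using p1 lab[OF that] D[OF that] that by (auto split: if_splits)
    have z1: "A1 aSize = (\<lambda>_. 0)" "A1 aMax = (\<lambda>_. 0)" "A1 aMark = (\<lambda>_. 0)" using f1 A0 by auto
    show "wp L W measure_blocks (wp L W sum_costs (wp L W adjust (wp L W (Copy 0 rSum) ?Q))) R1 A1 t1"
    proof (rule wp_conseq[OF wp_measure_blocks[OF s1]])
      show "\<forall>v<n. A1 aLabel v < n" "\<forall>x<n. A1 aSize x = 0 \<and> A1 aMax x = 0" using l1 lab_less z1 by auto
      fix R2 A2 t2
      assume p2: "(\<forall>x<n. A2 aSize x = cnt (A1 aLabel) {..<n} x \<and>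
          A2 aMax x = Max (insert 0 (A1 aDegree ` {v. v < n \<and> A1 aLabel v = x}))) \<and> t2 \<le> t1 + 21 * L"
        and f2: "\<forall>r. r \<notin> mods measure_blocks \<longrightarrow> R2 r = R1 r" "\<forall>k. k \<notin> puts measure_blocks \<longrightarrow> A2 k = A1 k"
      have s2: "std R2 A2" by (rule std_frame[OF s1 f2]) auto
      have l2: "A2 aSize x = sz x" "A2 aMax x = mx x" if "x < n" for x
      proof -
        have "{u \<in> {..<n}. A1 aLabel u = x} = {u \<in> {..<n}. lab u = x}" using l1 by auto
        then show "A2 aSize x = sz x" using p2 that by (simp add: sz_def cnt_def)
        have "A1 aDegree ` {v. v < n \<and> A1 aLabel v = x} = D ` {v. v < n \<and> lab v = x}"
          using l1 by (intro image_cong) auto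
        then show "A2 aMax x = mx x" using p2 that by (simp add: mx_def)
      qed
      have d2: "\<And>v. v < n \<Longrightarrow> A2 aDegree v = D v" and z2: "A2 aMark = (\<lambda>_. 0)" using f2 l1 z1 by auto
      have sum2: "(\<Sum>x | x < n \<and> 0 < A2 aSize x. cost (A2 aSize x) (A2 aMax x)) = (\<Sum>x | x < n \<and> 0 < sz x. cs x)"
        by (intro sum.cong) (use l2 in \<open>auto simp: cs_def\<close>)
      have big2: "{x. x < n \<and> 2 \<le> A2 aSize x} = {x. x < n \<and> 2 \<le> sz x}" using l2 by auto
      show "wp L W sum_costs (wp L W adjust (wp L W (Copy 0 rSum) ?Q)) R2 A2 t2"
      proof (rule wp_conseq[OF wp_sum_costs[OF s2]])
        show "\<forall>x<n. A2 aMax x \<le> A2 aSize x" "\<forall>x<n. A2 aSize x \<le> n" using l2 mx_le sz_le by auto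
        fix R3 A3 t3
        assume p3': "R3 rSum = (\<Sum>x | x < n \<and> 0 < A2 aSize x. cost (A2 aSize x) (A2 aMax x)) \<and>
            R3 rBig = card {x. x < n \<and> 2 \<le> A2 aSize x} \<and>
            (\<forall>x. {x. x < n \<and> 2 \<le> A2 aSize x} = {x} \<longrightarrow> R3 rSize = A2 aSize x \<and> R3 rCost = cost (A2 aSize x) (A2 aMax x)) \<and>
            R3 rFour = 4 \<and> t3 \<le> t2 + 24 * L"
          and f3: "\<forall>r. r \<notin> mods sum_costs \<longrightarrow> R3 r = R2 r" "\<forall>k. k \<notin> puts sum_costs \<longrightarrow> A3 k = A2 k"
        have s3: "std R3 A3" by (rule std_frame[OF s2 f3]) auto
        have A3: "A3 = A2" using f3(2) by (intro ext) simp
        let ?B = "{x. x < n \<and> 2 \<le> sz x}"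
        have one: "R3 rSize = sz x" "R3 rCost = cs x" if "?B = {x}" for x
        proof -
          have "x < n" using that by blast
          then show "R3 rSize = sz x" "R3 rCost = cs x"
            using p3' that l2 unfolding big2 cs_def by auto
        qed
        have p3: "R3 rSum = (\<Sum>x | x < n \<and> 0 < sz x. cs x)" "R3 rBig = card ?B" "R3 rFour = 4" "t3 \<le> t2 + 24 * L"
          using p3' unfolding sum2 big2 by auto
        have big1: "\<exists>x. ?B = {x}" if "R3 rBig = 1" using that p3 by (auto simp: card_1_singleton_iff)
        have d3: "\<And>v. v < n \<Longrightarrow> A3 aDegree v = D v" using d2 A3 by simp
        show "wp L W adjust (wp L W (Copy 0 rSum) ?Q) R3 A3 t3"
        proof (rule wp_conseq[OF wp_adjust[OF s3]])
          show "\<forall>v<n. A3 aDegree v < n" using d3 Dn by simp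
          show "\<exists>v<n. 0 < A3 aDegree v" if b: "R3 rBig = 1"
          proof -
            obtain x where "?B = {x}" using big1[OF b] by blast
            then obtain v where "v < n" "0 < D v" using pos[of x] unfolding sz_def by blast
            then show ?thesis using d3 by auto
          qed
          show "R3 rSize \<le> n" if "R3 rBig = 1" using big1[OF that] one sz_le by auto
          show "\<forall>u<n. A3 aMark u = 0" "R3 rFour = 4" using A3 z2 p3 by auto
          have "R3 rSum \<le> 4 * card {x. x < n \<and> 0 < sz x}" unfolding p3 cs_def by (intro sum_cost_le) simp
          also have "card {x. x < n \<and> 0 < sz x} \<le> card {..<n}" by (intro card_mono) auto
          finally show "R3 rSum + 1 < W" using n_less_L W by simp
          fix R4 A4 t4
          assume p4: "(\<exists>a. (R3 rBig = 1 \<and> 4 \<le> R3 rCost \<longrightarrow> a < n \<and> 0 < A3 aDegree a \<and>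
              (\<forall>v<n. 0 < A3 aDegree v \<longrightarrow> A3 aDegree a \<le> A3 aDegree v)) \<and>
            R4 rSum = R3 rSum + (if R3 rBig = 1 \<and> 3 \<le> R3 rSize \<and>
              \<not> (4 \<le> R3 rCost \<and> (\<exists>v<n. 0 < A3 aDegree v \<and> balanced (R3 rSize) a v)) then 1 else 0)) \<and>
            t4 \<le> t3 + 100 * L"
          then obtain a where a: "R3 rBig = 1 \<and> 4 \<le> R3 rCost \<longrightarrow> a < n \<and> 0 < A3 aDegree a \<and>
              (\<forall>v<n. 0 < A3 aDegree v \<longrightarrow> A3 aDegree a \<le> A3 aDegree v)"
            and r: "R4 rSum = R3 rSum + (if R3 rBig = 1 \<and> 3 \<le> R3 rSize \<and>
              \<not> (4 \<le> R3 rCost \<and> (\<exists>v<n. 0 < A3 aDegree v \<and> balanced (R3 rSize) a v)) then 1 else 0)" by blast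
          have "R3 rBig = 1 \<and> 3 \<le> R3 rSize \<and>
              \<not> (4 \<le> R3 rCost \<and> (\<exists>v<n. 0 < A3 aDegree v \<and> balanced (R3 rSize) a v)) \<longleftrightarrow>
            (\<exists>x. ?B = {x} \<and> 3 \<le> sz x \<and> \<not> (4 \<le> cs x \<and> (\<exists>v<n. 0 < D v \<and> balanced (sz x) a v)))"
          proof (cases "R3 rBig = 1")
            case True
            then obtain x where x: "?B = {x}" using big1 by blast
            have "y = x" if "?B = {y}" for y using that x by simp
            then show ?thesis using True x one[OF x] d3 by (metis (no_types, lifting))
          next
            case False
            then have "?B \<noteq> {x}" for x using p3(2) by (metis card_1_singleton_iff One_nat_def)
            then show ?thesis using False by blast
          qed
          then have val: "R4 rSum = blocks_value lab D a"
            unfolding r p3(1) blocks_value_def Let_def sz_def cs_def mx_def by simp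
          have "blocks_value lab D a = g"
          proof (cases "R3 rBig = 1 \<and> 4 \<le> R3 rCost")
            case True
            then show ?thesis using a d3 big1 unfolding sz_def by (intro goal) auto
          next
            case False
            then have "\<nexists>x. ?B = {x} \<and> 4 \<le> cs x" using one p3(2) by auto
            then show ?thesis unfolding sz_def cs_def mx_def by (rule goal')
          qed
          then show "wp L W (Copy 0 rSum) ?Q R4 A4 t4"
            using val p1 p2 p3 p4 n_less_L by auto
        qed
      qed
    qed
  qed
  moreover have "0 < L" "2 < W" using n_less_L W by auto
  moreover have "input_array (encode adj) 0 0 = n" using inp_simps(1) by (simp add: inp_def)
  ultimately show ?thesis unfolding program_def R0_def A0_def
    by (simp only: wp.simps(1,5) wp.simps(7)[of _ _ "SetC _ _"] wp.simps(7)[of _ _ "Get _ _ _"]) simp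
qed

text \<open>The graph \<open>F\<close> is the input graph or its complement. The last conclusion belongs to the runs without
  a search for a splitting pair, in which \<open>a\<close> is an arbitrary value.\<close>

lemma blocks_value_correct:
  fixes F :: "nat \<Rightarrow> nat \<Rightarrow> bool"
  assumes c: "cograph_components {..<n} F lab"
    and lab_less: "\<And>v. v < n \<Longrightarrow> lab v < n"
    and D: "\<And>v. v < n \<Longrightarrow> D v = card {u. F v u}"
    and N: "\<And>a v u. a < n \<Longrightarrow> v < n \<Longrightarrow> u < n \<Longrightarrow> u \<noteq> a \<Longrightarrow> u \<noteq> v \<Longrightarrow>
      (F a u \<longleftrightarrow> F v u) \<longleftrightarrow> (u \<in> nb a \<longleftrightarrow> u \<in> nb v)"
    and nb_sym: "\<And>u v. u < n \<Longrightarrow> v < n \<Longrightarrow> u \<in> nb v \<longleftrightarrow> v \<in> nb u"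
    and k: "\<And>t. cograph_components.big {..<n} lab = {t} \<Longrightarrow> lab ` {..<n} \<noteq> {t}"
  defines "B \<equiv> {x. x < n \<and> 2 \<le> cnt lab {..<n} x}"
    and "g \<equiv> LEAST k. \<exists>f. global_rd {..<n} F f \<and> (\<Sum>u<n. f u) = k"
  shows "\<And>v. v < n \<Longrightarrow> D v < cnt lab {..<n} (lab v)"
    and "\<And>x. B = {x} \<Longrightarrow> \<exists>v<n. 0 < D v"
    and "\<And>a. \<exists>x. B = {x} \<Longrightarrow> a < n \<Longrightarrow> 0 < D a \<Longrightarrow> \<forall>v<n. 0 < D v \<longrightarrow> D a \<le> D v \<Longrightarrow>
      blocks_value lab D a = g"
    and "\<And>a. \<nexists>x. B = {x} \<and> 4 \<le> cost (cnt lab {..<n} x) (Max (insert 0 (D ` {v. v < n \<and> lab v = x}))) \<Longrightarrow>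
      blocks_value lab D a = g"
proof -
  interpret c: cograph_components "{..<n}" F lab by (rule c)
  let ?sz = "cnt lab {..<n}" and ?cs = "\<lambda>x. cost (cnt lab {..<n} x) (Max (insert 0 (D ` {v. v < n \<and> lab v = x})))"
  have sz: "?sz x = card (c.block x)" for x by (simp add: cnt_def c.block_def)
  have deg: "D v = c.degree v" if "v < n" for v using D[OF that] by (simp add: c.degree_def)
  have img: "x \<in> lab ` {..<n} \<longleftrightarrow> x < n \<and> 0 < ?sz x" for x
    using lab_less by (auto simp: cnt_pos_iff)
  have B: "B = c.big" unfolding B_def c.big_def using img sz by auto
  have cs: "?cs x = c.block_cost x" if x: "x \<in> lab ` {..<n}" for x
  proof -
    have "D ` {v. v < n \<and> lab v = x} = c.degree ` c.block x"
      using deg by (intro image_cong) (auto simp: c.block_def)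
    moreover have "Max (insert 0 (c.degree ` c.block x)) = Max (c.degree ` c.block x)"
      using c.block_nonempty[OF x] by simp
    ultimately show ?thesis using sz by (simp add: c.block_cost_def)
  qed
  show D_less: "D v < ?sz (lab v)" if "v < n" for v
    using c.degree_less[of v "lab v"] deg[OF that] that sz by (simp add: c.block_def)
  have mem: "0 < D v \<longleftrightarrow> v \<in> c.block t" if "B = {t}" "v < n" for v t
    using c.degree_pos_iff[of t v] that B deg by simp
  have two: "2 \<le> card (c.block t)" "t \<in> lab ` {..<n}" if "B = {t}" for t
    using that B by (auto simp: c.big_def)
  show pos: "\<exists>v<n. 0 < D v" if Bx: "B = {x}" for x
  proof -
    obtain v where "v \<in> c.block x" using two[OF Bx] c.block_nonempty by blast
    then show ?thesis using mem[OF Bx, of v] by (auto simp: c.block_def)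
  qed
  have total: "(\<Sum>x | x < n \<and> 0 < ?sz x. ?cs x) = c.total_cost"
    unfolding c.total_cost_def using img cs by (intro sum.cong) auto
  have g: "g = (if \<exists>t. c.big = {t} \<and> card (c.block t) \<noteq> 2 \<and> (c.block_cost t = 4 \<longrightarrow> (\<nexists>x y. c.splitting_pair t x y))
     then Suc c.total_cost else c.total_cost)" unfolding g_def using k by (rule c.Least_weight)
  have cs4: "4 \<le> ?cs t \<longleftrightarrow> c.block_cost t = 4" if "B = {t}" for t
  proof -
    have "?cs t = c.block_cost t" using cs two[OF that] by simp
    moreover have "?cs t \<le> 4" by (simp add: cost_def)
    ultimately show ?thesis by linarith
  qed
  have sz3: "3 \<le> ?sz t \<longleftrightarrow> card (c.block t) \<noteq> 2" if "B = {t}" for t using two[OF that] sz[of t] by linarith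
  have reduce: "blocks_value lab D a = g"
    if pair: "\<And>t. B = {t} \<Longrightarrow> c.block_cost t = 4 \<Longrightarrow> 3 \<le> ?sz t \<Longrightarrow>
      (\<exists>v<n. 0 < D v \<and> balanced (?sz t) a v) \<longleftrightarrow> (\<exists>x y. c.splitting_pair t x y)" for a
  proof -
    have "(\<exists>x. B = {x} \<and> 3 \<le> ?sz x \<and> \<not> (4 \<le> ?cs x \<and> (\<exists>v<n. 0 < D v \<and> balanced (?sz x) a v))) \<longleftrightarrow>
      (\<exists>t. c.big = {t} \<and> card (c.block t) \<noteq> 2 \<and> (c.block_cost t = 4 \<longrightarrow> (\<nexists>x y. c.splitting_pair t x y)))"
      unfolding B[symmetric] using pair cs4 sz3 by (intro ex_cong1 conj_cong refl) blast+
    then show ?thesis unfolding g blocks_value_def Let_def total B_def by simp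
  qed
  show "blocks_value lab D a = g"
    if ex: "\<exists>x. B = {x}" and a: "a < n" "0 < D a" and amin: "\<forall>v<n. 0 < D v \<longrightarrow> D a \<le> D v" for a
  proof (rule reduce)
    fix t assume t: "B = {t}" and s3: "3 \<le> ?sz t"
    have ab: "a \<in> c.block t" using mem[OF t a(1)] a by simp
    have nbV: "nb v \<subseteq> {..<n} - {v}" if "v < n" for v using nbrs[OF that] .
    have sp: "c.splitting_pair t a v \<longleftrightarrow> balanced (?sz t) a v" if v: "v \<in> c.block t" "a \<noteq> v" for v
    proof -
      have vn: "v < n" using v by (simp add: c.block_def)
      have "c.splitting_pair t a v \<longleftrightarrow>
        card (nb v) + card (nb a) + 2 = card (c.block t) + 2 * (card (nb v \<inter> nb a) + (if v \<in> nb a then 1 else 0))"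
        using N[OF a(1) vn] nbV[OF a(1)] nbV[OF vn] nb_sym[OF vn a(1)]
        by (intro c.splitting_pair_iff_card[OF ab v]) auto
      then show ?thesis unfolding balanced_def using deg_eq_card[OF vn] deg_eq_card[OF a(1)] sz by simp
    qed
    \<comment> \<open>the program also tests \<open>a\<close> against itself, which fails for components with more than two vertices\<close>
    have ne: "\<not> balanced (?sz t) a a"
    proof -
      have "a \<notin> nb a" using nbV[OF a(1)] by blast
      then show ?thesis using s3 deg_eq_card[OF a(1)] unfolding balanced_def by simp
    qed
    show "(\<exists>v<n. 0 < D v \<and> balanced (?sz t) a v) \<longleftrightarrow> (\<exists>x y. c.splitting_pair t x y)"
    proof
      assume "\<exists>v<n. 0 < D v \<and> balanced (?sz t) a v"
      then obtain v where v: "v < n" "0 < D v" "balanced (?sz t) a v" by blast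
      then have "a \<noteq> v" "v \<in> c.block t" using ne mem[OF t] by auto
      then show "\<exists>x y. c.splitting_pair t x y" using sp v by blast
    next
      assume "\<exists>x y. c.splitting_pair t x y"
      then obtain x y where xy: "c.splitting_pair t x y" by blast
      have "c.degree a \<le> c.degree v" if "v \<in> c.block t" for v
      proof -
        have "v < n" using that by (simp add: c.block_def)
        then show ?thesis using amin mem[OF t, of v] that deg a(1) by simp
      qed
      then obtain v where v: "c.splitting_pair t a v" using c.splitting_pair_min_degree[OF ab _ xy] by blast
      then have vb: "v \<in> c.block t" "a \<noteq> v" by (auto simp: c.splitting_pair_def)
      then have vn: "v < n" by (simp add: c.block_def)
      then show "\<exists>v<n. 0 < D v \<and> balanced (?sz t) a v" using sp[OF vb] v mem[OF t vn] vb by blast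
    qed
  qed
  show "blocks_value lab D a = g" if "\<nexists>x. B = {x} \<and> 4 \<le> ?cs x" for a
    by (rule reduce) (use that cs4 in blast)
qed

end

lemma global_roman_number_program_correct:
  assumes cg: "cograph {..<n} E" and adj: "adjacency_lists n E adj"
    and W: "num_arrays * length (encode adj) \<le> W"
  shows "wp (length (encode adj)) W program
    (\<lambda>R A t. R 0 = global_roman_number {..<n} E \<and> t \<le> 750 * length (encode adj))
    (\<lambda>_. 0) (input_array (encode adj)) 0"
proof -
  have sg: "simple_graph {..<n} E" using cg by (simp add: cograph_def)
  have nbE: "set (adj ! u) = {v. edge_rel E u v}" if "u < n" for u
    using adj that simple_graph_edge[OF sg] by (auto simp: adjacency_lists_def edge_rel_def)
  interpret p: program_input n adj "length (encode adj)" W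
  proof
    show "set (adj ! u) \<subseteq> {..<n} - {u}" if "u < n" for u
      using nbE[OF that] simple_graph_edge[OF sg] by (auto simp: edge_rel_def)
  qed (use adj W in \<open>auto simp: adjacency_lists_def\<close>)
  let ?r = "edge_rel E" and ?c = "compl_rel {..<n} (edge_rel E)"
  interpret r: cograph_rel "{..<n}" ?r by (rule cograph_rel_edge_rel[OF cg])
  interpret r: cograph_order "{..<n}" ?r ..
  interpret c: cograph_rel "{..<n}" ?c by (rule r.cograph_rel_complement)
  interpret c: cograph_order "{..<n}" ?c ..
  have closed: "p.closed_leader v = leader ?r v" if "v < n" for v
  proof -
    have "(\<lambda>u. Min (insert u (set (adj ! u)))) ` insert v (set (adj ! v)) =
      (\<lambda>u. Min (insert u {w. ?r u w})) ` insert v {u. ?r v u}"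
      using nbE p.nbrs[OF that] that by (intro image_cong) auto
    then show ?thesis unfolding p.closed_leader_def leader_def by simp
  qed
  have co_nbE: "insert u {w. ?c u w} = {..<n} - set (adj ! u)" if "u < n" for u
    using nbE[OF that] that r.irrefl by (auto simp: compl_rel_def)
  have co: "p.co_leader v = leader ?c v" if "v < n" for v
    unfolding p.co_leader_def leader_def co_nbE[OF that] using co_nbE by (intro arg_cong[of _ _ Min] image_cong) auto
  have sym: "u \<in> set (adj ! v) \<longleftrightarrow> v \<in> set (adj ! u)" if "u < n" "v < n" for u v
    using nbE that r.r_sym by blast
  have g: "global_roman_number {..<n} E = (LEAST k. \<exists>f. global_rd {..<n} ?c f \<and> (\<Sum>u<n. f u) = k)"
    unfolding global_roman_number_eq r.global_rd_complement ..
  show ?thesis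
  proof (cases "\<forall>v<n. p.closed_leader v = 0")
    case True
    have k: "leader ?c ` {..<n} \<noteq> {t}" if b: "cograph_components.big {..<n} (leader ?c) = {t}" for t
    proof
      interpret cc: cograph_components "{..<n}" ?c "leader ?c" by (rule c.cograph_components_leader)
      assume i: "leader ?c ` {..<n} = {t}"
      have "2 \<le> card (cc.block t)" using b by (auto simp: cc.big_def)
      then have two: "2 \<le> card {..<n}" using card_mono[OF _ cc.block_subset[of t]] by simp
      then have "0 < n" by simp
      then have "leader ?r ` {..<n} = {0}" using True closed by force
      then show False using not_both_connected[OF r.cograph_components_leader c.cograph_components_leader two _ i] by blast
    qed
    have D: "n - 1 - length (adj ! v) = card {u. ?c v u}" if "v < n" for v
    proof -
      have "{u. ?c v u} = {..<n} - insert v (set (adj ! v))" using nbE[OF that] that by (auto simp: compl_rel_def)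
      moreover have "insert v (set (adj ! v)) \<subseteq> {..<n}" "v \<notin> set (adj ! v)" using p.nbrs[OF that] that by auto
      ultimately show ?thesis using p.deg_eq_card[OF that] by (simp add: card_Diff_subset)
    qed
    have N: "(?c a u \<longleftrightarrow> ?c v u) \<longleftrightarrow> (u \<in> set (adj ! a) \<longleftrightarrow> u \<in> set (adj ! v))"
      if "a < n" "v < n" "u < n" "u \<noteq> a" "u \<noteq> v" for a v u
      using nbE that by (auto simp: compl_rel_def)
    have "leader ?c v < n" if "v < n" for v using c.leader_in_V[of v] that by simp
    note correct = p.blocks_value_correct[OF c.cograph_components_leader this D N sym k, folded g]
    show ?thesis
    proof (rule p.wp_program[where lab = "leader ?c" and D = "\<lambda>v. n - 1 - length (adj ! v)"])
      fix v assume "v < n"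
      then show "leader ?c v = (if \<forall>u<n. p.closed_leader u = 0 then p.co_leader v else p.closed_leader v)"
        "n - 1 - length (adj ! v) = (if \<forall>u<n. p.closed_leader u = 0 then n - 1 - length (adj ! v) else length (adj ! v))"
        "leader ?c v < n"
        using True co c.leader_in_V[of v] by simp_all
    qed (rule correct; assumption)+
  next
    case False
    then obtain v where v: "v < n" "leader ?r v \<noteq> 0" using closed by auto
    have "leader ?r 0 = 0"
    proof -
      have "0 \<in> {..<n}" using v by simp
      have "finite {x. near ?r 0 x}"
        by (rule finite_subset[of _ "insert 0 {..<n}"]) (auto simp: near_def dest: r.in_V')
      then have "Min {x. near ?r 0 x} \<le> 0" by (intro Min_le) (auto simp: near_def)
      then show ?thesis using r.leader_eq_Min_near[OF \<open>0 \<in> {..<n}\<close>] by simp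
    qed
    then have k: "leader ?r ` {..<n} \<noteq> {t}" for t using v
      by (metis imageI lessThan_iff singletonD gr_implies_not0 not_gr_zero)
    have D: "length (adj ! v) = card {u. ?r v u}" if "v < n" for v
      using p.deg_eq_card[OF that] nbE[OF that] by simp
    have N: "(?r a u \<longleftrightarrow> ?r v u) \<longleftrightarrow> (u \<in> set (adj ! a) \<longleftrightarrow> u \<in> set (adj ! v))"
      if "a < n" "v < n" "u < n" "u \<noteq> a" "u \<noteq> v" for a v u
      using nbE that by auto
    have "leader ?r v < n" if "v < n" for v using r.leader_in_V[of v] that by simp
    note correct = p.blocks_value_correct[OF r.cograph_components_leader this D N sym k,
        folded global_roman_number_eq]
    show ?thesis
    proof (rule p.wp_program[where lab = "leader ?r" and D = "\<lambda>v. length (adj ! v)"])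
      fix v assume "v < n"
      then show "leader ?r v = (if \<forall>u<n. p.closed_leader u = 0 then p.co_leader v else p.closed_leader v)"
        "length (adj ! v) = (if \<forall>u<n. p.closed_leader u = 0 then n - 1 - length (adj ! v) else length (adj ! v))"
        "leader ?r v < n"
        unfolding if_not_P[OF False] using closed r.leader_in_V[of v] by simp_all
    qed (rule correct; assumption)+
  qed
qed

theorem theorem4p7:
  "linear_time_computable cograph global_roman_number"
proof (rule linear_time_computableI[OF wf_program])
  show "simple_graph {..<n} E" if "cograph {..<n} E" for n E using that by (simp add: cograph_def)
  fix n E adj W
  assume cg: "cograph {..<n} E" and adj: "adjacency_lists n E adj"
    and W: "num_arrays * length (encode adj) \<le> W"
  have sg: "simple_graph {..<n} E" using cg by (simp add: cograph_def)
  have "length adj = n" using adj by (simp add: adjacency_lists_def)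
  then have "length (encode adj) \<le> 2 * (n + card E + 1)"
    using sum_degrees_le[OF sg adj] by (simp add: length_encode offset_def)
  then show "wp (length (encode adj)) W program
    (\<lambda>R A t. R 0 = global_roman_number {..<n} E \<and> t \<le> 1500 * (n + card E + 1))
    (\<lambda>_. 0) (input_array (encode adj)) 0"
    using global_roman_number_program_correct[OF cg adj W] by (elim wp_mono) auto
qed

end
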